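(* Let $\pi:E\to B$ be a fiber bundle and $\Pi$ a coupling Poisson tensor on $E$ with vertical part $P$. Assume that $$\operatorname{Poiss}_V(E,P)=\operatorname{Ham}(E,P),$$ and that there exists a flat Poisson connection on $(E,P)$, i.e. a regular foliation $\mathcal F$ on $E$ such that $TE=T\mathcal F\oplus\mathbb V$ and $L_ZP=0$ for all $Z\in\Gamma_{\pi\text{-}\mathrm{pr}}(T\mathcal F)$. Suppose in addition that (for this $\mathcal F$): (i) the first foliated de Rham cohomology group of $(E,\mathcal F)$ is trivial, $H^1_{\mathrm{dR}}(\mathcal F)=\{0\}$; (ii) the subalgebra of Hamiltonian vector fields on $(E,P)$ preserving the foliation $\mathcal F$ is generated by the subspace $C^\infty_{\mathcal F}(E)$, i.e. $\operatorname{Ham}_{\mathcal F}(E,P)=\{P^\sharp dH: H\in C^\infty_{\mathcal F}(E)\}$. Then the first Poisson cohomology of the coupling Poisson tensor $\Pi$ vanishes: $H^1_\Pi(E)=\{0\}$.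
   Context: Everything is smooth. For a Poisson tensor $\Pi$ on $E$ ($[\Pi,\Pi]=0$), $\Pi^\sharp:T^*E\to TE$ is given by $\langle\beta,\Pi^\sharp\alpha\rangle=\Pi(\alpha,\beta)$; $\operatorname{Poiss}(E,\Pi)=\{Z\in\mathfrak X(E):L_Z\Pi=0\}$, $\operatorname{Ham}(E,\Pi)=\{\Pi^\sharp dF:F\in C^\infty(E)\}$, $H^1_\Pi(E)=\operatorname{Poiss}(E,\Pi)/\operatorname{Ham}(E,\Pi)$. A fiber bundle $\pi:E\to B$ is a surjective submersion; $\mathbb V=\ker d\pi$, $\mathbb V^0\subset T^*E$ its annihilator. $\Pi$ is a coupling Poisson tensor if $TE=\mathbb H\oplus\mathbb V$ with $\mathbb H:=\Pi^\sharp(\mathbb V^0)$. Then $\Pi=\Pi_{2,0}+P$ with $\Pi_{2,0}\in\Gamma(\wedge^2\mathbb H)$ and the vertical part $P=\Pi_{0,2}\in\Gamma(\wedge^2\mathbb V)$, a Poisson tensor. $\operatorname{Poiss}_V(E,P)=\{Y\in\Gamma(\mathbb V):L_YP=0\}$. For a subbundle $F\subset TE$, $\Gamma_{\pi\text{-}\mathrm{pr}}(F)$ is the set of sections of $F$ that are $\pi$-projectable (i.e. $\pi$-related to a vector field on $B$). An Ehresmann connection $\gamma$ on $E$ (a splitting $TE=\mathbb H^\gamma\oplus\mathbb V$) is Poisson on $(E,P)$ if all horizontal lifts of vector fields on $B$ preserve $P$; flat means $\mathbb H^\gamma$ is integrable; $\mathcal F$ is then the foliation with $T\mathcal F=\mathbb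 H^\gamma$. $H^*_{\mathrm{dR}}(\mathcal F)$ is the cohomology of the foliated de Rham complex $(\Gamma(\wedge^*(T\mathcal F)^* ),d_{\mathcal F})$ with $d_{\mathcal F}$ the leafwise exterior differential. $C^\infty_{\mathcal F}(E)=\{H\in C^\infty(E):d_{\mathcal F}H=0\}$, and $\operatorname{Ham}_{\mathcal F}(E,P)=\{Y\in\operatorname{Ham}(E,P):[Y,Z]=0\ \forall Z\in\Gamma_{\pi\text{-}\mathrm{pr}}(T\mathcal F)\}$. *)

theory Defs
  imports "HOL-Analysis.Analysis" "HOL-Library.Function_Algebras"
begin

text \<open>Tangent vectors, covectors and bivectors are all represented by functions; all linear operations
  on them are pointwise.\<close>

instantiation "fun" :: (type, real_vector) real_vector
begin

definition scaleR_fun_def: "c *\<^sub>R f = (\<lambda>x. c *\<^sub>R f x)"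

instance
  by standard (simp_all add: scaleR_fun_def plus_fun_def scaleR_add_left scaleR_add_right)

end

text \<open>Model spaces of charts. Unlike \<^class>\<open>euclidean_space\<close>, this class admits the
  zero-dimensional space.\<close>

class model_space = real_inner + banach + heine_borel +
  assumes ex_finite_orthonormal_basis:
    "\<exists>B. finite B \<and> (\<forall>u\<in>B. \<forall>v\<in>B. inner u v = (if u = v then 1 else 0)) \<and>
         (\<forall>x. (\<forall>u\<in>B. inner x u = 0) \<longrightarrow> x = 0)"

instance euclidean_space \<subseteq> model_space
proof
  show "\<exists>B::'a set. finite B \<and> (\<forall>u\<in>B. \<forall>v\<in>B. inner u v = (if u = v then 1 else 0)) \<and>
         (\<forall>x. (\<forall>u\<in>B. inner x u = 0) \<longrightarrow> x = 0)"
    by (intro exI[of _ Basis]) (simp add: inner_Basis euclidean_all_zero_iff)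
qed

text \<open>Both notions below are meant for open \<open>S\<close> in a finite-dimensional domain, where
  having all iterated directional derivatives differentiable is ordinary smoothness.\<close>

primrec Ck_on :: "nat \<Rightarrow> ('a::real_normed_vector \<Rightarrow> 'b::real_normed_vector) \<Rightarrow> 'a set \<Rightarrow> bool" where
  "Ck_on 0 f S \<longleftrightarrow> continuous_on S f"
| "Ck_on (Suc k) f S \<longleftrightarrow>
     (\<forall>x\<in>S. f differentiable (at x)) \<and> (\<forall>w. Ck_on k (\<lambda>x. frechet_derivative f (at x) w) S)"

definition smooth_on :: "('a::real_normed_vector \<Rightarrow> 'b::real_normed_vector) \<Rightarrow> 'a set \<Rightarrow> bool" where
  "smooth_on f S \<longleftrightarrow> (\<forall>k. Ck_on k f S)"

type_synonym ('e, 'm) chart = "'e set \<times> ('e \<Rightarrow> 'm)"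

definition is_chart :: "('e::topological_space, 'm::model_space) chart \<Rightarrow> bool" where
  "is_chart c \<longleftrightarrow> (case c of (U, \<phi>) \<Rightarrow>
     open U \<and> open (\<phi> ` U) \<and> homeomorphism U (\<phi> ` U) \<phi> (inv_into U \<phi>))"

definition compatible :: "('e, 'm::model_space) chart \<Rightarrow> ('e, 'm) chart \<Rightarrow> bool" where
  "compatible c c' \<longleftrightarrow> (case c of (U, \<phi>) \<Rightarrow> case c' of (U', \<phi>') \<Rightarrow>
     smooth_on (\<phi>' \<circ> inv_into U \<phi>) (\<phi> ` (U \<inter> U')) \<and>
     smooth_on (\<phi> \<circ> inv_into U' \<phi>') (\<phi>' ` (U \<inter> U')))"

text \<open>A manifold is given by an atlas on a whole type; Hausdorffness and second countability are
  imposed by the type class of the underlying space.\<close>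

definition smooth_manifold ::
    "('e::{t2_space,second_countable_topology}, 'm::model_space) chart set \<Rightarrow> bool" where
  "smooth_manifold E \<longleftrightarrow>
     (\<forall>c\<in>E. is_chart c) \<and> (\<Union>(U, \<phi>)\<in>E. U) = UNIV \<and> (\<forall>c\<in>E. \<forall>c'\<in>E. compatible c c')"

definition max_atlas :: "('e::topological_space, 'm::model_space) chart set \<Rightarrow> ('e, 'm) chart set" where
  "max_atlas E = {c. is_chart c \<and> (\<forall>c'\<in>E. compatible c c')}"

definition Cinf :: "('e, 'm::model_space) chart set \<Rightarrow> ('e \<Rightarrow> real) set" where
  "Cinf E = {f. \<forall>(U, \<phi>)\<in>E. smooth_on (f \<circ> inv_into U \<phi>) (\<phi> ` U)}"

definition smooth_map :: "('e::topological_space, 'm::model_space) chart set \<Rightarrow>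
    ('b::topological_space, 'n::model_space) chart set \<Rightarrow> ('e \<Rightarrow> 'b) \<Rightarrow> bool" where
  "smooth_map E B \<pi> \<longleftrightarrow> continuous_on UNIV \<pi> \<and>
     (\<forall>(U, \<phi>)\<in>E. \<forall>(W, \<psi>)\<in>B. smooth_on (\<psi> \<circ> \<pi> \<circ> inv_into U \<phi>) (\<phi> ` (U \<inter> \<pi> -` W)))"

text \<open>Tangent vectors at \<open>p\<close> are the derivations of the algebra of global smooth functions at \<open>p\<close>.
  Since HOL functions are total, vectors and forms are normalized to be \<open>0\<close> outside their intended
  domain, so that equality of HOL functions is equality of tensors.\<close>

type_synonym 'e tvec = "('e \<Rightarrow> real) \<Rightarrow> real"
type_synonym 'e covec = "'e tvec \<Rightarrow> real"
type_synonym 'e bivec = "'e covec \<Rightarrow> 'e covec \<Rightarrow> real"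

definition tangent :: "('e, 'm::model_space) chart set \<Rightarrow> 'e \<Rightarrow> 'e tvec set" where
  "tangent E p = {v.
     (\<forall>f\<in>Cinf E. \<forall>g\<in>Cinf E. v (f + g) = v f + v g) \<and>
     (\<forall>c. \<forall>f\<in>Cinf E. v (c *\<^sub>R f) = c * v f) \<and>
     (\<forall>f\<in>Cinf E. \<forall>g\<in>Cinf E. v (f * g) = f p * v g + g p * v f) \<and>
     (\<forall>f. f \<notin> Cinf E \<longrightarrow> v f = 0)}"

definition functionals_on :: "'v::real_vector set \<Rightarrow> ('v \<Rightarrow> real) set" where
  "functionals_on W = {\<alpha>.
     (\<forall>v\<in>W. \<forall>w\<in>W. \<alpha> (v + w) = \<alpha> v + \<alpha> w) \<and>
     (\<forall>c. \<forall>v\<in>W. \<alpha> (c *\<^sub>R v) = c * \<alpha> v) \<and>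
     (\<forall>v. v \<notin> W \<longrightarrow> \<alpha> v = 0)}"

definition cotangent :: "('e, 'm::model_space) chart set \<Rightarrow> 'e \<Rightarrow> 'e covec set" where
  "cotangent E p = functionals_on (tangent E p)"

definition diff :: "('e, 'm::model_space) chart set \<Rightarrow> ('e \<Rightarrow> real) \<Rightarrow> 'e \<Rightarrow> 'e covec" where
  "diff E f p = (\<lambda>v. if v \<in> tangent E p then v f else 0)"

definition dmap :: "('b, 'n::model_space) chart set \<Rightarrow> ('e \<Rightarrow> 'b) \<Rightarrow> 'e tvec \<Rightarrow> 'b tvec" where
  "dmap B \<pi> v = (\<lambda>f. if f \<in> Cinf B then v (f \<circ> \<pi>) else 0)"

definition vector_fields :: "('e, 'm::model_space) chart set \<Rightarrow> ('e \<Rightarrow> 'e tvec) set" where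
  "vector_fields E = {X. (\<forall>p. X p \<in> tangent E p) \<and> (\<forall>f\<in>Cinf E. (\<lambda>p. X p f) \<in> Cinf E)}"

definition sections :: "('e, 'm::model_space) chart set \<Rightarrow> ('e \<Rightarrow> 'e tvec set) \<Rightarrow> ('e \<Rightarrow> 'e tvec) set" where
  "sections E D = {X \<in> vector_fields E. \<forall>p. X p \<in> D p}"

definition lie_bracket :: "('e \<Rightarrow> 'e tvec) \<Rightarrow> ('e \<Rightarrow> 'e tvec) \<Rightarrow> 'e \<Rightarrow> 'e tvec" where
  "lie_bracket X Y = (\<lambda>p f. X p (\<lambda>q. Y q f) - Y p (\<lambda>q. X q f))"

definition one_forms :: "('e, 'm::model_space) chart set \<Rightarrow> ('e \<Rightarrow> 'e covec) set" where
  "one_forms E = {\<alpha>. (\<forall>p. \<alpha> p \<in> cotangent E p) \<and>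
     (\<forall>X\<in>vector_fields E. (\<lambda>p. \<alpha> p (X p)) \<in> Cinf E)}"

definition direct_sum :: "'v::real_vector set \<Rightarrow> 'v set \<Rightarrow> 'v set \<Rightarrow> bool" where
  "direct_sum T H V \<longleftrightarrow> subspace H \<and> subspace V \<and> T = {h + v |h v. h \<in> H \<and> v \<in> V} \<and> H \<inter> V = {0}"

text \<open>The quotient of \<open>S\<close> by a subspace \<open>R\<close>; for \<open>R \<subseteq> S\<close> it is the zero space iff it equals \<open>{R}\<close>.\<close>

definition quotient_space :: "'v::ab_group_add set \<Rightarrow> 'v set \<Rightarrow> 'v set set" where
  "quotient_space S R = S // {(x, y). x \<in> S \<and> y \<in> S \<and> x - y \<in> R}"

definition bivectors :: "('e, 'm::model_space) chart set \<Rightarrow> 'e \<Rightarrow> 'e bivec set" where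
  "bivectors E p = {b.
     (\<forall>\<alpha>\<in>cotangent E p. b \<alpha> \<in> functionals_on (cotangent E p)) \<and>
     (\<forall>\<alpha>\<in>cotangent E p. b \<alpha> \<alpha> = 0) \<and>
     (\<forall>\<alpha>\<in>cotangent E p. \<forall>\<beta>\<in>cotangent E p. b \<alpha> \<beta> = - b \<beta> \<alpha>) \<and>
     (\<forall>\<alpha>. \<alpha> \<notin> cotangent E p \<longrightarrow> b \<alpha> = 0)}"

definition wedge :: "('e, 'm::model_space) chart set \<Rightarrow> 'e \<Rightarrow> 'e tvec \<Rightarrow> 'e tvec \<Rightarrow> 'e bivec" where
  "wedge E p v w = (\<lambda>\<alpha> \<beta>. if \<alpha> \<in> cotangent E p \<and> \<beta> \<in> cotangent E p
     then \<alpha> v * \<beta> w - \<alpha> w * \<beta> v else 0)"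

definition bivector_fields :: "('e, 'm::model_space) chart set \<Rightarrow> ('e \<Rightarrow> 'e bivec) set" where
  "bivector_fields E = {A. (\<forall>p. A p \<in> bivectors E p) \<and>
     (\<forall>\<alpha>\<in>one_forms E. \<forall>\<beta>\<in>one_forms E. (\<lambda>p. A p (\<alpha> p) (\<beta> p)) \<in> Cinf E)}"

definition bivector_sections ::
    "('e, 'm::model_space) chart set \<Rightarrow> ('e \<Rightarrow> 'e tvec set) \<Rightarrow> ('e \<Rightarrow> 'e bivec) set" where
  "bivector_sections E D = {A \<in> bivector_fields E.
     \<forall>p. A p \<in> span {wedge E p v w |v w. v \<in> D p \<and> w \<in> D p}}"

definition on_diffs :: "('e, 'm::model_space) chart set \<Rightarrow> ('e \<Rightarrow> 'e bivec) \<Rightarrow>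
    ('e \<Rightarrow> real) \<Rightarrow> ('e \<Rightarrow> real) \<Rightarrow> 'e \<Rightarrow> real" where
  "on_diffs E A f g = (\<lambda>p. A p (diff E f p) (diff E g p))"

text \<open>The Schouten bracket \<open>[A,C]\<close> of bivector fields and the Lie derivative \<open>L\<^sub>Z A\<close>, evaluated on
  the differentials of smooth functions. As every covector at a point is the differential of a
  smooth function, these values determine the tensors.\<close>

definition schouten :: "('e, 'm::model_space) chart set \<Rightarrow> ('e \<Rightarrow> 'e bivec) \<Rightarrow> ('e \<Rightarrow> 'e bivec) \<Rightarrow>
    ('e \<Rightarrow> real) \<Rightarrow> ('e \<Rightarrow> real) \<Rightarrow> ('e \<Rightarrow> real) \<Rightarrow> 'e \<Rightarrow> real" where
  "schouten E A C f g h =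
     (on_diffs E A (on_diffs E C f g) h + on_diffs E C (on_diffs E A f g) h) +
     (on_diffs E A (on_diffs E C g h) f + on_diffs E C (on_diffs E A g h) f) +
     (on_diffs E A (on_diffs E C h f) g + on_diffs E C (on_diffs E A h f) g)"

definition poisson_tensor :: "('e, 'm::model_space) chart set \<Rightarrow> ('e \<Rightarrow> 'e bivec) \<Rightarrow> bool" where
  "poisson_tensor E \<Lambda> \<longleftrightarrow> \<Lambda> \<in> bivector_fields E \<and>
     (\<forall>f\<in>Cinf E. \<forall>g\<in>Cinf E. \<forall>h\<in>Cinf E. schouten E \<Lambda> \<Lambda> f g h = 0)"

definition lie_derivative :: "('e, 'm::model_space) chart set \<Rightarrow> ('e \<Rightarrow> 'e tvec) \<Rightarrow>
    ('e \<Rightarrow> 'e bivec) \<Rightarrow> ('e \<Rightarrow> real) \<Rightarrow> ('e \<Rightarrow> real) \<Rightarrow> 'e \<Rightarrow> real" where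
  "lie_derivative E Z A f g = (\<lambda>p. Z p (on_diffs E A f g)
     - on_diffs E A (\<lambda>q. Z q f) g p - on_diffs E A f (\<lambda>q. Z q g) p)"

definition preserves :: "('e, 'm::model_space) chart set \<Rightarrow> ('e \<Rightarrow> 'e tvec) \<Rightarrow> ('e \<Rightarrow> 'e bivec) \<Rightarrow> bool" where
  "preserves E Z A \<longleftrightarrow> (\<forall>f\<in>Cinf E. \<forall>g\<in>Cinf E. lie_derivative E Z A f g = 0)"

definition sharp :: "('e, 'm::model_space) chart set \<Rightarrow> ('e \<Rightarrow> 'e bivec) \<Rightarrow> 'e \<Rightarrow> 'e covec \<Rightarrow> 'e tvec" where
  "sharp E A p \<alpha> = (THE v. v \<in> tangent E p \<and> (\<forall>\<beta>\<in>cotangent E p. \<beta> v = A p \<alpha> \<beta>))"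

definition ham_field :: "('e, 'm::model_space) chart set \<Rightarrow> ('e \<Rightarrow> 'e bivec) \<Rightarrow>
    ('e \<Rightarrow> real) \<Rightarrow> 'e \<Rightarrow> 'e tvec" where
  "ham_field E A F = (\<lambda>p. sharp E A p (diff E F p))"

definition Ham :: "('e, 'm::model_space) chart set \<Rightarrow> ('e \<Rightarrow> 'e bivec) \<Rightarrow> ('e \<Rightarrow> 'e tvec) set" where
  "Ham E A = {ham_field E A F |F. F \<in> Cinf E}"

definition Poiss :: "('e, 'm::model_space) chart set \<Rightarrow> ('e \<Rightarrow> 'e bivec) \<Rightarrow> ('e \<Rightarrow> 'e tvec) set" where
  "Poiss E A = {Z \<in> vector_fields E. preserves E Z A}"

definition poisson_H1 ::
    "('e, 'm::model_space) chart set \<Rightarrow> ('e \<Rightarrow> 'e bivec) \<Rightarrow> ('e \<Rightarrow> 'e tvec) set set" where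
  "poisson_H1 E \<Lambda> = quotient_space (Poiss E \<Lambda>) (Ham E \<Lambda>)"

definition fiber_bundle :: "('e::topological_space, 'm::model_space) chart set \<Rightarrow>
    ('b::topological_space, 'n::model_space) chart set \<Rightarrow> ('e \<Rightarrow> 'b) \<Rightarrow> bool" where
  "fiber_bundle E B \<pi> \<longleftrightarrow> smooth_map E B \<pi> \<and> surj \<pi> \<and>
     (\<forall>p. dmap B \<pi> ` tangent E p = tangent B (\<pi> p))"

definition vertical :: "('e, 'm::model_space) chart set \<Rightarrow> ('b, 'n::model_space) chart set \<Rightarrow>
    ('e \<Rightarrow> 'b) \<Rightarrow> 'e \<Rightarrow> 'e tvec set" where
  "vertical E B \<pi> p = {v \<in> tangent E p. dmap B \<pi> v = 0}"

definition annihilator :: "('e, 'm::model_space) chart set \<Rightarrow> ('e \<Rightarrow> 'e tvec set) \<Rightarrow> 'e \<Rightarrow> 'e covec set" where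
  "annihilator E D p = {\<alpha> \<in> cotangent E p. \<forall>v\<in>D p. \<alpha> v = 0}"

definition coupling_horizontal :: "('e, 'm::model_space) chart set \<Rightarrow>
    ('b, 'n::model_space) chart set \<Rightarrow> ('e \<Rightarrow> 'b) \<Rightarrow> ('e \<Rightarrow> 'e bivec) \<Rightarrow> 'e \<Rightarrow> 'e tvec set" where
  "coupling_horizontal E B \<pi> \<Lambda> p = sharp E \<Lambda> p ` annihilator E (vertical E B \<pi>) p"

definition coupling_poisson :: "('e, 'm::model_space) chart set \<Rightarrow>
    ('b, 'n::model_space) chart set \<Rightarrow> ('e \<Rightarrow> 'b) \<Rightarrow> ('e \<Rightarrow> 'e bivec) \<Rightarrow> bool" where
  "coupling_poisson E B \<pi> \<Lambda> \<longleftrightarrow> poisson_tensor E \<Lambda> \<and>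
     (\<forall>p. direct_sum (tangent E p) (coupling_horizontal E B \<pi> \<Lambda> p) (vertical E B \<pi> p))"

definition vertical_part :: "('e, 'm::model_space) chart set \<Rightarrow> ('b, 'n::model_space) chart set \<Rightarrow>
    ('e \<Rightarrow> 'b) \<Rightarrow> ('e \<Rightarrow> 'e bivec) \<Rightarrow> ('e \<Rightarrow> 'e bivec) \<Rightarrow> bool" where
  "vertical_part E B \<pi> \<Lambda> P \<longleftrightarrow> P \<in> bivector_sections E (vertical E B \<pi>) \<and>
     (\<exists>Q \<in> bivector_sections E (coupling_horizontal E B \<pi> \<Lambda>). \<Lambda> = Q + P)"

definition Poiss_V :: "('e, 'm::model_space) chart set \<Rightarrow> ('b, 'n::model_space) chart set \<Rightarrow>
    ('e \<Rightarrow> 'b) \<Rightarrow> ('e \<Rightarrow> 'e bivec) \<Rightarrow> ('e \<Rightarrow> 'e tvec) set" where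
  "Poiss_V E B \<pi> P = {Y \<in> sections E (vertical E B \<pi>). preserves E Y P}"

definition projectable_sections :: "('e, 'm::model_space) chart set \<Rightarrow>
    ('b, 'n::model_space) chart set \<Rightarrow> ('e \<Rightarrow> 'b) \<Rightarrow> ('e \<Rightarrow> 'e tvec set) \<Rightarrow> ('e \<Rightarrow> 'e tvec) set" where
  "projectable_sections E B \<pi> D = {X \<in> sections E D.
     \<exists>u\<in>vector_fields B. \<forall>p. dmap B \<pi> (X p) = u (\<pi> p)}"

text \<open>The tangent vector at \<open>q\<close> with component vector \<open>w\<close> in the chart \<open>(U, \<phi>)\<close>.\<close>

definition coord_vector :: "('e, 'm::model_space) chart set \<Rightarrow> ('e, 'm) chart \<Rightarrow> 'e \<Rightarrow> 'm \<Rightarrow> 'e tvec" where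
  "coord_vector E c q w = (case c of (U, \<phi>) \<Rightarrow>
     (\<lambda>f. if f \<in> Cinf E then frechet_derivative (f \<circ> inv_into U \<phi>) (at (\<phi> q)) w else 0))"

text \<open>A regular foliation is represented by its tangent distribution \<open>TF\<close>: around each point there
  is a foliated chart, in which \<open>TF\<close> is the constant distribution with value a subspace \<open>K\<close>.\<close>

definition foliation :: "('e::topological_space, 'm::model_space) chart set \<Rightarrow>
    ('e \<Rightarrow> 'e tvec set) \<Rightarrow> bool" where
  "foliation E TF \<longleftrightarrow> (\<forall>p. \<exists>(U, \<phi>)\<in>max_atlas E. p \<in> U \<and>
     (\<exists>K. subspace K \<and> (\<forall>q\<in>U. TF q = coord_vector E (U, \<phi>) q ` K)))"

text \<open>Foliated forms of degree 0 are smooth functions, those of degree 1 are sections of the dual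
  bundle of \<open>TF\<close>.\<close>

definition fol_one_forms ::
    "('e, 'm::model_space) chart set \<Rightarrow> ('e \<Rightarrow> 'e tvec set) \<Rightarrow> ('e \<Rightarrow> 'e covec) set" where
  "fol_one_forms E TF = {\<alpha>. (\<forall>p. \<alpha> p \<in> functionals_on (TF p)) \<and>
     (\<forall>X\<in>sections E TF. (\<lambda>p. \<alpha> p (X p)) \<in> Cinf E)}"

definition fol_d0 :: "('e \<Rightarrow> 'e tvec set) \<Rightarrow> ('e \<Rightarrow> real) \<Rightarrow> 'e \<Rightarrow> 'e covec" where
  "fol_d0 TF H = (\<lambda>p v. if v \<in> TF p then v H else 0)"

definition fol_d1 :: "('e \<Rightarrow> 'e covec) \<Rightarrow> ('e \<Rightarrow> 'e tvec) \<Rightarrow> ('e \<Rightarrow> 'e tvec) \<Rightarrow> 'e \<Rightarrow> real" where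
  "fol_d1 \<alpha> X Y = (\<lambda>p. X p (\<lambda>q. \<alpha> q (Y q)) - Y p (\<lambda>q. \<alpha> q (X q)) - \<alpha> p (lie_bracket X Y p))"

definition fol_Z1 ::
    "('e, 'm::model_space) chart set \<Rightarrow> ('e \<Rightarrow> 'e tvec set) \<Rightarrow> ('e \<Rightarrow> 'e covec) set" where
  "fol_Z1 E TF = {\<alpha> \<in> fol_one_forms E TF.
     \<forall>X\<in>sections E TF. \<forall>Y\<in>sections E TF. fol_d1 \<alpha> X Y = 0}"

definition fol_B1 ::
    "('e, 'm::model_space) chart set \<Rightarrow> ('e \<Rightarrow> 'e tvec set) \<Rightarrow> ('e \<Rightarrow> 'e covec) set" where
  "fol_B1 E TF = fol_d0 TF ` Cinf E"

definition fol_H1 ::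
    "('e, 'm::model_space) chart set \<Rightarrow> ('e \<Rightarrow> 'e tvec set) \<Rightarrow> ('e \<Rightarrow> 'e covec) set set" where
  "fol_H1 E TF = quotient_space (fol_Z1 E TF) (fol_B1 E TF)"

definition Cinf_fol ::
    "('e, 'm::model_space) chart set \<Rightarrow> ('e \<Rightarrow> 'e tvec set) \<Rightarrow> ('e \<Rightarrow> real) set" where
  "Cinf_fol E TF = {H \<in> Cinf E. fol_d0 TF H = 0}"

definition Ham_fol :: "('e, 'm::model_space) chart set \<Rightarrow> ('b, 'n::model_space) chart set \<Rightarrow>
    ('e \<Rightarrow> 'b) \<Rightarrow> ('e \<Rightarrow> 'e tvec set) \<Rightarrow> ('e \<Rightarrow> 'e bivec) \<Rightarrow> ('e \<Rightarrow> 'e tvec) set" where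
  "Ham_fol E B \<pi> TF P =
     {Y \<in> Ham E P. \<forall>Z\<in>projectable_sections E B \<pi> TF. lie_bracket Y Z = 0}"

end

theory Submission
  imports Defs
begin

text \<open>Write \<open>\<Lambda> = Q + P\<close> with \<open>Q\<close> horizontal and \<open>P\<close> vertical, let \<open>V\<close> be the vertical bundle, \<open>V\<^sup>0\<close> its
  annihilator and \<open>H = \<Lambda>\<^sup>\<sharp>(V\<^sup>0)\<close>. The proof rests on one observation
  (\<open>projectable_congruent_preserves_P\<close>): a projectable vector field that differs from a Poisson field
  of \<open>\<Lambda>\<close> by a section of \<open>H\<close> preserves \<open>P\<close>. It is used twice.

  First, let \<open>Z\<close> be a Poisson field of \<open>\<Lambda>\<close>. Its vertical part is projectable (to zero) and congruent
  to \<open>Z\<close>, so it preserves \<open>P\<close> and is \<open>P\<^sup>\<sharp>dF\<close> for some \<open>F\<close>. Then \<open>X = Z - \<Lambda>\<^sup>\<sharp>dF\<close> is a Poisson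
  field and a section of \<open>H\<close>, that is, \<open>X = \<Lambda>\<^sup>\<sharp>\<beta>\<close> for a section \<open>\<beta>\<close> of \<open>V\<^sup>0\<close>, and \<open>L\<^sub>X\<Lambda> = 0\<close> means
  that \<open>d\<beta>\<close> vanishes on pairs of vectors in the image of \<open>\<Lambda>\<^sup>\<sharp>\<close> (\<open>horizontal_poisson_form\<close>).

  Second, the horizontal part of a projectable section \<open>Z\<close> of the foliation is congruent to the zero
  field, hence preserves \<open>P\<close>; so does \<open>Z\<close>, and the difference, being vertical, is \<open>P\<^sup>\<sharp>dG\<close> for some
  \<open>G\<close>. Thus \<open>TF \<subseteq> H + im P\<^sup>\<sharp> \<subseteq> im \<Lambda>\<^sup>\<sharp>\<close> and \<open>H \<subseteq> TF + im P\<^sup>\<sharp>\<close>. By the first inclusion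
  \<open>\<beta>\<close> is closed along the leaves, so it has a leafwise primitive: there is \<open>K\<close> with \<open>\<beta> = dK\<close> on \<open>TF\<close>. The pairing
  \<open>d\<beta>(P\<^sup>\<sharp>df, Z) = 0\<close> says that \<open>Z K = \<beta>(Z)\<close> is a Casimir function of \<open>P\<close> for every projectable
  section \<open>Z\<close> of \<open>TF\<close>, so \<open>P\<^sup>\<sharp>dK\<close> commutes with all of these. By assumption there is a leafwise
  constant \<open>L\<close> with \<open>P\<^sup>\<sharp>dK = P\<^sup>\<sharp>dL\<close>. Now \<open>d(K - L)\<close> agrees with \<open>\<beta>\<close> on \<open>TF\<close> and both vanish on
  \<open>im P\<^sup>\<sharp>\<close>, so they agree on \<open>H\<close>; together with \<open>P\<^sup>\<sharp>d(K - L) = 0 = P\<^sup>\<sharp>\<beta>\<close> this yields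
  \<open>X = \<Lambda>\<^sup>\<sharp>d(K - L)\<close> and \<open>Z = \<Lambda>\<^sup>\<sharp>d(F + K - L)\<close>.

  The foundations serve two purposes. Tangent vectors are derivations of the algebra of smooth
  functions, and Hadamard's lemma with bump functions shows that they are local and have a finite
  coordinate expansion; hence every covector is a differential and \<open>A\<^sup>\<sharp>\<close> is well defined for every
  bivector field \<open>A\<close>. Smoothness of horizontal parts and lifts is reduced to local frames of a complement of
  \<open>V\<close> dual to coordinates pulled back from the base; such frames come from an elimination procedure
  (\<open>dual_fields_near\<close>) that stays within a prescribed module of vector fields.\<close>

section \<open>Calculus of smooth functions on open sets\<close>

lemma Ck_on_subset: "Ck_on k f S \<Longrightarrow> T \<subseteq> S \<Longrightarrow> Ck_on k f T"
  by (induction k arbitrary: f) (auto intro: continuous_on_subset)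

lemma Ck_on_SucD: "Ck_on (Suc k) f S \<Longrightarrow> Ck_on k f S"
proof (induction k arbitrary: f)
  case 0
  then show ?case
    by (auto intro!: continuous_at_imp_continuous_on differentiable_imp_continuous_within)
next
  case (Suc k)
  then show ?case by (metis Ck_on.simps(2))
qed

lemma Ck_on_cong:
  assumes "open S" "\<And>x. x \<in> S \<Longrightarrow> f x = g x"
  shows "Ck_on k f S \<longleftrightarrow> Ck_on k g S"
  using assms(2)
proof (induction k arbitrary: f g)
  case 0
  then show ?case by (auto cong: continuous_on_cong)
next
  case (Suc k)
  have dif: "f differentiable (at x) \<longleftrightarrow> g differentiable (at x)" if "x \<in> S" for x
    unfolding differentiable_def
    using has_derivative_transform_within_open[OF _ \<open>open S\<close> that] Suc.prems by metis
  have fre: "frechet_derivative f (at x) = frechet_derivative g (at x)" if "x \<in> S" for x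
    unfolding frechet_derivative_def
    using has_derivative_transform_within_open[OF _ \<open>open S\<close> that] Suc.prems by metis
  have "Ck_on k (\<lambda>x. frechet_derivative f (at x) w) S \<longleftrightarrow> Ck_on k (\<lambda>x. frechet_derivative g (at x) w) S" for w
    by (rule Suc.IH) (simp add: fre)
  with dif show ?case by simp
qed

lemma Ck_on_local:
  assumes "\<And>x. x \<in> S \<Longrightarrow> \<exists>U. open U \<and> x \<in> U \<and> Ck_on k f U"
  shows "Ck_on k f S"
  using assms
proof (induction k arbitrary: f)
  case 0
  show ?case unfolding Ck_on.simps
    by (rule continuous_at_imp_continuous_on)
      (use 0 in \<open>force simp: continuous_on_eq_continuous_at\<close>)
next
  case (Suc k)
  show ?case
    unfolding Ck_on.simps
  proof (intro conjI ballI allI)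
    show "f differentiable at x" if "x \<in> S" for x
      using Suc.prems[OF that] by auto
    show "Ck_on k (\<lambda>x. frechet_derivative f (at x) w) S" for w
      by (rule Suc.IH) (use Suc.prems in fastforce)
  qed
qed

lemma Ck_on_SucI:
  assumes "open S" "\<And>x. x \<in> S \<Longrightarrow> (f has_derivative f' x) (at x)"
    "\<And>w. Ck_on k (\<lambda>x. f' x w) S"
  shows "Ck_on (Suc k) f S"
proof -
  have "Ck_on k (\<lambda>x. frechet_derivative f (at x) w) S" for w
    by (subst Ck_on_cong[OF \<open>open S\<close>, where g="\<lambda>x. f' x w"])
      (use assms frechet_derivative_at[OF assms(2)] in \<open>auto simp: fun_eq_iff\<close>)
  with assms(2) show ?thesis by (auto simp: differentiable_def)
qed

lemma Ck_on_Suc_has_derivative: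
  "Ck_on (Suc k) f S \<Longrightarrow> x \<in> S \<Longrightarrow> (f has_derivative frechet_derivative f (at x)) (at x)"
  by (simp add: frechet_derivative_works)

lemma Ck_on_const: "open S \<Longrightarrow> Ck_on k (\<lambda>x. c) S"
  by (induction k arbitrary: c) (auto simp: frechet_derivative_const)

lemma Ck_on_bounded_linear: "open S \<Longrightarrow> bounded_linear L \<Longrightarrow> Ck_on k L S"
  by (cases k)
    (auto intro!: Ck_on_SucI[where f'="\<lambda>_. L"] Ck_on_const bounded_linear_imp_has_derivative
      linear_continuous_on simp del: Ck_on.simps(2))

lemma Ck_on_linear_compose:
  assumes "open S" "bounded_linear L" "Ck_on k f S"
  shows "Ck_on k (\<lambda>x. L (f x)) S"
  using assms(3)
proof (induction k arbitrary: f)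
  case 0
  then show ?case by (auto intro: bounded_linear.continuous_on[OF assms(2)])
next
  case (Suc k)
  show ?case
    by (rule Ck_on_SucI[where f'="\<lambda>x w. L (frechet_derivative f (at x) w)"])
      (use Suc in \<open>auto intro!: assms bounded_linear.has_derivative[OF assms(2)]
         simp: frechet_derivative_works[symmetric]\<close>)
qed

lemma Ck_on_add:
  assumes "open S" "Ck_on k f S" "Ck_on k g S"
  shows "Ck_on k (\<lambda>x. f x + g x) S"
  using assms(2,3)
proof (induction k arbitrary: f g)
  case 0
  then show ?case by (auto intro: continuous_on_add)
next
  case (Suc k)
  show ?case
    by (rule Ck_on_SucI[where f'="\<lambda>x w. frechet_derivative f (at x) w + frechet_derivative g (at x) w"])
      (use Suc in \<open>auto intro!: assms has_derivative_add simp: frechet_derivative_works[symmetric]\<close>)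
qed

lemma Ck_on_sum:
  assumes "open S" "\<And>i. i \<in> I \<Longrightarrow> Ck_on k (f i) S"
  shows "Ck_on k (\<lambda>x. \<Sum>i\<in>I. f i x) S"
  using assms(2)
  by (induction I rule: infinite_finite_induct) (auto intro: Ck_on_const Ck_on_add assms(1))

lemma Ck_on_mult:
  fixes f g :: "_ \<Rightarrow> real"
  assumes "open S" "Ck_on k f S" "Ck_on k g S"
  shows "Ck_on k (\<lambda>x. f x * g x) S"
  using assms(2,3)
proof (induction k arbitrary: f g)
  case 0
  then show ?case by (auto intro: continuous_on_mult)
next
  case (Suc k)
  show ?case
  proof (rule Ck_on_SucI[where f'="\<lambda>x w. f x * frechet_derivative g (at x) w + frechet_derivative f (at x) w * g x"])
    show "((\<lambda>x. f x * g x) has_derivative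
          (\<lambda>w. f x * frechet_derivative g (at x) w + frechet_derivative f (at x) w * g x)) (at x)" if "x \<in> S" for x
      using Suc.prems that by (intro has_derivative_mult) (auto simp: frechet_derivative_works)
    show "Ck_on k (\<lambda>x. f x * frechet_derivative g (at x) w + frechet_derivative f (at x) w * g x) S" for w
      using Suc.prems Suc.prems[THEN Ck_on_SucD] by (intro Ck_on_add Suc.IH assms) auto
  qed fact
qed

definition onb :: "'a::model_space set" where
  "onb = (SOME B. finite B \<and> (\<forall>u\<in>B. \<forall>v\<in>B. inner u v = (if u = v then 1 else 0)) \<and>
     (\<forall>x. (\<forall>u\<in>B. inner x u = 0) \<longrightarrow> x = 0))"

lemma onb_properties:
  "finite (onb::'a::model_space set) \<and> (\<forall>u\<in>onb. \<forall>v\<in>onb. inner u (v::'a) = (if u = v then 1 else 0)) \<and>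
     (\<forall>x::'a. (\<forall>u\<in>onb. inner x u = 0) \<longrightarrow> x = 0)"
  unfolding onb_def by (rule someI_ex) (rule ex_finite_orthonormal_basis)

lemma finite_onb: "finite onb"
  using onb_properties by blast

lemma inner_onb: "u \<in> onb \<Longrightarrow> v \<in> onb \<Longrightarrow> inner u v = (if u = v then 1 else (0::real))"
  using onb_properties by blast

lemma onb_expansion: "y = (\<Sum>b\<in>onb. inner y b *\<^sub>R b)" for y :: "'a::model_space"
proof -
    have "\<forall>u\<in>onb. inner (y - (\<Sum>b\<in>onb. inner y b *\<^sub>R b)) u = 0"
    proof
      fix u :: 'a assume u: "u \<in> onb"
      have "(\<Sum>b\<in>onb. inner y b * inner b u) = (\<Sum>b\<in>onb. if b = u then inner y b else 0)"
        by (rule sum.cong) (use u in \<open>auto simp: inner_onb\<close>)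
      also have "\<dots> = inner y u" using u by (simp add: finite_onb)
      finally show "inner (y - (\<Sum>b\<in>onb. inner y b *\<^sub>R b)) u = 0"
        by (simp add: inner_diff_left inner_sum_left)
    qed
    then have "y - (\<Sum>b\<in>onb. inner y b *\<^sub>R b) = 0" using onb_properties by blast
    then show ?thesis by simp
qed

lemma linear_onb_expansion:
  fixes L :: "'a::model_space \<Rightarrow> 'b::real_vector"
  assumes "linear L"
  shows "L y = (\<Sum>b\<in>onb. inner y b *\<^sub>R L b)"
  by (subst onb_expansion[of y]) (simp add: linear_sum[OF assms] linear_scale[OF assms])

text \<open>In an orthonormal basis the chain rule expresses a directional derivative of \<open>f \<circ> g\<close> by products of
  coordinates of a derivative of \<open>g\<close> with functions \<open>f\<^sub>b \<circ> g\<close>, where \<open>f\<^sub>b\<close> is a partial derivative of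
  \<open>f\<close>. The induction therefore runs over all smooth \<open>f\<close> simultaneously.\<close>

lemma Ck_on_compose:
  fixes g :: "'a::real_normed_vector \<Rightarrow> 'b::model_space" and f :: "'b \<Rightarrow> real"
  assumes "open S" "open T" "g ` S \<subseteq> T" "smooth_on g S" "smooth_on f T"
  shows "Ck_on k (\<lambda>x. f (g x)) S"
  using assms(5)
proof (induction k arbitrary: f)
  case 0
  have "continuous_on S g" "continuous_on T f"
    using 0 assms(4) unfolding smooth_on_def by (metis Ck_on.simps(1))+
  then show ?case using assms(3) by (auto intro: continuous_on_compose2)
next
  case (Suc k)
  have f1: "Ck_on (Suc j) f T" and g1: "Ck_on (Suc j) g S" for j
    using Suc.prems assms(4) unfolding smooth_on_def by blast+
  have fd: "smooth_on (\<lambda>y. frechet_derivative f (at y) b) T" for b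
    unfolding smooth_on_def using f1 by auto
  show ?case
  proof (rule Ck_on_SucI[where f'="\<lambda>x w. \<Sum>b\<in>onb. inner (frechet_derivative g (at x) w) b * frechet_derivative f (at (g x)) b"])
    fix x assume x: "x \<in> S"
    have fdx: "(f has_derivative frechet_derivative f (at (g x))) (at (g x))"
      using Ck_on_Suc_has_derivative[OF f1] x assms(3) by auto
    have *: "((\<lambda>x. f (g x)) has_derivative (\<lambda>w. frechet_derivative f (at (g x)) (frechet_derivative g (at x) w))) (at x)"
      using has_derivative_compose[OF Ck_on_Suc_has_derivative[OF g1 x] fdx] .
    have eq: "(\<lambda>w. frechet_derivative f (at (g x)) (frechet_derivative g (at x) w)) =
        (\<lambda>w. \<Sum>b\<in>onb. inner (frechet_derivative g (at x) w) b * frechet_derivative f (at (g x)) b)"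
      by (rule ext, subst linear_onb_expansion[OF has_derivative_linear[OF fdx]]) simp
    from * show "((\<lambda>x. f (g x)) has_derivative (\<lambda>w. \<Sum>b\<in>onb. inner (frechet_derivative g (at x) w) b * frechet_derivative f (at (g x)) b)) (at x)"
      unfolding eq .
  next
    fix w
    have "Ck_on k (\<lambda>x. frechet_derivative g (at x) w) S"
      using g1[of k] by simp
    then show "Ck_on k (\<lambda>x. \<Sum>b\<in>onb. inner (frechet_derivative g (at x) w) b * frechet_derivative f (at (g x)) b) S"
      by (intro Ck_on_sum Ck_on_mult Suc.IH fd \<open>open S\<close> Ck_on_linear_compose[OF _ bounded_linear_inner_left])
  qed fact
qed

lemma smooth_on_compose:
  fixes g :: "'a::real_normed_vector \<Rightarrow> 'b::model_space" and f :: "'b \<Rightarrow> real"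
  assumes "open S" "open T" "g ` S \<subseteq> T" "smooth_on g S" "smooth_on f T"
  shows "smooth_on (\<lambda>x. f (g x)) S"
  using Ck_on_compose[OF assms] by (simp add: smooth_on_def)

lemma smooth_on_subset: "smooth_on f S \<Longrightarrow> T \<subseteq> S \<Longrightarrow> smooth_on f T"
  unfolding smooth_on_def by (blast intro: Ck_on_subset)

lemma smooth_on_cong:
  "open S \<Longrightarrow> (\<And>x. x \<in> S \<Longrightarrow> f x = g x) \<Longrightarrow> smooth_on f S \<longleftrightarrow> smooth_on g S"
  unfolding smooth_on_def using Ck_on_cong by metis

lemma smooth_on_local:
  assumes "\<And>x. x \<in> S \<Longrightarrow> \<exists>U. open U \<and> x \<in> U \<and> smooth_on f U"
  shows "smooth_on f S"
  unfolding smooth_on_def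
  by (intro allI Ck_on_local) (use assms in \<open>auto simp: smooth_on_def\<close>)

lemma smooth_on_const: "open S \<Longrightarrow> smooth_on (\<lambda>x. c) S"
  by (simp add: smooth_on_def Ck_on_const)

lemma smooth_on_bounded_linear: "open S \<Longrightarrow> bounded_linear L \<Longrightarrow> smooth_on L S"
  by (simp add: smooth_on_def Ck_on_bounded_linear)

lemma smooth_on_add:
  "open S \<Longrightarrow> smooth_on f S \<Longrightarrow> smooth_on g S \<Longrightarrow> smooth_on (\<lambda>x. f x + g x) S"
  by (simp add: smooth_on_def Ck_on_add)

lemma smooth_on_mult:
  fixes f g :: "_ \<Rightarrow> real"
  shows "open S \<Longrightarrow> smooth_on f S \<Longrightarrow> smooth_on g S \<Longrightarrow> smooth_on (\<lambda>x. f x * g x) S"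
  by (simp add: smooth_on_def Ck_on_mult)

lemma smooth_on_linear_compose:
  "open S \<Longrightarrow> bounded_linear L \<Longrightarrow> smooth_on f S \<Longrightarrow> smooth_on (\<lambda>x. L (f x)) S"
  by (simp add: smooth_on_def Ck_on_linear_compose)

lemma smooth_on_has_derivative:
  "smooth_on f S \<Longrightarrow> x \<in> S \<Longrightarrow> (f has_derivative frechet_derivative f (at x)) (at x)"
  unfolding smooth_on_def using Ck_on_Suc_has_derivative by blast

lemma smooth_on_derivative:
  "smooth_on f S \<Longrightarrow> smooth_on (\<lambda>x. frechet_derivative f (at x) w) S"
  unfolding smooth_on_def using Ck_on.simps(2) by blast

lemma smooth_on_imp_continuous_on: "smooth_on f S \<Longrightarrow> continuous_on S f"
  unfolding smooth_on_def using Ck_on.simps(1) by blast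

lemma smooth_on_inverse_real: "smooth_on (inverse :: real \<Rightarrow> real) (- {0})"
proof -
  have *: "Ck_on k (inverse :: real \<Rightarrow> real) (- {0})" for k
  proof (induction k)
    case 0
    show ?case by (auto intro!: continuous_intros)
  next
    case (Suc k)
    show ?case
      by (rule Ck_on_SucI[where f'="\<lambda>x w. - (inverse x * w * inverse x)"])
        (auto intro!: has_derivative_inverse' Ck_on_linear_compose[OF _ bounded_linear_minus[OF bounded_linear_ident]]
            Ck_on_mult Ck_on_const Suc.IH simp: open_Compl)
  qed
  then show ?thesis by (simp add: smooth_on_def)
qed

section \<open>Smooth cut-off functions\<close>

text \<open>The flat function \<open>exp (- 1 / t)\<close> for \<open>m = 0\<close>. The powers of \<open>1 / t\<close> make the family stable
  under differentiation, up to linear combinations.\<close>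

definition exp_recip :: "nat \<Rightarrow> real \<Rightarrow> real" where
  "exp_recip m t = (if t \<le> 0 then 0 else inverse t ^ m * exp (- inverse t))"

text \<open>The exponential series dominates its term of order \<open>m + 2\<close>. A quadratic bound is what forces the
  derivative at \<open>0\<close> to exist and to vanish.\<close>

lemma exp_recip_bound:
  assumes "t > 0" shows "\<bar>exp_recip m t\<bar> \<le> fact (m + 2) * t\<^sup>2"
proof -
  define s where "s = inverse t"
  have s: "s > 0" using assms by (simp add: s_def)
  have "s ^ (m + 2) / fact (m + 2) \<le> exp s"
  proof -
    have "(\<lambda>n. s ^ n /\<^sub>R fact n) sums exp s" by (rule exp_converges)
    then have "(\<Sum>n\<in>{m+2}. s ^ n /\<^sub>R fact n) \<le> exp s"
      unfolding sums_iff using sum_le_suminf[of "\<lambda>n. s ^ n /\<^sub>R fact n" "{m+2}"] s by auto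
    then show ?thesis by (simp add: divide_inverse mult.commute)
  qed
  then have "s ^ (m + 2) \<le> fact (m + 2) * exp s"
    by (simp only: pos_divide_le_eq[OF fact_gt_zero] mult.commute)
  then have "s ^ m * exp (- s) \<le> fact (m + 2) / s\<^sup>2"
    using s by (simp add: exp_minus divide_simps power_add mult.commute del: fact_Suc add_2_eq_Suc')
  moreover have "fact (m + 2) / s\<^sup>2 = fact (m + 2) * t\<^sup>2"
    by (simp add: s_def power_inverse divide_inverse)
  ultimately show ?thesis using assms s by (simp add: exp_recip_def s_def[symmetric])
qed

lemma exp_recip_derivative:
  "(exp_recip m has_real_derivative exp_recip (m + 2) t - m * exp_recip (m + 1) t) (at t)"
proof (cases t "0::real" rule: linorder_cases)
  case less
  have "((\<lambda>_. 0) has_real_derivative 0) (at t)" by simp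
  then have "(exp_recip m has_real_derivative 0) (at t)"
    by (rule has_field_derivative_transform_within_open[where S="{..<0}"])
      (use less in \<open>auto simp: exp_recip_def\<close>)
  then show ?thesis using less by (simp add: exp_recip_def)
next
  case greater
  have "((\<lambda>t. inverse t ^ m * exp (- inverse t)) has_real_derivative
      inverse t ^ (m+2) * exp (- inverse t) - m * (inverse t ^ (m+1) * exp (- inverse t))) (at t)"
  proof -
    have "((\<lambda>u. u ^ m * exp (- u)) has_real_derivative
        m * u ^ (m - 1) * exp (- u) - u ^ m * exp (- u)) (at u)" for u :: real
      by (auto intro!: derivative_eq_intros)
    from DERIV_chain2[OF this DERIV_inverse]
    have "((\<lambda>t. inverse t ^ m * exp (- inverse t)) has_real_derivative
        (m * inverse t ^ (m - 1) * exp (- inverse t) - inverse t ^ m * exp (- inverse t)) * - (inverse t ^ Suc (Suc 0))) (at t)"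
      using greater by simp
    then show ?thesis
      by (cases m) (simp_all add: algebra_simps)
  qed
  then have "(exp_recip m has_real_derivative
      inverse t ^ (m+2) * exp (- inverse t) - m * (inverse t ^ (m+1) * exp (- inverse t))) (at t)"
    by (rule has_field_derivative_transform_within_open[where S="{0<..}"])
      (use greater in \<open>auto simp: exp_recip_def\<close>)
  then show ?thesis using greater by (simp add: exp_recip_def)
next
  case equal
  have "((\<lambda>h. exp_recip m h / h) \<longlongrightarrow> 0) (at 0)"
  proof (rule Lim_null_comparison[where g="\<lambda>h. fact (m + 2) * \<bar>h\<bar>"])
    have "norm (exp_recip m h / h) \<le> fact (m + 2) * \<bar>h\<bar>" if "h \<noteq> 0" for h
    proof (cases "h > 0")
      case True
      then show ?thesis using exp_recip_bound[OF True, of m]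
        by (simp add: power2_eq_square field_simps abs_mult)
    qed (use mult_nonneg_nonneg[OF fact_ge_zero abs_ge_zero[of h], of "m + 2"] in \<open>simp add: exp_recip_def\<close>)
    then show "\<forall>\<^sub>F h in at 0. norm (exp_recip m h / h) \<le> fact (m + 2) * \<bar>h\<bar>"
      by (simp add: eventually_at_filter)
    show "((\<lambda>h. fact (m + 2) * \<bar>h\<bar>) \<longlongrightarrow> 0) (at (0::real))"
      by (auto intro!: tendsto_eq_intros)
  qed
  then show ?thesis using equal by (simp add: DERIV_def exp_recip_def)
qed

lemma smooth_on_exp_recip: "smooth_on (exp_recip m) UNIV"
proof -
  have "Ck_on k (exp_recip m) UNIV" for k
  proof (induction k arbitrary: m)
    case 0
    show ?case
      using DERIV_isCont[OF exp_recip_derivative] by (simp add: continuous_on_eq_continuous_at)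
  next
    case (Suc k)
    show ?case
    proof (rule Ck_on_SucI)
      show "(exp_recip m has_derivative (\<lambda>w. (exp_recip (m + 2) x + - real m * exp_recip (m + 1) x) * w)) (at x)" for x
        using exp_recip_derivative[of m x] by (simp add: has_field_derivative_def)
      show "Ck_on k (\<lambda>x. (exp_recip (m + 2) x + - real m * exp_recip (m + 1) x) * w) UNIV" for w
        by (intro Ck_on_mult Ck_on_add Ck_on_const Suc.IH open_UNIV)
    qed simp
  qed
  then show ?thesis by (simp add: smooth_on_def)
qed

text \<open>The cut-off is a function of the squared distance, which is smooth also at the centre.\<close>

lemma smooth_cutoff:
  fixes a :: "'a::model_space"
  assumes "0 < r" "r < s"
  shows "\<exists>\<eta> :: 'a \<Rightarrow> real. smooth_on \<eta> UNIV \<and>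
    (\<forall>x. dist a x \<le> r \<longrightarrow> \<eta> x = 1) \<and> (\<forall>x. s \<le> dist a x \<longrightarrow> \<eta> x = 0)"
proof -
  let ?\<theta> = "exp_recip 0"
  define h where "h t = ?\<theta> (s\<^sup>2 - t) * inverse (?\<theta> (s\<^sup>2 - t) + ?\<theta> (t - r\<^sup>2))" for t
  have rs: "r\<^sup>2 < s\<^sup>2" using assms by (simp add: power_strict_mono)
  have \<theta>0: "?\<theta> t \<ge> 0" and \<theta>pos: "t > 0 \<Longrightarrow> ?\<theta> t > 0" for t by (auto simp: exp_recip_def)
  have den: "?\<theta> (s\<^sup>2 - t) + ?\<theta> (t - r\<^sup>2) > 0" for t
    using \<theta>0[of "s\<^sup>2 - t"] \<theta>0[of "t - r\<^sup>2"] \<theta>pos[of "s\<^sup>2 - t"] \<theta>pos[of "t - r\<^sup>2"] rs by force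
  have id: "smooth_on (\<lambda>t::real. t) UNIV"
    by (intro smooth_on_bounded_linear bounded_linear_ident) simp
  have aff: "smooth_on (\<lambda>t. c - t) UNIV" "smooth_on (\<lambda>t. t - c) UNIV" for c :: real
    using smooth_on_add[OF _ smooth_on_const[of UNIV c] smooth_on_linear_compose[OF _ bounded_linear_minus[OF bounded_linear_ident] id]]
      smooth_on_add[OF _ id smooth_on_const[of UNIV "- c"]] by simp_all
  have th: "smooth_on (\<lambda>t. ?\<theta> (s\<^sup>2 - t)) UNIV" "smooth_on (\<lambda>t. ?\<theta> (t - r\<^sup>2)) UNIV"
    using aff smooth_on_exp_recip by (auto intro: smooth_on_compose)
  have "smooth_on (\<lambda>t. inverse (?\<theta> (s\<^sup>2 - t) + ?\<theta> (t - r\<^sup>2))) UNIV"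
    by (rule smooth_on_compose[OF _ _ _ _ smooth_on_inverse_real])
      (use den in \<open>auto simp: open_Compl less_imp_neq[THEN not_sym] intro!: smooth_on_add th\<close>)
  then have h: "smooth_on h UNIV"
    unfolding h_def[abs_def] by (intro smooth_on_mult th) auto
  have sq: "smooth_on (\<lambda>x. inner (x - a) (x - a)) UNIV"
  proof -
    have "Ck_on k (\<lambda>x. inner (x - a) (x - a)) UNIV" for k
    proof (cases k)
      case 0
      then show ?thesis by (auto intro!: continuous_intros)
    next
      case (Suc j)
      have lin: "Ck_on j (\<lambda>x. inner (x - a) w) UNIV" for w
        using Ck_on_add[OF _ Ck_on_bounded_linear[OF _ bounded_linear_inner_left[of w]] Ck_on_const[of UNIV _ "- inner a w"]]
        by (simp add: inner_diff_left)
      have "Ck_on (Suc j) (\<lambda>x. inner (x - a) (x - a)) UNIV"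
      proof (rule Ck_on_SucI)
        show "((\<lambda>x. inner (x - a) (x - a)) has_derivative (\<lambda>w. inner (x - a) w + inner (x - a) w)) (at x)" for x
          by (auto intro!: derivative_eq_intros simp: inner_commute[of _ "x - a"])
        show "Ck_on j (\<lambda>x. inner (x - a) w + inner (x - a) w) UNIV" for w
          by (intro Ck_on_add lin open_UNIV)
      qed simp
      then show ?thesis using Suc by simp
    qed
    then show ?thesis by (simp add: smooth_on_def)
  qed
  define \<eta> where "\<eta> x = h (inner (x - a) (x - a))" for x
  have dist: "inner (x - a) (x - a) = (dist a x)\<^sup>2" for x
    by (metis dist_commute dist_norm power2_norm_eq_inner)
  show ?thesis
  proof (intro exI[of _ \<eta>] conjI allI impI)
    show "smooth_on \<eta> UNIV" unfolding \<eta>_def[abs_def]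
      by (rule smooth_on_compose[OF _ _ _ sq h]) auto
    show "\<eta> x = 1" if "dist a x \<le> r" for x
    proof -
      have "inner (x - a) (x - a) \<le> r\<^sup>2" using that by (simp add: dist power_mono)
      then have "?\<theta> (inner (x - a) (x - a) - r\<^sup>2) = 0" by (simp add: exp_recip_def)
      then show ?thesis using den[of "inner (x - a) (x - a)"] by (simp add: \<eta>_def h_def)
    qed
    show "\<eta> x = 0" if "s \<le> dist a x" for x
    proof -
      have "s\<^sup>2 \<le> inner (x - a) (x - a)" using that assms by (simp add: dist)
      then have "?\<theta> (s\<^sup>2 - inner (x - a) (x - a)) = 0" by (simp add: exp_recip_def)
      then show ?thesis by (simp add: \<eta>_def h_def)
    qed
  qed
qed


section \<open>Hadamard's lemma\<close>

lemma linear_model_space_bounded: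
  fixes L :: "'a::model_space \<Rightarrow> 'b::real_normed_vector"
  assumes "linear L"
  shows "bounded_linear L"
proof -
  have "L = (\<lambda>y. \<Sum>b\<in>onb. inner y b *\<^sub>R L b)" by (rule ext) (rule linear_onb_expansion[OF assms])
  moreover have "bounded_linear (\<lambda>y. \<Sum>b\<in>onb. inner y b *\<^sub>R L b)"
    by (intro bounded_linear_sum bounded_linear_compose[OF bounded_linear_scaleR_left] bounded_linear_inner_left)
  ultimately show ?thesis by simp
qed

text \<open>Differentiation under the integral sign produces a factor \<open>t\<close> and a derivative of \<open>f\<close>; with
  arbitrary weights \<open>t ^ m\<close> the statement reproduces itself under differentiation.\<close>

lemma radial_average_Ck_on:
  fixes f :: "'a::model_space \<Rightarrow> real"
  assumes "smooth_on f (ball a r)"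
  shows "Ck_on k (\<lambda>y. integral {0..1} (\<lambda>t. t ^ m * f (a + t *\<^sub>R (y - a)))) (ball a r)"
  using assms
proof (induction k arbitrary: m f)
  have segment: "a + t *\<^sub>R (y - a) \<in> ball a r" if "y \<in> ball a r" "t \<in> {0..1}" for y t
  proof -
    have "t * norm (y - a) \<le> 1 * norm (y - a)" using that by (intro mult_right_mono) auto
    then show ?thesis using that by (simp add: dist_norm norm_minus_commute)
  qed
  have cont: "continuous_on (ball a r \<times> {0..1}) (\<lambda>(y, t). t ^ m * f (a + t *\<^sub>R (y - a)))"
    if "smooth_on f (ball a r)" for m and f :: "'a \<Rightarrow> real"
    unfolding split_beta
    by (intro continuous_intros continuous_on_compose2[OF smooth_on_imp_continuous_on[OF that]])
      (use segment in auto)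
  {
    case (0 m f)
    show ?case
      using integral_continuous_on_param[of "ball a r" 0 1 "\<lambda>y t. t ^ m * f (a + t *\<^sub>R (y - a))"]
        cont[OF 0] by simp
  next
    case (Suc k m f)
    define D where "D y = frechet_derivative f (at y)" for y
    have D: "(f has_derivative D y) (at y)" if "y \<in> ball a r" for y
      unfolding D_def by (rule smooth_on_has_derivative[OF Suc.prems that])
    have Dsm: "smooth_on (\<lambda>y. D y b) (ball a r)" for b
      unfolding D_def by (rule smooth_on_derivative[OF Suc.prems])
    have Dexp: "D y w = (\<Sum>b\<in>onb. inner w b * D y b)" if "y \<in> ball a r" for y w
      using linear_onb_expansion[OF has_derivative_linear[OF D[OF that]], of w] by simp
    define c where "c b y t = t ^ Suc m * D (a + t *\<^sub>R (y - a)) b" for b y t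
    define fx where "fx y t = (\<Sum>b\<in>onb. c b y t *\<^sub>R blinfun_inner_left b)" for y t
    have fx_apply: "blinfun_apply (fx y t) w = (\<Sum>b\<in>onb. c b y t * inner w b)" for y t w
      by (simp add: fx_def blinfun.bilinear_simps blinfun.sum_left)
    have cc: "continuous_on (ball a r \<times> {0..1}) (\<lambda>(y, t). c b y t)" for b
      unfolding c_def by (rule cont[OF Dsm])
    have ci: "c b y integrable_on {0..1}" if "y \<in> ball a r" for b y
    proof (rule integrable_continuous_real)
      have "continuous_on {0..1} (\<lambda>t. case (y, t) of (y, t) \<Rightarrow> c b y t)"
        by (rule continuous_on_compose2[OF cc continuous_on_Pair[OF continuous_on_const continuous_on_id]])
          (use that in auto)
      then show "continuous_on {0..1} (c b y)" by simp
    qed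
    have "((\<lambda>y. integral {0..1} (\<lambda>t. t ^ m * f (a + t *\<^sub>R (y - a)))) has_derivative
        (\<lambda>w. \<Sum>b\<in>onb. integral {0..1} (c b y) * inner w b)) (at y)" if y: "y \<in> ball a r" for y
    proof -
      have "((\<lambda>y. integral (cbox 0 1) (\<lambda>t. t ^ m * f (a + t *\<^sub>R (y - a)))) has_derivative
          blinfun_apply (integral (cbox 0 1) (fx y))) (at y within ball a r)"
      proof (rule leibniz_rule)
        fix x and t :: real assume x: "x \<in> ball a r" and t: "t \<in> cbox 0 1"
        have xt: "a + t *\<^sub>R (x - a) \<in> ball a r" using segment x t by simp
        have "((\<lambda>y. a + t *\<^sub>R (y - a)) has_derivative (\<lambda>w. t *\<^sub>R w)) (at x)"
          by (auto intro!: derivative_eq_intros)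
        from has_derivative_mult_right[OF has_derivative_compose[OF this D[OF xt]], of "t ^ m"]
        have "((\<lambda>y. t ^ m * f (a + t *\<^sub>R (y - a))) has_derivative
            (\<lambda>w. t ^ m * D (a + t *\<^sub>R (x - a)) (t *\<^sub>R w))) (at x)" .
        moreover have "(\<lambda>w. t ^ m * D (a + t *\<^sub>R (x - a)) (t *\<^sub>R w)) = blinfun_apply (fx x t)"
          by (rule ext)
            (simp add: fx_apply c_def Dexp[OF xt, of "t *\<^sub>R w" for w] sum_distrib_left mult_ac)
        ultimately show "((\<lambda>y. t ^ m * f (a + t *\<^sub>R (y - a))) has_derivative
            blinfun_apply (fx x t)) (at x within ball a r)"
          by (simp add: has_derivative_at_withinI)
      next
        fix x assume x: "x \<in> ball a r"
        have "continuous_on {0..1} (\<lambda>t. case (x, t) of (y, t) \<Rightarrow> t ^ m * f (a + t *\<^sub>R (y - a)))"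
          by (rule continuous_on_compose2[OF cont[OF Suc.prems] continuous_on_Pair[OF continuous_on_const continuous_on_id]])
            (use x in auto)
        then show "(\<lambda>t. t ^ m * f (a + t *\<^sub>R (x - a))) integrable_on cbox 0 1"
          by (simp add: integrable_continuous_real)
      next
        show "continuous_on (ball a r \<times> cbox 0 1) (\<lambda>(x, t). fx x t)"
          using cc unfolding fx_def split_beta by (auto intro!: continuous_intros)
      qed (use y in auto)
      moreover have "integral (cbox 0 1) (fx y) = (\<Sum>b\<in>onb. integral {0..1} (c b y) *\<^sub>R blinfun_inner_left b)"
        unfolding fx_def box_real
        by (intro integral_unique has_integral_sum finite_onb has_integral_scaleR_left integrable_integral ci y)
      moreover have "blinfun_apply (\<Sum>b\<in>onb. integral {0..1} (c b y) *\<^sub>R blinfun_inner_left b) =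
          (\<lambda>w. \<Sum>b\<in>onb. integral {0..1} (c b y) * inner w b)"
        by (rule ext) (simp add: blinfun.bilinear_simps blinfun.sum_left)
      ultimately show ?thesis
        using y at_within_open[OF y] by simp
    qed
    then show ?case
    proof (rule Ck_on_SucI[OF open_ball])
      show "Ck_on k (\<lambda>y. \<Sum>b\<in>onb. integral {0..1} (c b y) * inner w b) (ball a r)" for w
        unfolding c_def
        by (intro Ck_on_sum Ck_on_mult Ck_on_const Suc.IH Dsm open_ball)
    qed
  }
qed

text \<open>The functions \<open>g b\<close> are the averages of the partial derivatives of \<open>f\<close> along the segments issuing
  from \<open>a\<close>; the expansion is the fundamental theorem of calculus on these segments.\<close>

lemma hadamard:
  fixes f :: "'a::model_space \<Rightarrow> real"
  assumes f: "smooth_on f (ball a r)"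
  obtains g where "\<And>b. smooth_on (g b) (ball a r)" "\<And>b. g b a = frechet_derivative f (at a) b"
    "\<And>y. y \<in> ball a r \<Longrightarrow>
       f y = f a + (\<Sum>b\<in>onb. inner (y - a) b * g b y)"
proof
  define D where "D y = frechet_derivative f (at y)" for y
  have D: "(f has_derivative D y) (at y)" if "y \<in> ball a r" for y
    unfolding D_def by (rule smooth_on_has_derivative[OF f that])
  define g where "g b y = integral {0..1} (\<lambda>t. D (a + t *\<^sub>R (y - a)) b)" for b y
  show "smooth_on (g b) (ball a r)" for b
    using radial_average_Ck_on[OF smooth_on_derivative[OF f], of _ 0 b]
    by (simp add: smooth_on_def g_def[abs_def] D_def)
  show "g b a = frechet_derivative f (at a) b" for b
    by (simp add: g_def D_def)
  fix y assume y: "y \<in> ball a r"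
  have Dexp: "D z w = (\<Sum>b\<in>onb. inner w b * D z b)" if "z \<in> ball a r" for z w
    using linear_onb_expansion[OF has_derivative_linear[OF D[OF that]], of w] by simp
  have seg: "a + t *\<^sub>R (y - a) \<in> ball a r" if "t \<in> {0..1}" for t
  proof -
    have "t * norm (y - a) \<le> 1 * norm (y - a)" using that by (intro mult_right_mono) auto
    then show ?thesis using y by (simp add: dist_norm norm_minus_commute)
      (use that in \<open>simp add: norm_minus_commute\<close>)
  qed
  have *: "((\<lambda>t. D (a + t *\<^sub>R (y - a)) (y - a)) has_integral
      f (a + 1 *\<^sub>R (y - a)) - f (a + 0 *\<^sub>R (y - a))) {0..1}"
  proof (rule fundamental_theorem_of_calculus)
    fix t :: real assume t: "t \<in> {0..1}"
    have "((\<lambda>t. a + t *\<^sub>R (y - a)) has_derivative (\<lambda>h. h *\<^sub>R (y - a))) (at t)"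
      by (auto intro!: derivative_eq_intros)
    from has_derivative_compose[OF this D[OF seg[OF t]]]
    have "((\<lambda>t. f (a + t *\<^sub>R (y - a))) has_derivative (\<lambda>h. D (a + t *\<^sub>R (y - a)) (h *\<^sub>R (y - a)))) (at t)" .
    then show "((\<lambda>t. f (a + t *\<^sub>R (y - a))) has_vector_derivative D (a + t *\<^sub>R (y - a)) (y - a)) (at t within {0..1})"
      unfolding has_vector_derivative_def
      by (simp add: linear_scale[OF has_derivative_linear[OF D[OF seg[OF t]]]] has_derivative_at_withinI)
  qed simp
  have **: "((\<lambda>t. D (a + t *\<^sub>R (y - a)) (y - a)) has_integral
      (\<Sum>b\<in>onb. inner (y - a) b * g b y)) {0..1}"
  proof (rule has_integral_eq)
    show "((\<lambda>t. \<Sum>b\<in>onb. inner (y - a) b * D (a + t *\<^sub>R (y - a)) b) has_integral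
        (\<Sum>b\<in>onb. inner (y - a) b * g b y)) {0..1}"
      unfolding g_def
    proof (intro has_integral_sum finite_onb has_integral_mult_right integrable_integral integrable_continuous_real)
      fix b
      show "continuous_on {0..1} (\<lambda>t. D (a + t *\<^sub>R (y - a)) b)"
        unfolding D_def
        by (rule continuous_on_compose2[OF smooth_on_imp_continuous_on[OF smooth_on_derivative[OF f]]])
          (use seg in \<open>auto intro!: continuous_intros\<close>)
    qed
    fix t :: real assume t: "t \<in> {0..1}"
    show "(\<Sum>b\<in>onb. inner (y - a) b * D (a + t *\<^sub>R (y - a)) b) = D (a + t *\<^sub>R (y - a)) (y - a)"
      by (rule Dexp[OF seg[OF t], symmetric])
  qed
  show "f y = f a + (\<Sum>b\<in>onb. inner (y - a) b * g b y)"
    using has_integral_unique[OF * **] by simp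
qed

section \<open>The algebra of smooth functions on a manifold\<close>

locale smooth_mfd =
  fixes E :: "('e::{t2_space,second_countable_topology}, 'm::model_space) chart set"
  assumes smooth_manifold: "smooth_manifold E"
begin

abbreviation "C \<equiv> Cinf E"
abbreviation "T \<equiv> tangent E"
abbreviation "VF \<equiv> vector_fields E"
abbreviation "near p Q \<equiv> eventually Q (nhds p)"

lemma atlas_subset_max_atlas: "E \<subseteq> max_atlas E"
  using smooth_manifold unfolding smooth_manifold_def max_atlas_def by auto

lemma chart_around: obtains U \<phi> where "(U, \<phi>) \<in> E" "p \<in> U" "(U, \<phi>) \<in> max_atlas E"
proof -
  have "p \<in> (\<Union>(U, \<phi>)\<in>E. U)" using smooth_manifold unfolding smooth_manifold_def by simp
  then show ?thesis using that atlas_subset_max_atlas by auto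
qed

lemma max_atlasD:
  assumes "(U, \<phi>) \<in> max_atlas E"
  shows "open U" "open (\<phi> ` U)" "homeomorphism U (\<phi> ` U) \<phi> (inv_into U \<phi>)" "inj_on \<phi> U"
    "continuous_on U \<phi>" "continuous_on (\<phi> ` U) (inv_into U \<phi>)"
    "q \<in> U \<Longrightarrow> inv_into U \<phi> (\<phi> q) = q"
proof -
  show h: "open U" "open (\<phi> ` U)" "homeomorphism U (\<phi> ` U) \<phi> (inv_into U \<phi>)"
    using assms unfolding max_atlas_def is_chart_def by auto
  show *: "q \<in> U \<Longrightarrow> inv_into U \<phi> (\<phi> q) = q" for q
    using h(3) unfolding homeomorphism_def by auto
  show "inj_on \<phi> U" using * by (metis inj_onI)
  show "continuous_on U \<phi>" "continuous_on (\<phi> ` U) (inv_into U \<phi>)"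
    using h(3) unfolding homeomorphism_def by auto
qed

lemma open_chart_image:
  assumes "(U, \<phi>) \<in> max_atlas E" "open W"
  shows "open (\<phi> ` (U \<inter> W))"
proof -
  have "\<phi> ` (U \<inter> W) = \<phi> ` U \<inter> inv_into U \<phi> -` W"
    using max_atlasD(7)[OF assms(1)] by auto
  then show ?thesis
    using continuous_open_preimage[OF max_atlasD(6)[OF assms(1)] max_atlasD(2)[OF assms(1)] assms(2)] by simp
qed

lemma transition_smooth:
  assumes "(U, \<phi>) \<in> max_atlas E" "(U', \<phi>') \<in> E"
  shows "smooth_on (\<phi>' \<circ> inv_into U \<phi>) (\<phi> ` (U \<inter> U'))"
    "smooth_on (\<phi> \<circ> inv_into U' \<phi>') (\<phi>' ` (U' \<inter> U))"
  using assms unfolding max_atlas_def compatible_def by (fastforce simp: Int_commute)+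

lemma Cinf_in_chart:
  assumes f: "f \<in> C" and c: "(U, \<phi>) \<in> max_atlas E"
  shows "smooth_on (\<lambda>y. f (inv_into U \<phi> y)) (\<phi> ` U)"
proof (rule smooth_on_local)
  fix y assume "y \<in> \<phi> ` U"
  then obtain q where q: "q \<in> U" "y = \<phi> q" by auto
  obtain U' \<phi>' where c': "(U', \<phi>') \<in> E" "q \<in> U'" and c'm: "(U', \<phi>') \<in> max_atlas E"
    using chart_around .
  let ?N = "\<phi> ` (U \<inter> U')"
  have N: "open ?N" by (rule open_chart_image[OF c max_atlasD(1)[OF c'm]])
  have "smooth_on (\<lambda>y. (f \<circ> inv_into U' \<phi>') ((\<phi>' \<circ> inv_into U \<phi>) y)) ?N"
  proof (rule smooth_on_compose[OF N max_atlasD(2)[OF c'm] _ transition_smooth(1)[OF c c'(1)]])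
    show "smooth_on (f \<circ> inv_into U' \<phi>') (\<phi>' ` U')"
      using f c'(1) unfolding Cinf_def by auto
  qed (use max_atlasD(7)[OF c] in auto)
  then have "smooth_on (\<lambda>y. f (inv_into U \<phi> y)) ?N"
    by (rule smooth_on_cong[OF N, THEN iffD1, rotated])
      (use max_atlasD(7)[OF c] max_atlasD(7)[OF c'm] in auto)
  then show "\<exists>N. open N \<and> y \<in> N \<and> smooth_on (\<lambda>y. f (inv_into U \<phi> y)) N"
    using N q c'(2) by blast
qed

lemma Cinf_iff: "f \<in> C \<longleftrightarrow> (\<forall>(U, \<phi>)\<in>E. smooth_on (\<lambda>y. f (inv_into U \<phi> y)) (\<phi> ` U))"
  by (simp add: Cinf_def o_def)

lemma Cinf_localI:
  assumes "\<And>p. \<exists>g\<in>C. near p (\<lambda>q. f q = g q)"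
  shows "f \<in> C"
  unfolding Cinf_iff
proof (clarify, rule smooth_on_local)
  fix U \<phi> y assume c: "(U, \<phi>) \<in> E" and "y \<in> \<phi> ` U"
  then obtain q where q: "q \<in> U" "y = \<phi> q" by auto
  have cm: "(U, \<phi>) \<in> max_atlas E" using c atlas_subset_max_atlas by auto
  obtain g V where g: "g \<in> C" and V: "open V" "q \<in> V" "\<And>q'. q' \<in> V \<Longrightarrow> f q' = g q'"
    using assms[of q] unfolding eventually_nhds by auto
  let ?N = "\<phi> ` (U \<inter> V)"
  have N: "open ?N" by (rule open_chart_image[OF cm V(1)])
  have "smooth_on (\<lambda>y. g (inv_into U \<phi> y)) ?N"
    by (rule smooth_on_subset[OF Cinf_in_chart[OF g cm]]) auto
  then have "smooth_on (\<lambda>y. f (inv_into U \<phi> y)) ?N"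
    by (rule smooth_on_cong[OF N, THEN iffD1, rotated]) (use V max_atlasD(7)[OF cm] in auto)
  then show "\<exists>N. open N \<and> y \<in> N \<and> smooth_on (\<lambda>y. f (inv_into U \<phi> y)) N"
    using N q V by blast
qed

lemma open_chart_range: "(U, \<phi>) \<in> E \<Longrightarrow> open (\<phi> ` U)"
  using max_atlasD(2) atlas_subset_max_atlas by blast

lemma Cinf_const: "(\<lambda>_. c) \<in> C"
  unfolding Cinf_iff by (auto intro: smooth_on_const open_chart_range)

lemma Cinf_add: "f \<in> C \<Longrightarrow> g \<in> C \<Longrightarrow> (\<lambda>p. f p + g p) \<in> C"
  unfolding Cinf_iff by (auto intro!: smooth_on_add open_chart_range)

lemma Cinf_mult: "f \<in> C \<Longrightarrow> g \<in> C \<Longrightarrow> (\<lambda>p. f p * g p) \<in> C"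
  unfolding Cinf_iff by (auto intro!: smooth_on_mult open_chart_range)

lemma Cinf_scale: "f \<in> C \<Longrightarrow> (\<lambda>p. c * f p) \<in> C"
  by (intro Cinf_mult Cinf_const)

lemma Cinf_diff: "f \<in> C \<Longrightarrow> g \<in> C \<Longrightarrow> (\<lambda>p. f p - g p) \<in> C"
  using Cinf_add[of f "\<lambda>p. - 1 * g p"] Cinf_scale[of g "-1"] by simp

lemma Cinf_uminus: "f \<in> C \<Longrightarrow> (\<lambda>p. - f p) \<in> C"
  using Cinf_scale[of f "-1"] by simp

lemma Cinf_sum: "(\<And>i. i \<in> I \<Longrightarrow> f i \<in> C) \<Longrightarrow> (\<lambda>p. \<Sum>i\<in>I. f i p) \<in> C"
  by (induction I rule: infinite_finite_induct) (auto intro: Cinf_const Cinf_add)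

lemmas Cinf_intros = Cinf_const Cinf_add Cinf_mult Cinf_diff Cinf_uminus Cinf_sum

lemma Cinf_isCont:
  assumes "f \<in> C" shows "isCont f p"
proof -
  obtain U \<phi> where c: "(U, \<phi>) \<in> E" "p \<in> U" and cm: "(U, \<phi>) \<in> max_atlas E"
    using chart_around .
  have "continuous_on U (\<lambda>q. f (inv_into U \<phi> (\<phi> q)))"
    by (rule continuous_on_compose2[OF smooth_on_imp_continuous_on[OF Cinf_in_chart[OF assms cm]]
        max_atlasD(5)[OF cm]]) auto
  then have "continuous_on U f"
    by (rule continuous_on_cong[THEN iffD1, rotated 2]) (auto simp: max_atlasD(7)[OF cm])
  then show ?thesis
    using continuous_on_eq_continuous_at[OF max_atlasD(1)[OF cm]] c(2) by blast
qed

text \<open>A function given in the chart becomes global when multiplied by \<open>\<rho>\<close>: the support of \<open>\<rho>\<close> lies in the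
  image of a closed ball, which is compact and therefore closed in the Hausdorff space, so that the
  product vanishes near every point outside the domain of the chart.\<close>

lemma chart_bump:
  assumes c: "(U, \<phi>) \<in> max_atlas E" and W: "open W" "W \<subseteq> U" and p: "p \<in> W"
  obtains \<rho> where "\<rho> \<in> C" "near p (\<lambda>q. \<rho> q = 1)" "\<And>q. q \<notin> W \<Longrightarrow> \<rho> q = 0"
    "\<And>h. smooth_on h (\<phi> ` W) \<Longrightarrow> (\<lambda>q. \<rho> q * h (\<phi> q)) \<in> C"
proof -
  have inv: "q \<in> U \<Longrightarrow> inv_into U \<phi> (\<phi> q) = q" for q by (rule max_atlasD(7)[OF c])
  have oW: "open (\<phi> ` W)" using open_chart_image[OF c W(1)] W(2) by (simp add: Int_absorb1)
  obtain s where s: "s > 0" "cball (\<phi> p) s \<subseteq> \<phi> ` W"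
    using oW p by (meson imageI open_contains_cball)
  have "s/2 > 0" "s/2 < s" using s(1) by auto
  then obtain \<eta> :: "'m \<Rightarrow> real" where \<eta>: "smooth_on \<eta> UNIV" "\<And>x. dist (\<phi> p) x \<le> s/2 \<Longrightarrow> \<eta> x = 1"
     "\<And>x. s \<le> dist (\<phi> p) x \<Longrightarrow> \<eta> x = 0"
    using smooth_cutoff[of "s/2" s "\<phi> p"] by blast
  define \<rho> where "\<rho> q = (if q \<in> W then \<eta> (\<phi> q) else 0)" for q
  \<comment> \<open>the compact set that contains the support of the bump function\<close>
  define K where "K = inv_into U \<phi> ` cball (\<phi> p) s"
  have "compact K" unfolding K_def
    by (rule compact_continuous_image[OF continuous_on_subset[OF max_atlasD(6)[OF c]] compact_cball])
      (use s W in auto)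
  then have K: "closed K" by (rule compact_imp_closed)
  have KW: "K \<subseteq> W" using s W inv by (auto simp: K_def subset_eq image_iff)
  have \<rho>0: "\<rho> q = 0" if "q \<notin> K" for q
  proof (rule ccontr)
    assume *: "\<rho> q \<noteq> 0"
    then have q: "q \<in> W" "\<eta> (\<phi> q) \<noteq> 0" by (auto simp: \<rho>_def split: if_splits)
    then have "dist (\<phi> p) (\<phi> q) < s" using \<eta>(3) by force
    then have "q \<in> K" unfolding K_def using inv q(1) W(2) by (intro image_eqI[where x="\<phi> q"]) auto
    with that show False by simp
  qed
  have ext: "(\<lambda>q. \<rho> q * h (\<phi> q)) \<in> C" if h: "smooth_on h (\<phi> ` W)" for h
    unfolding Cinf_iff
  proof (clarify, rule smooth_on_local)
    fix U' \<phi>' y assume c': "(U', \<phi>') \<in> E" and "y \<in> \<phi>' ` U'"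
    then obtain q where q: "q \<in> U'" "y = \<phi>' q" by auto
    have c'm: "(U', \<phi>') \<in> max_atlas E" using c' atlas_subset_max_atlas by auto
    note inv' = max_atlasD(7)[OF c'm]
    show "\<exists>N. open N \<and> y \<in> N \<and> smooth_on (\<lambda>y. \<rho> (inv_into U' \<phi>' y) * h (\<phi> (inv_into U' \<phi>' y))) N"
    proof (cases "q \<in> W")
      case True
      let ?N = "\<phi>' ` (U' \<inter> W)"
      have N: "open ?N" by (rule open_chart_image[OF c'm W(1)])
      have "smooth_on (\<lambda>y. (\<lambda>z. \<eta> z * h z) ((\<phi> \<circ> inv_into U' \<phi>') y)) ?N"
      proof (rule smooth_on_compose[OF N oW])
        show "smooth_on (\<phi> \<circ> inv_into U' \<phi>') ?N"
          by (rule smooth_on_subset[OF transition_smooth(2)[OF c c']]) (use W in auto)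
        show "smooth_on (\<lambda>z. \<eta> z * h z) (\<phi> ` W)"
          by (intro smooth_on_mult oW h smooth_on_subset[OF \<eta>(1)]) simp
      qed (use inv' in auto)
      then have "smooth_on (\<lambda>y. \<rho> (inv_into U' \<phi>' y) * h (\<phi> (inv_into U' \<phi>' y))) ?N"
        by (rule smooth_on_cong[OF N, THEN iffD1, rotated]) (use inv' in \<open>auto simp: \<rho>_def\<close>)
      with N True q show ?thesis by blast
    next
      case False
      let ?N = "\<phi>' ` (U' \<inter> - K)"
      have N: "open ?N" by (rule open_chart_image[OF c'm]) (use K in auto)
      have "smooth_on (\<lambda>y. 0 :: real) ?N" by (rule smooth_on_const[OF N])
      then have "smooth_on (\<lambda>y. \<rho> (inv_into U' \<phi>' y) * h (\<phi> (inv_into U' \<phi>' y))) ?N"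
        by (rule smooth_on_cong[OF N, THEN iffD1, rotated]) (use inv' \<rho>0 in auto)
      with N False KW q show ?thesis by blast
    qed
  qed
  show ?thesis
  proof
    show "\<rho> \<in> C" using ext[OF smooth_on_const[OF oW, of 1]] by simp
    have "open (U \<inter> \<phi> -` ball (\<phi> p) (s/2))"
      by (rule continuous_open_preimage[OF max_atlasD(5)[OF c] max_atlasD(1)[OF c]]) simp
    moreover have "\<rho> q = 1" if "q \<in> (U \<inter> \<phi> -` ball (\<phi> p) (s/2)) \<inter> W" for q
      using that \<eta>(2)[of "\<phi> q"] by (auto simp: \<rho>_def)
    ultimately show "near p (\<lambda>q. \<rho> q = 1)"
      unfolding eventually_nhds using p W s(1)
      by (intro exI[of _ "(U \<inter> \<phi> -` ball (\<phi> p) (s/2)) \<inter> W"]) auto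
    show "\<rho> q = 0" if "q \<notin> W" for q using that by (simp add: \<rho>_def)
    show "(\<lambda>q. \<rho> q * h (\<phi> q)) \<in> C" if "smooth_on h (\<phi> ` W)" for h
      by (rule ext[OF that])
  qed
qed

lemma bump:
  assumes "open W" "p \<in> W"
  obtains \<rho> where "\<rho> \<in> C" "near p (\<lambda>q. \<rho> q = 1)" "\<And>q. q \<notin> W \<Longrightarrow> \<rho> q = 0"
proof -
  obtain U \<phi> where c: "(U, \<phi>) \<in> E" "p \<in> U" and cm: "(U, \<phi>) \<in> max_atlas E"
    using chart_around .
  show ?thesis
    by (rule chart_bump[OF cm, of "U \<inter> W" p]) (use assms c max_atlasD(1)[OF cm] that in auto)
qed

text \<open>A function has a globally defined smooth reciprocal only if it has no zeros, so it is modified away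
  from \<open>p\<close>.\<close>

lemma local_reciprocal:
  assumes f: "f \<in> C" and p: "f p = 1"
  obtains g where "g \<in> C" "g p = 1" "near p (\<lambda>q. g q * f q = 1)"
proof -
  have "open (- {0::real})" by auto
  moreover have "isCont f p" by (rule Cinf_isCont[OF f])
  ultimately obtain W where W: "open W" "p \<in> W" "\<And>q. q \<in> W \<Longrightarrow> f q \<noteq> 0"
    using p unfolding continuous_at_open by (metis ComplD ComplI singletonI singletonD zero_neq_one)
  obtain \<rho> where \<rho>: "\<rho> \<in> C" "near p (\<lambda>q. \<rho> q = 1)" "\<And>q. q \<notin> W \<Longrightarrow> \<rho> q = 0"
    using bump[OF W(1,2)] by metis
  \<comment> \<open>a nowhere vanishing function which agrees with \<open>f\<^sup>2\<close> near \<open>p\<close>\<close>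
  define k where "k q = f q * f q + (1 - \<rho> q) * (1 - \<rho> q)" for q
  have k: "k \<in> C" unfolding k_def by (intro Cinf_intros f \<rho>)
  have k0: "k q \<noteq> 0" for q
    using W(3)[of q] \<rho>(3)[of q] sum_squares_eq_zero_iff[of "f q" "1 - \<rho> q"] unfolding k_def by (cases "q \<in> W") auto
  have "(\<lambda>q. inverse (k q)) \<in> C"
    unfolding Cinf_iff
  proof clarify
    fix U \<phi> assume c: "(U, \<phi>) \<in> E"
    then have "smooth_on (\<lambda>y. k (inv_into U \<phi> y)) (\<phi> ` U)" using k unfolding Cinf_iff by auto
    then show "smooth_on (\<lambda>y. inverse (k (inv_into U \<phi> y))) (\<phi> ` U)"
      by (rule smooth_on_compose[OF open_chart_range[OF c] _ _ _ smooth_on_inverse_real, rotated 2])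
        (use k0 in \<open>auto simp: open_Compl\<close>)
  qed
  then have g: "(\<lambda>q. inverse (k q) * f q) \<in> C" by (intro Cinf_mult f)
  show ?thesis
  proof
    show "near p (\<lambda>q. (inverse (k q) * f q) * f q = 1)"
      using \<rho>(2)
    proof eventually_elim
      case (elim q)
      then show ?case using k0[of q] by (auto simp: k_def field_simps)
    qed
    show "inverse (k p) * f p = 1"
      using eventually_nhds_x_imp_x[OF \<rho>(2)] p by (simp add: k_def)
  qed (rule g)
qed

section \<open>Tangent vectors\<close>

lemma tangent_eq_0: "v \<in> T p \<Longrightarrow> f \<notin> C \<Longrightarrow> v f = 0"
  unfolding tangent_def by blast

lemma tangent_add: "v \<in> T p \<Longrightarrow> f \<in> C \<Longrightarrow> g \<in> C \<Longrightarrow> v (\<lambda>q. f q + g q) = v f + v g"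
  unfolding tangent_def plus_fun_def by blast

lemma tangent_scale: "v \<in> T p \<Longrightarrow> f \<in> C \<Longrightarrow> v (\<lambda>q. c * f q) = c * v f"
  unfolding tangent_def scaleR_fun_def by simp

lemma tangent_mult: "v \<in> T p \<Longrightarrow> f \<in> C \<Longrightarrow> g \<in> C \<Longrightarrow> v (\<lambda>q. f q * g q) = f p * v g + g p * v f"
  unfolding tangent_def times_fun_def by blast

lemma tangent_diff: "v \<in> T p \<Longrightarrow> f \<in> C \<Longrightarrow> g \<in> C \<Longrightarrow> v (\<lambda>q. f q - g q) = v f - v g"
  using tangent_add[of v p f "\<lambda>q. -1 * g q"] tangent_scale[of v p g "-1"] Cinf_scale[of g "-1"] by simp

lemma tangent_uminus: "v \<in> T p \<Longrightarrow> f \<in> C \<Longrightarrow> v (\<lambda>q. - f q) = - v f"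
  using tangent_scale[of v p f "-1"] by simp

lemma tangent_const: "v \<in> T p \<Longrightarrow> v (\<lambda>_. c) = 0"
  using tangent_mult[of v p "\<lambda>_. 1" "\<lambda>_. 1"] tangent_scale[of v p "\<lambda>_. 1" c] by (simp add: Cinf_const)

lemma tangent_sum: "v \<in> T p \<Longrightarrow> (\<And>i. i \<in> I \<Longrightarrow> f i \<in> C) \<Longrightarrow> v (\<lambda>q. \<Sum>i\<in>I. f i q) = (\<Sum>i\<in>I. v (f i))"
proof (induction I rule: infinite_finite_induct)
  case (insert i I)
  then have "(\<lambda>q. \<Sum>i\<in>I. f i q) \<in> C" by (intro Cinf_sum) auto
  with insert show ?case using tangent_add[of v p "f i" "\<lambda>q. \<Sum>i\<in>I. f i q"] by simp
qed (simp_all add: tangent_const)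

lemma tangent_eqI: "v \<in> T p \<Longrightarrow> w \<in> T p \<Longrightarrow> (\<And>f. f \<in> C \<Longrightarrow> v f = w f) \<Longrightarrow> v = w"
  by (rule ext) (metis tangent_eq_0)

lemma tangentI:
  assumes "\<And>f g. f \<in> C \<Longrightarrow> g \<in> C \<Longrightarrow> v (\<lambda>q. f q + g q) = v f + v g"
    "\<And>c f. f \<in> C \<Longrightarrow> v (\<lambda>q. c * f q) = c * v f"
    "\<And>f g. f \<in> C \<Longrightarrow> g \<in> C \<Longrightarrow> v (\<lambda>q. f q * g q) = f p * v g + g p * v f"
    "\<And>f. f \<notin> C \<Longrightarrow> v f = 0"
  shows "v \<in> T p"
  using assms unfolding tangent_def by (simp add: plus_fun_def times_fun_def scaleR_fun_def)

lemma subspace_tangent: "subspace (T p)"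
proof (rule subspaceI)
  show "0 \<in> T p" by (rule tangentI) auto
  show "x + y \<in> T p" if "x \<in> T p" "y \<in> T p" for x y
    using that by (intro tangentI) (auto simp: tangent_add tangent_scale tangent_mult tangent_eq_0 algebra_simps)
  show "c *\<^sub>R x \<in> T p" if "x \<in> T p" for x c
    using that by (intro tangentI)
      (auto simp: tangent_add tangent_scale tangent_mult tangent_eq_0 algebra_simps scaleR_fun_def)
qed

text \<open>The product of \<open>f - g\<close> with a bump function supported where \<open>f = g\<close> is zero, and the Leibniz rule
  at \<open>p\<close> turns this into \<open>v (f - g) = 0\<close>.\<close>

lemma tangent_local:
  assumes v: "v \<in> T p" and fg: "f \<in> C" "g \<in> C" and eq: "near p (\<lambda>q. f q = g q)"
  shows "v f = v g"
proof -
  obtain W where W: "open W" "p \<in> W" "\<And>q. q \<in> W \<Longrightarrow> f q = g q"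
    using eq unfolding eventually_nhds by auto
  obtain \<rho> where \<rho>: "\<rho> \<in> C" "near p (\<lambda>q. \<rho> q = 1)" "\<And>q. q \<notin> W \<Longrightarrow> \<rho> q = 0"
    using bump[OF W(1,2)] by metis
  have "(\<lambda>q. (f q - g q) * \<rho> q) = (\<lambda>_. 0)"
    using W(3) \<rho>(3) by (auto simp: fun_eq_iff)
  then have "0 = v (\<lambda>q. (f q - g q) * \<rho> q)" using tangent_const[OF v, of 0] by simp
  also have "\<dots> = (f p - g p) * v \<rho> + \<rho> p * v (\<lambda>q. f q - g q)"
    by (rule tangent_mult[OF v]) (intro Cinf_intros fg \<rho>)+
  also have "\<dots> = v f - v g"
    using eventually_nhds_x_imp_x[OF \<rho>(2)] eventually_nhds_x_imp_x[OF eq] tangent_diff[OF v fg] by simp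
  finally show ?thesis by simp
qed

lemma coord_vector_tangent:
  assumes c: "(U, \<phi>) \<in> max_atlas E" and q: "q \<in> U"
  shows "coord_vector E (U, \<phi>) q w \<in> T q"
proof -
  have D: "((\<lambda>y. f (inv_into U \<phi> y)) has_derivative frechet_derivative (\<lambda>y. f (inv_into U \<phi> y)) (at (\<phi> q))) (at (\<phi> q))"
    if "f \<in> C" for f
    by (rule smooth_on_has_derivative[OF Cinf_in_chart[OF that c]]) (use q in auto)
  show ?thesis
  proof (rule tangentI)
    fix f g assume f: "f \<in> C" and g: "g \<in> C"
    show "coord_vector E (U, \<phi>) q w (\<lambda>q. f q + g q) = coord_vector E (U, \<phi>) q w f + coord_vector E (U, \<phi>) q w g"
      using frechet_derivative_at[OF has_derivative_add[OF D[OF f] D[OF g]], symmetric] f g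
      by (simp add: coord_vector_def o_def Cinf_add)
    show "coord_vector E (U, \<phi>) q w (\<lambda>q. f q * g q) = f q * coord_vector E (U, \<phi>) q w g + g q * coord_vector E (U, \<phi>) q w f"
      using frechet_derivative_at[OF has_derivative_mult[OF D[OF f] D[OF g]], symmetric] f g
        max_atlasD(7)[OF c q]
      by (simp add: coord_vector_def o_def Cinf_mult)
  next
    fix k f assume f: "f \<in> C"
    show "coord_vector E (U, \<phi>) q w (\<lambda>q. k * f q) = k * coord_vector E (U, \<phi>) q w f"
      using frechet_derivative_at[OF has_derivative_mult_right[OF D[OF f], of k], symmetric] f
      by (simp add: coord_vector_def o_def Cinf_scale)
  qed (simp add: coord_vector_def)
qed

lemma coord_vector_linear:
  assumes c: "(U, \<phi>) \<in> max_atlas E" and q: "q \<in> U"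
  shows "linear (coord_vector E (U, \<phi>) q)"
proof -
  have D: "linear (frechet_derivative (\<lambda>y. f (inv_into U \<phi> y)) (at (\<phi> q)))" if "f \<in> C" for f
    by (rule has_derivative_linear[OF smooth_on_has_derivative[OF Cinf_in_chart[OF that c]]]) (use q in auto)
  show ?thesis
    by (rule linearI) (auto simp: coord_vector_def o_def fun_eq_iff scaleR_fun_def linear_add[OF D] linear_scale[OF D])
qed

lemma coord_vector_linear_function:
  assumes c: "(U, \<phi>) \<in> max_atlas E" and q: "q \<in> U" and L: "linear L"
    and \<rho>: "near q (\<lambda>q. \<rho> q = 1)" "(\<lambda>q. \<rho> q * L (\<phi> q)) \<in> C"
  shows "coord_vector E (U, \<phi>) q w (\<lambda>q. \<rho> q * L (\<phi> q)) = L w"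
proof -
  obtain V where V: "open V" "q \<in> V" "\<And>q'. q' \<in> V \<Longrightarrow> \<rho> q' = 1"
    using \<rho>(1) unfolding eventually_nhds by auto
  have "(L has_derivative L) (at (\<phi> q))"
    by (rule bounded_linear_imp_has_derivative[OF linear_model_space_bounded[OF L]])
  then have "((\<lambda>y. \<rho> (inv_into U \<phi> y) * L (\<phi> (inv_into U \<phi> y))) has_derivative L) (at (\<phi> q))"
    by (rule has_derivative_transform_within_open[OF _ open_chart_image[OF c V(1)]])
      (use V q max_atlasD(7)[OF c] in auto)
  from frechet_derivative_at[OF this, symmetric] show ?thesis
    using \<rho>(2) by (simp add: coord_vector_def o_def)
qed

text \<open>By Hadamard's lemma \<open>f = f q + (\<Sum>b\<in>onb. (x\<^sub>b - x\<^sub>b q) G\<^sub>b)\<close> near \<open>q\<close> with smooth \<open>G\<^sub>b\<close>, where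
  \<open>x\<^sub>b\<close> are the coordinates cut off by \<open>\<rho>\<close>. The Leibniz rule leaves only the terms
  \<open>v x\<^sub>b * G\<^sub>b q\<close>, and \<open>G\<^sub>b q\<close> is a partial derivative of \<open>f\<close>. It follows that the space of
  derivations at a point is finite-dimensional.\<close>

lemma coord_vector_expansion:
  assumes c: "(U, \<phi>) \<in> max_atlas E" and q: "q \<in> U"
    and \<rho>: "near q (\<lambda>q. \<rho> q = 1)" "\<And>b. (\<lambda>q. \<rho> q * inner (\<phi> q) b) \<in> C"
    and v: "v \<in> T q"
  shows "v = (\<Sum>b\<in>onb. v (\<lambda>q. \<rho> q * inner (\<phi> q) b) *\<^sub>R coord_vector E (U, \<phi>) q b)"
proof (rule tangent_eqI[OF v])
  show "(\<Sum>b\<in>onb. v (\<lambda>q. \<rho> q * inner (\<phi> q) b) *\<^sub>R coord_vector E (U, \<phi>) q b) \<in> T q"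
    by (intro subspace_sum subspace_scale subspace_tangent coord_vector_tangent c q)
  fix f assume f: "f \<in> C"
  define x where "x b q = \<rho> q * inner (\<phi> q) b" for b q
  obtain r where r: "r > 0" "ball (\<phi> q) r \<subseteq> \<phi> ` U"
    using max_atlasD(2)[OF c] q by (meson imageI open_contains_ball)
  have fs: "smooth_on (\<lambda>y. f (inv_into U \<phi> y)) (ball (\<phi> q) r)"
    by (rule smooth_on_subset[OF Cinf_in_chart[OF f c] r(2)])
  obtain g where g: "\<And>b. smooth_on (g b) (ball (\<phi> q) r)"
    "\<And>b. g b (\<phi> q) = frechet_derivative (\<lambda>y. f (inv_into U \<phi> y)) (at (\<phi> q)) b"
    "\<And>y. y \<in> ball (\<phi> q) r \<Longrightarrow> f (inv_into U \<phi> y) = f (inv_into U \<phi> (\<phi> q)) + (\<Sum>b\<in>onb. inner (y - \<phi> q) b * g b y)"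
    by (rule hadamard[OF fs]) (rule that)
  define W where "W = U \<inter> \<phi> -` ball (\<phi> q) r"
  have W: "open W" "W \<subseteq> U" "q \<in> W"
    using continuous_open_preimage[OF max_atlasD(5)[OF c] max_atlasD(1)[OF c], of "ball (\<phi> q) r"] q r
    by (auto simp: W_def)
  have gW: "smooth_on (g b) (\<phi> ` W)" for b
    by (rule smooth_on_subset[OF g(1)]) (auto simp: W_def)
  obtain \<sigma> where \<sigma>: "\<sigma> \<in> C" "near q (\<lambda>q. \<sigma> q = 1)" "\<And>q. q \<notin> W \<Longrightarrow> \<sigma> q = 0"
    "\<And>h. smooth_on h (\<phi> ` W) \<Longrightarrow> (\<lambda>q. \<sigma> q * h (\<phi> q)) \<in> C"
    using chart_bump[OF c W] by metis
  define G where "G b q = \<sigma> q * g b (\<phi> q)" for b q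
  have G: "G b \<in> C" for b unfolding G_def by (rule \<sigma>(4)[OF gW])
  have x: "x b \<in> C" for b unfolding x_def by (rule \<rho>(2))
  define F where "F q' = f q + (\<Sum>b\<in>onb. (x b q' - x b q) * G b q')" for q'
  have terms: "(\<lambda>q'. (x b q' - x b q) * G b q') \<in> C" for b
    by (intro Cinf_intros x G)
  have F: "F \<in> C" unfolding F_def by (intro Cinf_intros x G)
  have \<rho>q: "\<rho> q = 1" "\<sigma> q = 1" using \<rho>(1) \<sigma>(2) by (auto dest: eventually_nhds_x_imp_x)
  have "near q (\<lambda>q'. q' \<in> W)" using W eventually_nhds by blast
  with \<rho>(1) \<sigma>(2) have "near q (\<lambda>q'. f q' = F q')"
  proof eventually_elim
    case (elim q')
    then have "f q' = f q + (\<Sum>b\<in>onb. inner (\<phi> q' - \<phi> q) b * g b (\<phi> q'))"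
      using g(3)[of "\<phi> q'"] max_atlasD(7)[OF c] q by (auto simp: W_def)
    then show ?case using elim \<rho>q by (simp add: F_def x_def G_def inner_diff_left)
  qed
  then have "v f = v F" by (rule tangent_local[OF v f F])
  also have "\<dots> = (\<Sum>b\<in>onb. v (\<lambda>q'. (x b q' - x b q) * G b q'))"
    unfolding F_def using terms by (simp add: tangent_add[OF v] tangent_sum[OF v] tangent_const[OF v] Cinf_intros)
  also have "\<dots> = (\<Sum>b\<in>onb. v (x b) * coord_vector E (U, \<phi>) q b f)"
  proof (rule sum.cong[OF refl])
    fix b
    have "v (\<lambda>q'. (x b q' - x b q) * G b q') = G b q * v (\<lambda>q'. x b q' - x b q)"
      using tangent_mult[OF v, of "\<lambda>q'. x b q' - x b q" "G b"] by (simp add: Cinf_intros x G)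
    also have "v (\<lambda>q'. x b q' - x b q) = v (x b)"
      using tangent_diff[OF v x Cinf_const] tangent_const[OF v] by simp
    finally show "v (\<lambda>q'. (x b q' - x b q) * G b q') = v (x b) * coord_vector E (U, \<phi>) q b f"
      using f \<rho>q by (simp add: G_def g(2) coord_vector_def o_def)
  qed
  also have "\<dots> = (\<Sum>b\<in>onb. v (x b) *\<^sub>R coord_vector E (U, \<phi>) q b) f"
  proof -
    have "(\<Sum>b\<in>I. c b *\<^sub>R w b) f = (\<Sum>b\<in>I. c b * w b f)" for I :: "'m set" and c and w :: "'m \<Rightarrow> 'e tvec"
      by (induction I rule: infinite_finite_induct) (auto simp: scaleR_fun_def)
    then show ?thesis by simp
  qed
  finally show "v f = (\<Sum>b\<in>onb. v (\<lambda>q. \<rho> q * inner (\<phi> q) b) *\<^sub>R coord_vector E (U, \<phi>) q b) f"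
    unfolding x_def .
qed

end

section \<open>Linear functionals on subspaces\<close>

lemma sum_fun_apply: "(\<Sum>i\<in>I. F i) x = (\<Sum>i\<in>I. F i x)"
  by (induction I rule: infinite_finite_induct) auto

lemma scaleR_fun_apply: "(c *\<^sub>R f) x = c *\<^sub>R f x"
  by (simp add: scaleR_fun_def)

lemma functionals_on_sum:
  assumes \<alpha>: "\<alpha> \<in> functionals_on W" and W: "subspace W" and v: "\<And>i. i \<in> I \<Longrightarrow> v i \<in> W"
  shows "\<alpha> (\<Sum>i\<in>I. c i *\<^sub>R v i) = (\<Sum>i\<in>I. c i * \<alpha> (v i))"
  using v
proof (induction I rule: infinite_finite_induct)
  case (insert i I)
  have "(\<Sum>i\<in>I. c i *\<^sub>R v i) \<in> W" "c i *\<^sub>R v i \<in> W"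
    using insert.prems by (auto intro!: subspace_sum subspace_scale W)
  then show ?case using insert \<alpha> by (simp add: functionals_on_def)
next
  case empty
  have "\<alpha> (0 *\<^sub>R 0) = 0 * \<alpha> 0" using \<alpha> subspace_0[OF W] unfolding functionals_on_def by blast
  then show ?case by simp
next
  case (infinite I)
  have "\<alpha> (0 *\<^sub>R 0) = 0 * \<alpha> 0" using \<alpha> subspace_0[OF W] unfolding functionals_on_def by blast
  with infinite show ?case by simp
qed

lemma subspace_functionals_on: "subspace (functionals_on W)"
  unfolding functionals_on_def by (rule subspaceI) (auto simp: scaleR_fun_def algebra_simps)

lemma functionals_on_add: "\<alpha> \<in> functionals_on W \<Longrightarrow> v \<in> W \<Longrightarrow> w \<in> W \<Longrightarrow> \<alpha> (v + w) = \<alpha> v + \<alpha> w"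
  and functionals_on_scale: "\<alpha> \<in> functionals_on W \<Longrightarrow> v \<in> W \<Longrightarrow> \<alpha> (c *\<^sub>R v) = c * \<alpha> v"
  by (auto simp: functionals_on_def)

lemma functionals_on_diff:
  "\<alpha> \<in> functionals_on W \<Longrightarrow> subspace W \<Longrightarrow> v \<in> W \<Longrightarrow> w \<in> W \<Longrightarrow> \<alpha> (v - w) = \<alpha> v - \<alpha> w"
  using functionals_on_add[of \<alpha> W v "(-1) *\<^sub>R w"] functionals_on_scale[of \<alpha> W w "-1"]
    subspace_scale[of W w "-1"] by simp

context smooth_mfd
begin

section \<open>Vector fields and local frames\<close>

lemma vector_field_tangent: "X \<in> VF \<Longrightarrow> X p \<in> T p"
  and vector_field_smooth: "X \<in> VF \<Longrightarrow> f \<in> C \<Longrightarrow> (\<lambda>p. X p f) \<in> C"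
  by (auto simp: vector_fields_def)

lemma vector_field_combination:
  assumes "\<And>i. i \<in> I \<Longrightarrow> c i \<in> C" "\<And>i. i \<in> I \<Longrightarrow> X i \<in> VF"
  shows "(\<lambda>p. \<Sum>i\<in>I. c i p *\<^sub>R X i p) \<in> VF"
  unfolding vector_fields_def
proof safe
  show "(\<Sum>i\<in>I. c i p *\<^sub>R X i p) \<in> T p" for p
    using assms by (intro subspace_sum subspace_scale subspace_tangent vector_field_tangent)
  show "(\<lambda>p. (\<Sum>i\<in>I. c i p *\<^sub>R X i p) f) \<in> C" if "f \<in> C" for f
    unfolding sum_fun_apply scaleR_fun_apply real_scaleR_def
    by (rule Cinf_sum, rule Cinf_mult) (use assms that vector_field_smooth in blast)+
qed

lemma vector_field_mult: "f \<in> C \<Longrightarrow> X \<in> VF \<Longrightarrow> (\<lambda>p. f p *\<^sub>R X p) \<in> VF"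
  using vector_field_combination[of "{()}" "\<lambda>_. f" "\<lambda>_. X"] by simp

lemma vector_field_add: "X \<in> VF \<Longrightarrow> Y \<in> VF \<Longrightarrow> (\<lambda>p. X p + Y p) \<in> VF"
  unfolding vector_fields_def by (auto intro!: Cinf_intros subspace_add subspace_tangent)

lemma vector_field_diff: "X \<in> VF \<Longrightarrow> Y \<in> VF \<Longrightarrow> (\<lambda>p. X p - Y p) \<in> VF"
  unfolding vector_fields_def by (auto intro!: Cinf_intros subspace_diff subspace_tangent)

lemma vector_field_localI:
  assumes "\<And>p. \<exists>Y\<in>VF. near p (\<lambda>q. X q = Y q)"
  shows "X \<in> VF"
  unfolding vector_fields_def
proof safe
  show "X p \<in> T p" for p
    using assms[of p] by (auto dest!: eventually_nhds_x_imp_x intro: vector_field_tangent)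
  show "(\<lambda>p. X p f) \<in> C" if f: "f \<in> C" for f
  proof (rule Cinf_localI)
    fix p
    obtain Y where Y: "Y \<in> VF" "near p (\<lambda>q. X q = Y q)" using assms by blast
    show "\<exists>g\<in>C. near p (\<lambda>q. X q f = g q)"
      by (rule bexI[of _ "\<lambda>q. Y q f"])
        (use Y(2) in \<open>auto simp: vector_field_smooth[OF Y(1) f] elim: eventually_mono\<close>)
  qed
qed

lemma coord_field:
  assumes c: "(U, \<phi>) \<in> max_atlas E" and \<rho>: "\<And>q. q \<notin> U \<Longrightarrow> \<rho> q = 0"
    "\<And>h. smooth_on h (\<phi> ` U) \<Longrightarrow> (\<lambda>q. \<rho> q * h (\<phi> q)) \<in> C"
  shows "(\<lambda>q. \<rho> q *\<^sub>R coord_vector E (U, \<phi>) q w) \<in> VF"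
  unfolding vector_fields_def
proof safe
  show "\<rho> q *\<^sub>R coord_vector E (U, \<phi>) q w \<in> T q" for q
  proof (cases "q \<in> U")
    case True
    then show ?thesis by (intro subspace_scale subspace_tangent coord_vector_tangent c)
  next
    case False
    then show ?thesis using \<rho>(1) subspace_0[OF subspace_tangent] by simp
  qed
  fix f assume f: "f \<in> C"
  have "(\<lambda>q. \<rho> q * frechet_derivative (\<lambda>y. f (inv_into U \<phi> y)) (at (\<phi> q)) w) \<in> C"
    by (rule \<rho>(2)[OF smooth_on_derivative[OF Cinf_in_chart[OF f c]]])
  then show "(\<lambda>q. (\<rho> q *\<^sub>R coord_vector E (U, \<phi>) q w) f) \<in> C"
    using f by (simp add: coord_vector_def o_def scaleR_fun_apply)
qed

text \<open>One cut-off \<open>\<rho>\<close> makes all coordinate functions and coordinate fields of the chart global; near \<open>p\<close>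
  they keep their meaning.\<close>

lemma chart_frame:
  assumes c: "(U, \<phi>) \<in> max_atlas E" and p: "p \<in> U"
  obtains \<rho> where
    "\<And>L. linear L \<Longrightarrow> (\<lambda>q. \<rho> q * L (\<phi> q)) \<in> C"
    "\<And>w. (\<lambda>q. \<rho> q *\<^sub>R coord_vector E (U, \<phi>) q w) \<in> VF"
    "near p (\<lambda>q. q \<in> U \<and> \<rho> q = 1)"
    "near p (\<lambda>q. \<forall>L w. linear L \<longrightarrow> coord_vector E (U, \<phi>) q w (\<lambda>q. \<rho> q * L (\<phi> q)) = L w)"
    "near p (\<lambda>q. \<forall>v\<in>T q. v = (\<Sum>b\<in>onb. v (\<lambda>q. \<rho> q * inner (\<phi> q) b) *\<^sub>R coord_vector E (U, \<phi>) q b))"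
proof -
  obtain \<rho> where \<rho>: "\<rho> \<in> C" "near p (\<lambda>q. \<rho> q = 1)" "\<And>q. q \<notin> U \<Longrightarrow> \<rho> q = 0"
    "\<And>h. smooth_on h (\<phi> ` U) \<Longrightarrow> (\<lambda>q. \<rho> q * h (\<phi> q)) \<in> C"
    using chart_bump[OF c max_atlasD(1)[OF c] subset_refl p] by metis
  have L: "(\<lambda>q. \<rho> q * L (\<phi> q)) \<in> C" if "linear L" for L
    by (rule \<rho>(4)[OF smooth_on_bounded_linear[OF max_atlasD(2)[OF c] linear_model_space_bounded[OF that]]])
  have inner: "(\<lambda>q. \<rho> q * inner (\<phi> q) b) \<in> C" for b
    by (rule L[OF bounded_linear.linear[OF bounded_linear_inner_left]])
  have U: "near p (\<lambda>q. q \<in> U)" using max_atlasD(1)[OF c] p eventually_nhds by blast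
  have near2: "near p (\<lambda>q. near q (\<lambda>q. \<rho> q = 1))" using \<rho>(2) by (simp add: eventually_eventually)
  show ?thesis
  proof
    show "near p (\<lambda>q. q \<in> U \<and> \<rho> q = 1)" using U \<rho>(2) by eventually_elim auto
    show "near p (\<lambda>q. \<forall>L w. linear L \<longrightarrow> coord_vector E (U, \<phi>) q w (\<lambda>q. \<rho> q * L (\<phi> q)) = L w)"
      using U near2 by eventually_elim (auto intro: coord_vector_linear_function[OF c] L)
    show "near p (\<lambda>q. \<forall>v\<in>T q. v = (\<Sum>b\<in>onb. v (\<lambda>q. \<rho> q * inner (\<phi> q) b) *\<^sub>R coord_vector E (U, \<phi>) q b))"
      using U near2
    proof eventually_elim
      case (elim q)
      show ?case by (intro ballI coord_vector_expansion[OF c elim inner])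
    qed
  qed (rule L coord_field[OF c \<rho>(3,4)]; assumption)+
qed

lemma frame:
  obtains x :: "'m \<Rightarrow> 'e \<Rightarrow> real" and d where "\<And>b. x b \<in> C" "\<And>b. d b \<in> VF"
    "near p (\<lambda>q. (\<forall>b\<in>onb. \<forall>b'\<in>onb. d b q (x b') = (if b = b' then 1 else 0)) \<and>
       (\<forall>v\<in>T q. v = (\<Sum>b\<in>onb. v (x b) *\<^sub>R d b q)))"
proof -
  obtain U \<phi> where c: "(U, \<phi>) \<in> E" "p \<in> U" and cm: "(U, \<phi>) \<in> max_atlas E"
    using chart_around .
  obtain \<rho> where \<rho>:
    "\<And>L. linear L \<Longrightarrow> (\<lambda>q. \<rho> q * L (\<phi> q)) \<in> C"
    "\<And>w. (\<lambda>q. \<rho> q *\<^sub>R coord_vector E (U, \<phi>) q w) \<in> VF"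
    "near p (\<lambda>q. q \<in> U \<and> \<rho> q = 1)"
    "near p (\<lambda>q. \<forall>L w. linear L \<longrightarrow> coord_vector E (U, \<phi>) q w (\<lambda>q. \<rho> q * L (\<phi> q)) = L w)"
    "near p (\<lambda>q. \<forall>v\<in>T q. v = (\<Sum>b\<in>onb. v (\<lambda>q. \<rho> q * inner (\<phi> q) b) *\<^sub>R coord_vector E (U, \<phi>) q b))"
    by (rule chart_frame[OF cm c(2)]) (rule that)
  have lin: "linear (\<lambda>y. inner y b)" for b :: 'm
    by (rule bounded_linear.linear[OF bounded_linear_inner_left])
  show ?thesis
  proof (rule that)
    show "(\<lambda>q. \<rho> q * inner (\<phi> q) b) \<in> C" for b by (rule \<rho>(1)[OF lin])
    show "(\<lambda>q. \<rho> q *\<^sub>R coord_vector E (U, \<phi>) q b) \<in> VF" for b by (rule \<rho>(2))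
    show "near p (\<lambda>q. (\<forall>b\<in>onb. \<forall>b'\<in>onb. (\<rho> q *\<^sub>R coord_vector E (U, \<phi>) q b) (\<lambda>q. \<rho> q * inner (\<phi> q) b') = (if b = b' then 1 else 0)) \<and>
       (\<forall>v\<in>T q. v = (\<Sum>b\<in>onb. v (\<lambda>q. \<rho> q * inner (\<phi> q) b) *\<^sub>R \<rho> q *\<^sub>R coord_vector E (U, \<phi>) q b)))"
      using \<rho>(3-5)
    proof eventually_elim
      case (elim q)
      have "coord_vector E (U, \<phi>) q b (\<lambda>q. \<rho> q * (\<lambda>y. inner y b') (\<phi> q)) = (\<lambda>y. inner y b') b" for b b'
        using elim(2) lin[of b'] by blast
      with elim(1,3) show ?case by (simp add: inner_onb scaleR_fun_apply)
    qed
  qed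
qed

lemma frame_at:
  obtains x :: "'m \<Rightarrow> 'e \<Rightarrow> real" and d where "\<And>b. x b \<in> C" "\<And>b. d b \<in> T p"
    "\<And>v. v \<in> T p \<Longrightarrow> v = (\<Sum>b\<in>onb. v (x b) *\<^sub>R d b)"
proof (rule frame[of p])
  fix x d
  assume x: "\<And>b :: 'm. x b \<in> C" and d: "\<And>b. d b \<in> VF"
    and n: "near p (\<lambda>q. (\<forall>b\<in>onb. \<forall>b'\<in>onb. d b q (x b') = (if b = b' then 1 else 0)) \<and>
       (\<forall>v\<in>T q. v = (\<Sum>b\<in>onb. v (x b) *\<^sub>R d b q)))"
  show thesis
    by (rule that[of x "\<lambda>b. d b p", OF x vector_field_tangent[OF d]]) (use eventually_nhds_x_imp_x[OF n] in blast)
qed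

section \<open>Covectors and bivectors\<close>

lemma cotangent_sum:
  assumes "\<alpha> \<in> cotangent E p" "\<And>i. i \<in> I \<Longrightarrow> v i \<in> T p"
  shows "\<alpha> (\<Sum>i\<in>I. c i *\<^sub>R v i) = (\<Sum>i\<in>I. c i * \<alpha> (v i))"
  using functionals_on_sum[OF _ subspace_tangent] assms unfolding cotangent_def by blast

lemma cotangent_eqI:
  "\<alpha> \<in> cotangent E p \<Longrightarrow> \<beta> \<in> cotangent E p \<Longrightarrow> (\<And>v. v \<in> T p \<Longrightarrow> \<alpha> v = \<beta> v) \<Longrightarrow> \<alpha> = \<beta>"
  unfolding cotangent_def functionals_on_def by (rule ext) (auto, metis)

lemma diff_cotangent: "f \<in> C \<Longrightarrow> diff E f p \<in> cotangent E p"
  using subspace_add[OF subspace_tangent] subspace_scale[OF subspace_tangent]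
  unfolding cotangent_def functionals_on_def diff_def by (auto simp: scaleR_fun_apply)

lemma diff_apply: "v \<in> T p \<Longrightarrow> diff E f p v = v f"
  by (simp add: diff_def)

lemma diff_sum:
  assumes "\<And>i. i \<in> I \<Longrightarrow> f i \<in> C"
  shows "diff E (\<lambda>q. \<Sum>i\<in>I. c i * f i q) p = (\<Sum>i\<in>I. c i *\<^sub>R diff E (f i) p)"
proof
  fix v
  show "diff E (\<lambda>q. \<Sum>i\<in>I. c i * f i q) p v = (\<Sum>i\<in>I. c i *\<^sub>R diff E (f i) p) v"
  proof (cases "v \<in> T p")
    case True
    then show ?thesis
      using assms tangent_sum[OF True, of I "\<lambda>i q. c i * f i q"]
      by (simp add: diff_apply sum_fun_apply scaleR_fun_apply tangent_scale Cinf_scale)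
  qed (simp add: diff_def sum_fun_apply scaleR_fun_apply)
qed

text \<open>The witness is the function with constant coefficients \<open>\<alpha> (d b)\<close> in local coordinates.\<close>

lemma cotangent_is_diff:
  assumes \<alpha>: "\<alpha> \<in> cotangent E p"
  obtains f where "f \<in> C" "\<alpha> = diff E f p"
proof -
  obtain x :: "'m \<Rightarrow> 'e \<Rightarrow> real" and d where x: "\<And>b. x b \<in> C" and dT: "\<And>b. d b \<in> T p"
    and exp: "\<And>v. v \<in> T p \<Longrightarrow> v = (\<Sum>b\<in>onb. v (x b) *\<^sub>R d b)"
    by (rule frame_at[of p]) (rule that)
  define f where "f q = (\<Sum>b\<in>onb. \<alpha> (d b) * x b q)" for q
  have terms: "(\<lambda>q. \<alpha> (d b) * x b q) \<in> C" for b by (intro Cinf_scale x)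
  have f: "f \<in> C" unfolding f_def by (intro Cinf_intros x)
  have "\<alpha> = diff E f p"
  proof (rule cotangent_eqI[OF \<alpha> diff_cotangent[OF f]])
    fix v assume v: "v \<in> T p"
    have "\<alpha> v = \<alpha> (\<Sum>b\<in>onb. v (x b) *\<^sub>R d b)" using exp[OF v] by simp
    also have "\<dots> = (\<Sum>b\<in>onb. v (x b) * \<alpha> (d b))"
      by (rule cotangent_sum[OF \<alpha> dT])
    also have "\<dots> = (\<Sum>b\<in>onb. v (\<lambda>q. \<alpha> (d b) * x b q))"
      by (rule sum.cong[OF refl]) (subst tangent_scale[OF v x], simp)
    also have "\<dots> = v f" unfolding f_def by (rule tangent_sum[OF v terms, symmetric])
    finally show "\<alpha> v = diff E f p v" using v by (simp add: diff_apply)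
  qed
  with f show ?thesis by (rule that)
qed

text \<open>The vector is determined by its pairings because differentials separate tangent vectors. It exists
  because the tangent space has a finite frame: take the combination of frame vectors whose
  coefficients are the values of \<open>A p \<alpha>\<close> on the dual covectors.\<close>

lemma sharp:
  assumes A: "A p \<in> bivectors E p" and \<alpha>: "\<alpha> \<in> cotangent E p"
  shows "sharp E A p \<alpha> \<in> T p \<and> (\<forall>\<beta>\<in>cotangent E p. \<beta> (sharp E A p \<alpha>) = A p \<alpha> \<beta>)"
proof -
  obtain x :: "'m \<Rightarrow> 'e \<Rightarrow> real" and d where x: "\<And>b. x b \<in> C" and dT: "\<And>b. d b \<in> T p"
    and exp: "\<And>v. v \<in> T p \<Longrightarrow> v = (\<Sum>b\<in>onb. v (x b) *\<^sub>R d b)"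
    by (rule frame_at[of p]) (rule that)
  have A\<alpha>: "A p \<alpha> \<in> functionals_on (cotangent E p)" using A \<alpha> by (auto simp: bivectors_def)
  define v where "v = (\<Sum>b\<in>onb. A p \<alpha> (diff E (x b) p) *\<^sub>R d b)"
  have v: "v \<in> T p \<and> (\<forall>\<beta>\<in>cotangent E p. \<beta> v = A p \<alpha> \<beta>)"
  proof (intro conjI ballI)
    show "v \<in> T p" unfolding v_def by (intro subspace_sum subspace_scale subspace_tangent dT)
    fix \<beta> assume \<beta>: "\<beta> \<in> cotangent E p"
    have "\<beta> = (\<Sum>b\<in>onb. \<beta> (d b) *\<^sub>R diff E (x b) p)"
    proof
      fix w
      show "\<beta> w = (\<Sum>b\<in>onb. \<beta> (d b) *\<^sub>R diff E (x b) p) w"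
      proof (cases "w \<in> T p")
        case True
        have "\<beta> w = \<beta> (\<Sum>b\<in>onb. w (x b) *\<^sub>R d b)" using exp[OF True] by simp
        also have "\<dots> = (\<Sum>b\<in>onb. w (x b) * \<beta> (d b))" by (rule cotangent_sum[OF \<beta> dT])
        finally show ?thesis using True by (simp add: sum_fun_apply scaleR_fun_apply diff_apply mult.commute)
      next
        case False
        then show ?thesis using \<beta>
          by (simp add: sum_fun_apply scaleR_fun_apply diff_def cotangent_def functionals_on_def)
      qed
    qed
    then have "A p \<alpha> \<beta> = A p \<alpha> (\<Sum>b\<in>onb. \<beta> (d b) *\<^sub>R diff E (x b) p)" by simp
    also have "\<dots> = (\<Sum>b\<in>onb. \<beta> (d b) * A p \<alpha> (diff E (x b) p))"
      by (rule functionals_on_sum[OF A\<alpha>])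
        (auto simp: cotangent_def[symmetric] diff_cotangent x, simp add: cotangent_def subspace_functionals_on)
    also have "\<dots> = \<beta> v"
      unfolding v_def by (subst cotangent_sum[OF \<beta> dT], simp add: mult.commute)
    finally show "\<beta> v = A p \<alpha> \<beta>" by simp
  qed
  have "w = v" if w: "w \<in> T p \<and> (\<forall>\<beta>\<in>cotangent E p. \<beta> w = A p \<alpha> \<beta>)" for w
  proof (rule tangent_eqI[of _ p])
    fix f assume f: "f \<in> C"
    show "w f = v f" using v w diff_cotangent[OF f, of p] diff_apply[of w p f] diff_apply[of v p f] by metis
  qed (use v w in auto)
  with v have "\<exists>!v. v \<in> T p \<and> (\<forall>\<beta>\<in>cotangent E p. \<beta> v = A p \<alpha> \<beta>)" by blast
  from theI'[OF this] show ?thesis unfolding sharp_def .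
qed

lemma sharp_tangent: "A p \<in> bivectors E p \<Longrightarrow> \<alpha> \<in> cotangent E p \<Longrightarrow> sharp E A p \<alpha> \<in> T p"
  and sharp_pairing: "A p \<in> bivectors E p \<Longrightarrow> \<alpha> \<in> cotangent E p \<Longrightarrow> \<beta> \<in> cotangent E p \<Longrightarrow>
    \<beta> (sharp E A p \<alpha>) = A p \<alpha> \<beta>"
  using sharp by blast+

lemma sharp_apply:
  "A p \<in> bivectors E p \<Longrightarrow> \<alpha> \<in> cotangent E p \<Longrightarrow> g \<in> C \<Longrightarrow> sharp E A p \<alpha> g = A p \<alpha> (diff E g p)"
  using sharp_pairing[OF _ _ diff_cotangent, of A p \<alpha> g] sharp_tangent[of A p \<alpha>] by (simp add: diff_apply)

lemma bivector_fieldD: "A \<in> bivector_fields E \<Longrightarrow> A p \<in> bivectors E p"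
  by (simp add: bivector_fields_def)

lemma bivector_skew:
  "A p \<in> bivectors E p \<Longrightarrow> \<alpha> \<in> cotangent E p \<Longrightarrow> \<beta> \<in> cotangent E p \<Longrightarrow> A p \<alpha> \<beta> = - A p \<beta> \<alpha>"
  unfolding bivectors_def by blast

lemma diff_one_form: "f \<in> C \<Longrightarrow> diff E f \<in> one_forms E"
  unfolding one_forms_def by (auto simp: diff_cotangent diff_apply vector_field_tangent vector_field_smooth)

lemma ham_field_apply:
  "A \<in> bivector_fields E \<Longrightarrow> f \<in> C \<Longrightarrow> g \<in> C \<Longrightarrow> ham_field E A f p g = on_diffs E A f g p"
  using sharp_apply[of A p "diff E f p" g]
  by (simp add: ham_field_def on_diffs_def bivector_fieldD diff_cotangent)

lemma on_diffs_smooth: "A \<in> bivector_fields E \<Longrightarrow> f \<in> C \<Longrightarrow> g \<in> C \<Longrightarrow> on_diffs E A f g \<in> C"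
  unfolding on_diffs_def bivector_fields_def using diff_one_form by blast

lemma on_diffs_skew: "A \<in> bivector_fields E \<Longrightarrow> f \<in> C \<Longrightarrow> g \<in> C \<Longrightarrow> on_diffs E A f g p = - on_diffs E A g f p"
  using bivector_skew[of A p "diff E f p" "diff E g p"]
  by (simp add: on_diffs_def bivector_fieldD diff_cotangent)

lemma ham_field_vector_field: "A \<in> bivector_fields E \<Longrightarrow> f \<in> C \<Longrightarrow> ham_field E A f \<in> VF"
  unfolding vector_fields_def
proof safe
  show "ham_field E A f p \<in> T p" if "A \<in> bivector_fields E" "f \<in> C" for p
    unfolding ham_field_def by (intro sharp_tangent bivector_fieldD diff_cotangent that)
  show "(\<lambda>p. ham_field E A f p g) \<in> C" if "A \<in> bivector_fields E" "f \<in> C" "g \<in> C" for g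
    using on_diffs_smooth[OF that] by (simp add: ham_field_apply that)
qed

lemma ham_field_tangent: "A \<in> bivector_fields E \<Longrightarrow> f \<in> C \<Longrightarrow> ham_field E A f p \<in> T p"
  by (rule vector_field_tangent[OF ham_field_vector_field])

lemma on_diffs_eq_ham_right: "A \<in> bivector_fields E \<Longrightarrow> f \<in> C \<Longrightarrow> g \<in> C \<Longrightarrow> on_diffs E A f g p = ham_field E A f p g"
  by (simp add: ham_field_apply)

lemma on_diffs_eq_ham_left: "A \<in> bivector_fields E \<Longrightarrow> f \<in> C \<Longrightarrow> g \<in> C \<Longrightarrow> on_diffs E A f g p = - ham_field E A g p f"
  using on_diffs_skew[of A f g p] by (simp add: ham_field_apply)

section \<open>Lie brackets and Lie derivatives\<close>

lemma lie_bracket_tangent: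
  assumes X: "X \<in> VF" and Y: "Y \<in> VF"
  shows "lie_bracket X Y p \<in> T p"
proof (rule tangentI)
  note tX = vector_field_tangent[OF X] and tY = vector_field_tangent[OF Y]
  note XY = vector_field_smooth[OF X] vector_field_smooth[OF Y] tangent_add[OF tX] tangent_add[OF tY]
    tangent_mult[OF tX] tangent_mult[OF tY] tangent_scale[OF tX] tangent_scale[OF tY] Cinf_mult
  fix f g assume f: "f \<in> C" and g: "g \<in> C"
  show "lie_bracket X Y p (\<lambda>q. f q + g q) = lie_bracket X Y p f + lie_bracket X Y p g"
    using f g by (simp add: lie_bracket_def XY)
  show "lie_bracket X Y p (\<lambda>q. f q * g q) = f p * lie_bracket X Y p g + g p * lie_bracket X Y p f"
    using f g by (simp add: lie_bracket_def XY algebra_simps)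
  fix c :: real
  show "lie_bracket X Y p (\<lambda>q. c * f q) = c * lie_bracket X Y p f"
    using f by (simp add: lie_bracket_def XY algebra_simps)
next
  fix f assume "f \<notin> C"
  then show "lie_bracket X Y p f = 0"
    using tangent_const[OF vector_field_tangent[OF X, of p], of 0] tangent_const[OF vector_field_tangent[OF Y, of p], of 0]
    by (simp add: lie_bracket_def tangent_eq_0[OF vector_field_tangent[OF X]] tangent_eq_0[OF vector_field_tangent[OF Y]])
qed

text \<open>A Lie derivative along \<open>S + \<Sum>\<^sub>i a\<^sub>i X\<^sub>i\<close> is tensorial up to the terms in which the coefficients
  are differentiated by the Hamiltonian fields of the arguments.\<close>

lemma lie_derivative_combination:
  assumes A: "A \<in> bivector_fields E" and S: "S \<in> VF" and W: "W \<in> VF"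
    and X: "\<And>i. i \<in> I \<Longrightarrow> X i \<in> VF" and a: "\<And>i. i \<in> I \<Longrightarrow> a i \<in> C"
    and eq: "near p (\<lambda>q. W q = S q + (\<Sum>i\<in>I. a i q *\<^sub>R X i q))"
    and f: "f \<in> C" and g: "g \<in> C"
  shows "lie_derivative E W A f g p = lie_derivative E S A f g p +
    (\<Sum>i\<in>I. a i p * lie_derivative E (X i) A f g p
       - on_diffs E A (a i) g p * X i p f - on_diffs E A f (a i) p * X i p g)"
proof -
  have Wh: "W p h = S p h + (\<Sum>i\<in>I. a i p * X i p h)" for h
    using eventually_nhds_x_imp_x[OF eq] by (simp add: sum_fun_apply scaleR_fun_apply)
  have deriv: "v (\<lambda>q. W q h) = v (\<lambda>q. S q h) + (\<Sum>i\<in>I. a i p * v (\<lambda>q. X i q h) + X i p h * v (a i))"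
    if v: "v \<in> T p" and h: "h \<in> C" for v h
  proof -
    have sm: "(\<lambda>q. S q h) \<in> C" "\<And>i. i \<in> I \<Longrightarrow> (\<lambda>q. X i q h) \<in> C"
      using vector_field_smooth[OF S h] vector_field_smooth[OF X h] by auto
    have ai: "(\<lambda>q. a i q * X i q h) \<in> C" if "i \<in> I" for i using sm a that by (intro Cinf_intros)
    have "near p (\<lambda>q. W q h = S q h + (\<Sum>i\<in>I. a i q * X i q h))"
      using eq by eventually_elim (simp add: sum_fun_apply scaleR_fun_apply)
    then have "v (\<lambda>q. W q h) = v (\<lambda>q. S q h + (\<Sum>i\<in>I. a i q * X i q h))"
      using ai sm by (intro tangent_local[OF v] vector_field_smooth[OF W h] Cinf_add Cinf_sum) auto
    also have "\<dots> = v (\<lambda>q. S q h) + (\<Sum>i\<in>I. v (\<lambda>q. a i q * X i q h))"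
      using ai sm tangent_add[OF v sm(1) Cinf_sum[of I "\<lambda>i q. a i q * X i q h"]]
        tangent_sum[OF v, of I "\<lambda>i q. a i q * X i q h"] by simp
    also have "(\<Sum>i\<in>I. v (\<lambda>q. a i q * X i q h)) = (\<Sum>i\<in>I. a i p * v (\<lambda>q. X i q h) + X i p h * v (a i))"
      by (rule sum.cong) (use sm a tangent_mult[OF v] in auto)
    finally show ?thesis .
  qed
  have V: "(\<lambda>q. Y q h) \<in> C" if "Y \<in> VF" "h \<in> C" for Y h
    by (rule vector_field_smooth[OF that])
  have L: "lie_derivative E Y A f g p =
      Y p (on_diffs E A f g) + ham_field E A g p (\<lambda>q. Y q f) - ham_field E A f p (\<lambda>q. Y q g)"
    if "Y \<in> VF" for Y
    using on_diffs_eq_ham_left[OF A V[OF that f] g, of p] on_diffs_eq_ham_right[OF A f V[OF that g], of p]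
    by (simp add: lie_derivative_def)
  have "lie_derivative E W A f g p = lie_derivative E S A f g p +
     (\<Sum>i\<in>I. a i p * X i p (on_diffs E A f g)) +
     (\<Sum>i\<in>I. a i p * ham_field E A g p (\<lambda>q. X i q f) + X i p f * ham_field E A g p (a i)) -
     (\<Sum>i\<in>I. a i p * ham_field E A f p (\<lambda>q. X i q g) + X i p g * ham_field E A f p (a i))"
    unfolding L[OF W] L[OF S] Wh
      deriv[OF ham_field_tangent[OF A g] f] deriv[OF ham_field_tangent[OF A f] g] by simp
  also have "\<dots> = lie_derivative E S A f g p +
    (\<Sum>i\<in>I. a i p * X i p (on_diffs E A f g) +
     (a i p * ham_field E A g p (\<lambda>q. X i q f) + X i p f * ham_field E A g p (a i)) -
     (a i p * ham_field E A f p (\<lambda>q. X i q g) + X i p g * ham_field E A f p (a i)))"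
    by (simp add: sum.distrib sum_subtractf)
  also have "\<dots> = lie_derivative E S A f g p +
    (\<Sum>i\<in>I. a i p * lie_derivative E (X i) A f g p
       - on_diffs E A (a i) g p * X i p f - on_diffs E A f (a i) p * X i p g)"
  proof (intro arg_cong2[where f=plus] refl sum.cong)
    fix i assume i: "i \<in> I"
    have "on_diffs E A (a i) g p = - ham_field E A g p (a i)" "on_diffs E A f (a i) p = ham_field E A f p (a i)"
      using on_diffs_eq_ham_left[OF A a[OF i] g] on_diffs_eq_ham_right[OF A f a[OF i]] by auto
    then show "a i p * X i p (on_diffs E A f g) +
       (a i p * ham_field E A g p (\<lambda>q. X i q f) + X i p f * ham_field E A g p (a i)) -
       (a i p * ham_field E A f p (\<lambda>q. X i q g) + X i p g * ham_field E A f p (a i)) =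
       a i p * lie_derivative E (X i) A f g p
       - on_diffs E A (a i) g p * X i p f - on_diffs E A f (a i) p * X i p g"
      unfolding L[OF X[OF i]] by (simp add: algebra_simps)
  qed
  finally show ?thesis .
qed

end

section \<open>Dual frames near a point\<close>

context smooth_mfd
begin

text \<open>Gauss-Jordan elimination on the matrix \<open>X\<^sub>i(Y\<^sub>j)\<close>, which is the identity at \<open>p\<close>: the columns in \<open>J\<close>
  have already been normalised near \<open>p\<close>, while the other columns are only known to be normalised at
  \<open>p\<close>. The pivots equal \<open>1\<close> at \<open>p\<close>, so they can be inverted nearby. The fields never leave the
  module \<open>M\<close>; this is how tangency to a distribution, or a special form of the fields, is retained.\<close>

lemma dual_fields_near:
  assumes fin: "finite I" and Y: "\<And>i. i \<in> I \<Longrightarrow> Y i \<in> C"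
    and M: "M \<subseteq> VF"
    and M_add: "\<And>X Z. X \<in> M \<Longrightarrow> Z \<in> M \<Longrightarrow> (\<lambda>q. X q + Z q) \<in> M"
    and M_mult: "\<And>f X. f \<in> C \<Longrightarrow> X \<in> M \<Longrightarrow> (\<lambda>q. f q *\<^sub>R X q) \<in> M"
    and start: "\<And>i. i \<in> I \<Longrightarrow> \<exists>X\<in>M. \<forall>j\<in>I. X p (Y j) = (if i = j then 1 else 0)"
  obtains X where "\<And>i. i \<in> I \<Longrightarrow> X i \<in> M"
    "near p (\<lambda>q. \<forall>i\<in>I. \<forall>j\<in>I. X i q (Y j) = (if i = j then 1 else 0))"
proof -
  have step: "J \<subseteq> I \<Longrightarrow> \<exists>X. (\<forall>i\<in>I. X i \<in> M \<and> (\<forall>j\<in>I. X i p (Y j) = (if i = j then 1 else 0))) \<and>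
     near p (\<lambda>q. \<forall>i\<in>I. \<forall>j\<in>J. X i q (Y j) = (if i = j then 1 else 0))" if "finite J" for J
    using that
  proof (induction J)
    case empty
    have "\<forall>i\<in>I. \<exists>X. X \<in> M \<and> (\<forall>j\<in>I. X p (Y j) = (if i = j then 1 else 0))" using start by blast
    from bchoice[OF this] obtain X where
      "\<forall>i\<in>I. X i \<in> M \<and> (\<forall>j\<in>I. X i p (Y j) = (if i = j then 1 else 0))" by blast
    then show ?case by (intro exI[of _ X]) simp
  next
    case (insert k J)
    then obtain X where X: "\<And>i. i \<in> I \<Longrightarrow> X i \<in> M"
      and Xp: "\<And>i j. i \<in> I \<Longrightarrow> j \<in> I \<Longrightarrow> X i p (Y j) = (if i = j then 1 else 0)"
      and Xn: "near p (\<lambda>q. \<forall>i\<in>I. \<forall>j\<in>J. X i q (Y j) = (if i = j then 1 else 0))"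
      by auto
    have k: "k \<in> I" "k \<notin> J" using insert by auto
    have XY: "(\<lambda>q. X i q (Y j)) \<in> C" if "i \<in> I" "j \<in> I" for i j
      by (rule vector_field_smooth) (use X M Y that in auto)
    obtain g where g: "g \<in> C" "g p = 1" "near p (\<lambda>q. g q * X k q (Y k) = 1)"
      using local_reciprocal[OF XY[OF k(1) k(1)], of p] Xp[OF k(1) k(1)] by auto
    define Z where "Z q = g q *\<^sub>R X k q" for q
    \<comment> \<open>the pivot row is scaled and subtracted from the others, so that column \<open>k\<close> is normalised as well\<close>
    define X' where "X' i q = (if i = k then Z q else X i q + (- X i q (Y k)) *\<^sub>R Z q)" for i q
    have Z: "Z \<in> M" unfolding Z_def by (intro M_mult g X k)
    have X': "X' i \<in> M" if "i \<in> I" for i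
    proof (cases "i = k")
      case False
      then have "X' i = (\<lambda>q. X i q + (- X i q (Y k)) *\<^sub>R Z q)" by (auto simp: X'_def fun_eq_iff)
      also have "\<dots> \<in> M" by (intro M_add M_mult Cinf_uminus XY X Z that k)
      finally show ?thesis .
    qed (use Z in \<open>simp add: X'_def[abs_def]\<close>)
    have ev: "X' i q f = (if i = k then g q * X k q f else X i q f - X i q (Y k) * (g q * X k q f))" for i q f
      by (simp add: X'_def Z_def scaleR_fun_apply)
    have "X' i p (Y j) = (if i = j then 1 else 0)" if "i \<in> I" "j \<in> I" for i j
      using that k Xp g(2) by (simp add: ev)
    moreover have "near p (\<lambda>q. \<forall>i\<in>I. \<forall>j\<in>insert k J. X' i q (Y j) = (if i = j then 1 else 0))"
      using Xn g(3)
    proof eventually_elim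
      case (elim q)
      show ?case
      proof (intro ballI)
        fix i j assume i: "i \<in> I" and j: "j \<in> insert k J"
        show "X' i q (Y j) = (if i = j then 1 else 0)"
        proof (cases "j = k")
          case True
          then show ?thesis using elim i by (simp add: ev)
        next
          case False
          then have "X k q (Y j) = 0" "X i q (Y j) = (if i = j then 1 else 0)" using elim i j k by auto
          then show ?thesis using False by (cases "i = j") (auto simp: ev)
        qed
      qed
    qed
    ultimately show ?case using X' by (intro exI[of _ X']) auto
  qed
  from step[OF fin subset_refl] show ?thesis using that by blast
qed

end

section \<open>Fibre bundles\<close>

locale smooth_bundle = smooth_mfd E + base: smooth_mfd B
  for E :: "('e::{t2_space,second_countable_topology}, 'm::model_space) chart set"
    and B :: "('b::{t2_space,second_countable_topology}, 'n::model_space) chart set" +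
  fixes \<pi> :: "'e \<Rightarrow> 'b"
  assumes fiber_bundle: "fiber_bundle E B \<pi>"
begin

abbreviation "V \<equiv> vertical E B \<pi>"
abbreviation "basic g \<equiv> (\<lambda>q. g (\<pi> q))"
text \<open>At \<open>\<pi> q\<close> the fields \<open>u\<close> form the frame dual to the coordinates \<open>y\<close>.\<close>

abbreviation "adapted (y :: 'n \<Rightarrow> 'b \<Rightarrow> real) u q \<equiv> (\<forall>b\<in>onb. \<forall>b'\<in>onb. u b (\<pi> q) (y b') = (if b = b' then 1 else 0)) \<and>
  (\<forall>w\<in>tangent B (\<pi> q). w = (\<Sum>b\<in>onb. w (y b) *\<^sub>R u b (\<pi> q)))"

abbreviation "spanned D (y :: 'n \<Rightarrow> 'b \<Rightarrow> real) h q \<equiv> (\<forall>b\<in>onb. h b q \<in> D q) \<and>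
  (\<forall>v\<in>D q. v = (\<Sum>b\<in>onb. v (basic (y b)) *\<^sub>R h b q))"

lemma continuous_projection: "isCont \<pi> p"
  using fiber_bundle unfolding fiber_bundle_def smooth_map_def by (auto simp: continuous_on_eq_continuous_at)

lemma near_projection: "eventually Q (nhds (\<pi> p)) \<Longrightarrow> near p (\<lambda>q. Q (\<pi> q))"
proof -
  have "(\<pi> \<longlongrightarrow> \<pi> p) (nhds p)"
    using continuous_projection[of p] by (simp add: continuous_within tendsto_nhds_iff)
  then show "eventually Q (nhds (\<pi> p)) \<Longrightarrow> near p (\<lambda>q. Q (\<pi> q))"
    by (simp add: filterlim_iff)
qed

lemma pullback_smooth:
  assumes g: "g \<in> Cinf B"
  shows "(basic g) \<in> C"
  unfolding Cinf_iff
proof (clarify, rule smooth_on_local)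
  fix U \<phi> y assume c: "(U, \<phi>) \<in> E" and "y \<in> \<phi> ` U"
  then obtain q where q: "q \<in> U" "y = \<phi> q" by auto
  have cm: "(U, \<phi>) \<in> max_atlas E" using c atlas_subset_max_atlas by auto
  obtain W \<psi> where b: "(W, \<psi>) \<in> B" "\<pi> q \<in> W" and bm: "(W, \<psi>) \<in> max_atlas B"
    by (rule base.chart_around)
  have pi: "continuous_on UNIV \<pi>" "smooth_on (\<psi> \<circ> \<pi> \<circ> inv_into U \<phi>) (\<phi> ` (U \<inter> \<pi> -` W))"
    using fiber_bundle c b unfolding fiber_bundle_def smooth_map_def by auto
  let ?N = "\<phi> ` (U \<inter> \<pi> -` W)"
  have "open (\<pi> -` W)" by (rule open_vimage[OF base.max_atlasD(1)[OF bm] pi(1)])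
  then have N: "open ?N" by (rule open_chart_image[OF cm])
  have "smooth_on (\<lambda>y. (\<lambda>z. g (inv_into W \<psi> z)) ((\<psi> \<circ> \<pi> \<circ> inv_into U \<phi>) y)) ?N"
    by (rule smooth_on_compose[OF N base.max_atlasD(2)[OF bm] _ pi(2) base.Cinf_in_chart[OF g bm]])
      (use max_atlasD(7)[OF cm] in auto)
  then have "smooth_on (\<lambda>y. g (\<pi> (inv_into U \<phi> y))) ?N"
    by (rule smooth_on_cong[OF N, THEN iffD1, rotated])
      (use max_atlasD(7)[OF cm] base.max_atlasD(7)[OF bm] in auto)
  then show "\<exists>N. open N \<and> y \<in> N \<and> smooth_on (\<lambda>y. g (\<pi> (inv_into U \<phi> y))) N"
    using N q b by blast
qed

lemma dmap_apply: "g \<in> Cinf B \<Longrightarrow> dmap B \<pi> v g = v (basic g)"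
  by (simp add: dmap_def o_def)

lemma dmap_tangent: "v \<in> T p \<Longrightarrow> dmap B \<pi> v \<in> tangent B (\<pi> p)"
  using fiber_bundle unfolding fiber_bundle_def by blast

lemma dmap_surj: "u \<in> tangent B (\<pi> p) \<Longrightarrow> \<exists>v\<in>T p. dmap B \<pi> v = u"
  using fiber_bundle unfolding fiber_bundle_def by (metis imageE)

lemma vertical_iff: "v \<in> V p \<longleftrightarrow> v \<in> T p \<and> (\<forall>g\<in>Cinf B. v (basic g) = 0)"
  unfolding vertical_def dmap_def by (auto simp: fun_eq_iff o_def split: if_splits)

lemma vertical_tangent: "v \<in> V p \<Longrightarrow> v \<in> T p"
  by (simp add: vertical_iff)

lemma vertical_basic: "v \<in> V p \<Longrightarrow> g \<in> Cinf B \<Longrightarrow> v (basic g) = 0"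
  by (simp add: vertical_iff)

lemma vertical_diff_iff:
  "v \<in> T p \<Longrightarrow> w \<in> T p \<Longrightarrow> v - w \<in> V p \<longleftrightarrow> (\<forall>g\<in>Cinf B. v (basic g) = w (basic g))"
  using subspace_diff[OF subspace_tangent, of v p w] by (simp add: vertical_iff)

lemma base_coordinates:
  obtains y :: "'n \<Rightarrow> 'b \<Rightarrow> real" and u where "\<And>b. y b \<in> Cinf B" "\<And>b. u b \<in> vector_fields B"
    "near p (adapted y u)"
proof -
  obtain y :: "'n \<Rightarrow> 'b \<Rightarrow> real" and u where yu: "\<And>b. y b \<in> Cinf B" "\<And>b. u b \<in> vector_fields B"
    "eventually (\<lambda>q. (\<forall>b\<in>onb. \<forall>b'\<in>onb. u b q (y b') = (if b = b' then 1 else 0)) \<and>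
       (\<forall>w\<in>tangent B q. w = (\<Sum>b\<in>onb. w (y b) *\<^sub>R u b q))) (nhds (\<pi> p))"
    by (rule base.frame[of "\<pi> p"]) (rule that)
  show ?thesis by (rule that[OF yu(1,2) near_projection[OF yu(3)]])
qed

lemma vertical_coordinates:
  fixes y :: "'n \<Rightarrow> 'b \<Rightarrow> real"
  assumes y: "\<And>b. y b \<in> Cinf B"
    and exp: "\<forall>w\<in>tangent B (\<pi> q). w = (\<Sum>b\<in>onb. w (y b) *\<^sub>R u b (\<pi> q))"
    and v: "v \<in> T q" "\<And>b. b \<in> onb \<Longrightarrow> v (basic (y b)) = 0"
  shows "v \<in> V q"
proof -
  have "dmap B \<pi> v = (\<Sum>b\<in>onb. dmap B \<pi> v (y b) *\<^sub>R u b (\<pi> q))" using exp dmap_tangent[OF v(1)] by blast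
  also have "\<dots> = 0" using v(2) y by (simp add: dmap_apply)
  finally show ?thesis using v(1) by (simp add: vertical_def)
qed

lemma direct_sumD:
  assumes "direct_sum (T p) S (V p)"
  shows "subspace S" "subspace (V p)" "v \<in> S \<Longrightarrow> v \<in> T p" "v \<in> S \<Longrightarrow> v \<in> V p \<Longrightarrow> v = 0"
    "w \<in> T p \<Longrightarrow> \<exists>v\<in>S. w - v \<in> V p"
proof -
  show S: "subspace S" and V: "subspace (V p)" using assms by (auto simp: direct_sum_def)
  have T: "T p = {h + v |h v. h \<in> S \<and> v \<in> V p}" and I: "S \<inter> V p = {0}"
    using assms by (auto simp: direct_sum_def)
  show "v \<in> T p" if "v \<in> S"
  proof -
    have "v = v + 0 \<and> v \<in> S \<and> 0 \<in> V p" using that subspace_0[OF V] by simp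
    then show ?thesis unfolding T by blast
  qed
  show "v \<in> S \<Longrightarrow> v \<in> V p \<Longrightarrow> v = 0" using I by auto
  show "\<exists>v\<in>S. w - v \<in> V p" if "w \<in> T p"
  proof -
    obtain h v where "h \<in> S" "v \<in> V p" "w = h + v" using \<open>w \<in> T p\<close> unfolding T by auto
    then show ?thesis by (intro bexI[of _ h]) simp_all
  qed
qed

text \<open>A complement \<open>D\<close> of \<open>V\<close> is mapped isomorphically onto the tangent spaces of the base. Hence
  \<open>D p\<close> contains vectors dual to the basic coordinates \<open>basic (y b)\<close>, and elimination makes them into
  fields that are dual nearby. These span \<open>D\<close>, since a vector of \<open>D\<close> killed by all basic coordinates
  is vertical.\<close>

lemma distribution_frame:
  fixes y :: "'n \<Rightarrow> 'b \<Rightarrow> real"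
  assumes D: "\<And>q. direct_sum (T q) (D q) (V q)"
    and M: "M \<subseteq> VF" "\<And>X. X \<in> M \<Longrightarrow> near p (\<lambda>q. X q \<in> D q)"
    and M_add: "\<And>X Z. X \<in> M \<Longrightarrow> Z \<in> M \<Longrightarrow> (\<lambda>q. X q + Z q) \<in> M"
    and M_mult: "\<And>f X. f \<in> C \<Longrightarrow> X \<in> M \<Longrightarrow> (\<lambda>q. f q *\<^sub>R X q) \<in> M"
    and M_extend: "\<And>v. v \<in> D p \<Longrightarrow> \<exists>X\<in>M. X p = v"
    and y: "\<And>b. y b \<in> Cinf B"
    and yu: "near p (adapted y u)"
    and u: "\<And>b. u b \<in> vector_fields B"
  obtains h where "\<And>b. b \<in> onb \<Longrightarrow> h b \<in> M"
    "near p (spanned D y h)"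
proof -
  \<comment> \<open>the \<open>D\<close>-component of a lift of \<open>u b\<close> is dual to the basic coordinates at \<open>p\<close>\<close>
  have start: "\<exists>X\<in>M. \<forall>b'\<in>onb. X p (basic (y b')) = (if b = b' then 1 else 0)" if b: "b \<in> onb" for b
  proof -
    obtain t where t: "t \<in> T p" "dmap B \<pi> t = u b (\<pi> p)"
      using dmap_surj[OF base.vector_field_tangent[OF u]] by blast
    obtain v where v: "v \<in> D p" "t - v \<in> V p" using direct_sumD(5)[OF D t(1)] by blast
    obtain X where X: "X \<in> M" "X p = v" using M_extend[OF v(1)] by blast
    have "v (basic (y b')) = (if b = b' then 1 else 0)" if "b' \<in> onb" for b'
    proof -
      have "v (basic (y b')) = t (basic (y b'))"
        using v vertical_diff_iff[OF t(1) direct_sumD(3)[OF D v(1)]] y by simp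
      also have "\<dots> = u b (\<pi> p) (y b')" using t(2) dmap_apply[OF y, of t b'] by simp
      finally show ?thesis using eventually_nhds_x_imp_x[OF yu] b that by simp
    qed
    with X show ?thesis by (intro bexI[of _ X]) auto
  qed
  obtain h where h: "\<And>b. b \<in> onb \<Longrightarrow> h b \<in> M"
    and hn: "near p (\<lambda>q. \<forall>b\<in>onb. \<forall>b'\<in>onb. h b q (basic (y b')) = (if b = b' then 1 else 0))"
    by (rule dual_fields_near[where I = "onb :: 'n set" and Y = "\<lambda>b q. y b (\<pi> q)" and M = M and p = p])
      (use finite_onb pullback_smooth[OF y] M(1) M_add M_mult start that in blast)+
  have hD: "near p (\<lambda>q. \<forall>b\<in>onb. h b q \<in> D q)"
    using M(2)[OF h] by (simp add: eventually_ball_finite_distrib finite_onb)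
  have "near p (spanned D y h)"
    using hn hD yu
  proof eventually_elim
    case (elim q)
    have "v = (\<Sum>b\<in>onb. v (basic (y b)) *\<^sub>R h b q)" if v: "v \<in> D q" for v
    proof -
      define w where "w = v - (\<Sum>b\<in>onb. v (basic (y b)) *\<^sub>R h b q)"
      have wD: "w \<in> D q" unfolding w_def
        using elim v by (intro subspace_diff subspace_sum subspace_scale direct_sumD(1)[OF D]) auto
      have "w (basic (y b')) = 0" if b': "b' \<in> onb" for b'
      proof -
        have "(\<Sum>b\<in>onb. v (basic (y b)) * h b q (basic (y b'))) =
            (\<Sum>b\<in>onb. if b = b' then v (basic (y b)) else 0)"
          by (rule sum.cong) (use elim b' in auto)
        also have "\<dots> = v (basic (y b'))" using b' by (simp add: finite_onb)
        finally show ?thesis by (simp add: w_def sum_fun_apply scaleR_fun_apply)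
      qed
      then have "w \<in> V q"
        by (intro vertical_coordinates[OF y _ direct_sumD(3)[OF D wD]]) (use elim in auto)
      with wD have "w = 0" by (rule direct_sumD(4)[OF D])
      then show ?thesis by (simp add: w_def)
    qed
    with elim show ?case by blast
  qed
  with h show ?thesis by (rule that)
qed

text \<open>The expansion turns smoothness of a section of \<open>D\<close> into smoothness of its derivatives of basic
  functions.\<close>

definition framed :: "('e \<Rightarrow> 'e tvec set) \<Rightarrow> bool" where
  "framed D \<longleftrightarrow> (\<forall>p. direct_sum (T p) (D p) (V p)) \<and>
     (\<forall>p. \<exists>y h. (\<forall>b :: 'n. y b \<in> Cinf B) \<and> (\<forall>b\<in>onb. h b \<in> VF) \<and>
        near p (spanned D y h))"

lemma framed_direct_sum: "framed D \<Longrightarrow> direct_sum (T p) (D p) (V p)"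
  by (simp add: framed_def)

lemma framed_frame:
  assumes "framed D"
  obtains y :: "'n \<Rightarrow> 'b \<Rightarrow> real" and h where "\<And>b. y b \<in> Cinf B"
    "\<And>b. b \<in> onb \<Longrightarrow> h b \<in> VF" "near p (spanned D y h)"
proof -
  from assms have "\<exists>y h. (\<forall>b :: 'n. y b \<in> Cinf B) \<and> (\<forall>b\<in>onb. h b \<in> VF) \<and> near p (spanned D y h)"
    by (simp add: framed_def)
  then show ?thesis using that by blast
qed

lemmas framedD = direct_sumD[OF framed_direct_sum]

text \<open>A section of a complement of the vertical bundle is smooth as soon as it differentiates basic
  functions to smooth functions, because its coefficients in the local frames are such derivatives.\<close>

lemma framed_section_smooth:
  assumes D: "framed D" and X: "\<And>p. X p \<in> D p" and basic: "\<And>g. g \<in> Cinf B \<Longrightarrow> (\<lambda>q. X q (basic g)) \<in> C"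
  shows "X \<in> VF"
proof (rule vector_field_localI)
  fix p
  obtain y h where y: "\<And>b. y b \<in> Cinf B"
    and h: "\<And>b. b \<in> onb \<Longrightarrow> h b \<in> VF" and n: "near p (spanned D y h)"
    by (rule framed_frame[OF D, of p]) (rule that)
  show "\<exists>Y\<in>VF. near p (\<lambda>q. X q = Y q)"
  proof (rule bexI)
    show "near p (\<lambda>q. X q = (\<Sum>b\<in>onb. X q (basic (y b)) *\<^sub>R h b q))"
      using n by eventually_elim (use X in blast)
    show "(\<lambda>q. \<Sum>b\<in>onb. X q (basic (y b)) *\<^sub>R h b q) \<in> VF"
      by (rule vector_field_combination[OF basic[OF y] h])
  qed
qed

lemma projection_field:
  assumes D: "framed D" and X: "X \<in> VF"
  obtains X' where "X' \<in> VF" "\<And>p. X' p \<in> D p" "\<And>p. X p - X' p \<in> V p"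
proof -
  have "\<forall>p. \<exists>v. v \<in> D p \<and> X p - v \<in> V p" using framedD(5)[OF D vector_field_tangent[OF X]] by blast
  then obtain X' where X': "\<And>p. X' p \<in> D p" "\<And>p. X p - X' p \<in> V p" by metis
  have eq: "X' p (basic g) = X p (basic g)" if "g \<in> Cinf B" for g p
    using vertical_diff_iff[OF vector_field_tangent[OF X] framedD(3)[OF D X'(1)]] X'(2) that by force
  have "X' \<in> VF"
    by (rule framed_section_smooth[OF D X'(1)])
      (simp add: eq vector_field_smooth[OF X pullback_smooth])
  then show ?thesis using X' by (rule that)
qed

text \<open>The projection of \<open>w\<close> to the base extends to a vector field with constant coefficients in a local
  frame; its lift to \<open>D\<close> passes through \<open>w\<close>, because \<open>D\<close> contains only one vector over each vector of
  the base.\<close>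

lemma projectable_section_through:
  assumes D: "framed D" and w: "w \<in> D p"
  obtains Z where "Z \<in> projectable_sections E B \<pi> D" "Z p = w"
proof -
  obtain y u where y: "\<And>b. y b \<in> Cinf B" and u: "\<And>b. u b \<in> vector_fields B"
    and n: "near p (adapted y u)"
    by (rule base_coordinates[of p]) (rule that)
  have wT: "w \<in> T p" by (rule framedD(3)[OF D w])
  define U where "U b = (\<Sum>c\<in>onb. dmap B \<pi> w (y c) *\<^sub>R u c b)" for b
  have U: "U \<in> vector_fields B"
    unfolding U_def[abs_def] by (intro base.vector_field_combination base.Cinf_const u)
  have Up: "U (\<pi> p) = dmap B \<pi> w"
    using eventually_nhds_x_imp_x[OF n] dmap_tangent[OF wT] by (simp add: U_def)
  have "\<forall>q. \<exists>v. v \<in> D q \<and> dmap B \<pi> v = U (\<pi> q)"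
  proof
    fix q
    obtain t where t: "t \<in> T q" "dmap B \<pi> t = U (\<pi> q)"
      using dmap_surj[OF base.vector_field_tangent[OF U]] by blast
    obtain v where v: "v \<in> D q" "t - v \<in> V q" using framedD(5)[OF D t(1)] by blast
    have "dmap B \<pi> v = dmap B \<pi> t"
      using v(2) vertical_diff_iff[OF t(1) framedD(3)[OF D v(1)]] by (auto simp: dmap_def fun_eq_iff o_def)
    with v(1) t(2) show "\<exists>v. v \<in> D q \<and> dmap B \<pi> v = U (\<pi> q)" by auto
  qed
  then obtain Z where Z: "\<And>q. Z q \<in> D q" "\<And>q. dmap B \<pi> (Z q) = U (\<pi> q)" by metis
  have "Z q (basic g) = U (\<pi> q) g" if "g \<in> Cinf B" for g q
    using Z(2)[of q] dmap_apply[OF that, of "Z q"] by simp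
  then have Zs: "Z \<in> VF"
    by (intro framed_section_smooth[OF D Z(1)])
      (simp add: pullback_smooth[OF base.vector_field_smooth[OF U]])
  have "Z p = w"
  proof -
    have "w - Z p \<in> V p"
      unfolding vertical_diff_iff[OF wT framedD(3)[OF D Z(1)]]
      using Z(2)[of p] Up dmap_apply[of _ w] dmap_apply[of _ "Z p"] by simp
    moreover have "w - Z p \<in> D p" by (intro subspace_diff framedD(1)[OF D] w Z(1))
    ultimately have "w - Z p = 0" using framedD(4)[OF D] by blast
    then show ?thesis by simp
  qed
  moreover have "Z \<in> projectable_sections E B \<pi> D"
    unfolding projectable_sections_def sections_def using Z Zs U by auto
  ultimately show ?thesis using that by blast
qed

section \<open>Foliations\<close>

lemma foliation_chart:
  assumes "foliation E TF"
  obtains U \<phi> K where "(U, \<phi>) \<in> max_atlas E" "p \<in> U" "subspace K"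
    "\<And>q. q \<in> U \<Longrightarrow> TF q = coord_vector E (U, \<phi>) q ` K"
  using assms unfolding foliation_def by fastforce

text \<open>In a foliated chart every vector of \<open>TF\<close> extends to a field with constant coefficients, which stays
  in \<open>TF\<close>.\<close>

lemma foliation_framed:
  assumes F: "foliation E TF" and D: "\<And>p. direct_sum (T p) (TF p) (V p)"
  shows "framed TF"
  unfolding framed_def
proof (intro conjI allI D)
  fix p
  obtain U \<phi> K where c: "(U, \<phi>) \<in> max_atlas E" "p \<in> U" and K: "subspace K"
    and TF: "\<And>q. q \<in> U \<Longrightarrow> TF q = coord_vector E (U, \<phi>) q ` K"
    by (rule foliation_chart[OF F, of p]) (rule that)
  obtain \<rho> where \<rho>: "\<And>w. (\<lambda>q. \<rho> q *\<^sub>R coord_vector E (U, \<phi>) q w) \<in> VF"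
    "near p (\<lambda>q. q \<in> U \<and> \<rho> q = 1)"
    by (rule chart_frame[OF c]) (rule that)
  obtain y u where y: "\<And>b. y b \<in> Cinf B" and u: "\<And>b. u b \<in> vector_fields B"
    and n: "near p (adapted y u)"
    by (rule base_coordinates[of p]) (rule that)
  let ?M = "{X \<in> VF. near p (\<lambda>q. X q \<in> TF q)}"
  obtain h where h: "\<And>b. b \<in> onb \<Longrightarrow> h b \<in> ?M"
    "near p (spanned TF y h)"
  proof (rule distribution_frame[where D=TF and M = ?M and p=p, OF D _ _ _ _ _ y n u])
    show "(\<lambda>q. X q + Z q) \<in> ?M" if "X \<in> ?M" "Z \<in> ?M" for X Z
      using that by (auto intro!: vector_field_add subspace_add direct_sumD(1)[OF D] elim: eventually_elim2)
    show "(\<lambda>q. f q *\<^sub>R X q) \<in> ?M" if "f \<in> C" "X \<in> ?M" for f X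
      using that by (auto intro!: vector_field_mult subspace_scale direct_sumD(1)[OF D] elim: eventually_mono)
    show "\<exists>X\<in>?M. X p = v" if v: "v \<in> TF p" for v
    proof -
      obtain k where k: "k \<in> K" "v = coord_vector E (U, \<phi>) p k" using v TF[OF c(2)] by auto
      have "near p (\<lambda>q. \<rho> q *\<^sub>R coord_vector E (U, \<phi>) q k \<in> TF q)"
        using \<rho>(2) by eventually_elim (use TF k in auto)
      then show ?thesis using \<rho>(1)[of k] k(2) eventually_nhds_x_imp_x[OF \<rho>(2)]
        by (intro bexI[of _ "\<lambda>q. \<rho> q *\<^sub>R coord_vector E (U, \<phi>) q k"]) auto
    qed
  qed (auto intro: that)
  show "\<exists>y h. (\<forall>b :: 'n. y b \<in> Cinf B) \<and> (\<forall>b\<in>onb. h b \<in> VF) \<and>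
        near p (spanned TF y h)"
    using y h by (intro exI[of _ y] exI[of _ h]) auto
qed

lemma linear_functional_separating:
  fixes K :: "'v::real_vector set"
  assumes "subspace K" "k \<notin> K"
  obtains L :: "'v \<Rightarrow> real" where "linear L" "\<And>x. x \<in> K \<Longrightarrow> L x = 0" "L k = 1"
proof -
  obtain S where S: "S \<subseteq> K" "independent S" "K \<subseteq> span S" using basis_exists[of K] by metis
  have spanS: "span S = K" using S assms(1) by (metis span_minimal subset_antisym)
  then have "independent (insert k S)" using S(2) assms(2) by (simp add: independent_insertI)
  then obtain L :: "'v \<Rightarrow> real" where L: "linear L" "\<forall>x\<in>insert k S. L x = (if x = k then 1 else 0)"
    using linear_independent_extend[where f="\<lambda>x. if x = k then 1 else 0"] by metis
  have "k \<notin> S" using S(1) assms(2) by blast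
  then have "\<forall>x\<in>S. L x = 0" using L(2) by auto
  then have "L x = 0" if "x \<in> K" for x
    using linear_eq_0_on_span[OF L(1)] that spanS by blast
  with L show ?thesis by (intro that[of L]) auto
qed

text \<open>If the coordinate vector of the bracket were not in \<open>K\<close>, a linear functional vanishing on \<open>K\<close> but not
  on it would give a function that is constant along the leaves near \<open>p\<close>; sections of \<open>TF\<close> kill such
  a function, and therefore so does their bracket.\<close>

lemma foliation_involutive:
  assumes F: "foliation E TF" and X: "X \<in> sections E TF" and Y: "Y \<in> sections E TF"
  shows "lie_bracket X Y p \<in> TF p"
proof -
  obtain U \<phi> K where c: "(U, \<phi>) \<in> max_atlas E" "p \<in> U" and K: "subspace K"
    and TF: "\<And>q. q \<in> U \<Longrightarrow> TF q = coord_vector E (U, \<phi>) q ` K"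
    by (rule foliation_chart[OF F, of p]) (rule that)
  obtain \<rho> where \<rho>:
    "\<And>L. linear L \<Longrightarrow> (\<lambda>q. \<rho> q * L (\<phi> q)) \<in> C"
    "near p (\<lambda>q. q \<in> U \<and> \<rho> q = 1)"
    "near p (\<lambda>q. \<forall>L w. linear L \<longrightarrow> coord_vector E (U, \<phi>) q w (\<lambda>q. \<rho> q * L (\<phi> q)) = L w)"
    "near p (\<lambda>q. \<forall>v\<in>T q. v = (\<Sum>b\<in>onb. v (\<lambda>q. \<rho> q * inner (\<phi> q) b) *\<^sub>R coord_vector E (U, \<phi>) q b))"
    by (rule chart_frame[OF c]) (rule that)
  have XY: "X \<in> VF" "Y \<in> VF" "\<And>q. X q \<in> TF q" "\<And>q. Y q \<in> TF q"
    using X Y by (auto simp: sections_def)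
  note lin = coord_vector_linear[OF c]
  define k where "k = (\<Sum>b\<in>onb. lie_bracket X Y p (\<lambda>q. \<rho> q * inner (\<phi> q) b) *\<^sub>R b)"
  have k: "lie_bracket X Y p = coord_vector E (U, \<phi>) p k"
    using eventually_nhds_x_imp_x[OF \<rho>(4)] lie_bracket_tangent[OF XY(1,2), of p]
    unfolding k_def by (simp add: linear_sum[OF lin] linear_scale[OF lin])
  have "k \<in> K"
  proof (rule ccontr)
    assume "k \<notin> K"
    then obtain L :: "'m \<Rightarrow> real" where L: "linear L" "\<And>x. x \<in> K \<Longrightarrow> L x = 0" "L k = 1"
      using linear_functional_separating[OF K] by metis
    define f where "f q = \<rho> q * L (\<phi> q)" for q
    have f: "f \<in> C" unfolding f_def by (rule \<rho>(1)[OF L(1)])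
    have zero: "Z p (\<lambda>q. W q f) = 0" if Z: "Z \<in> VF" and W: "W \<in> VF" "\<And>q. W q \<in> TF q" for Z W
    proof -
      have "near p (\<lambda>q. W q f = 0)"
        using \<rho>(2,3)
      proof eventually_elim
        case (elim q)
        then obtain w where "w \<in> K" "W q = coord_vector E (U, \<phi>) q w" using W(2)[of q] TF[of q] by auto
        then show ?case using elim L by (simp add: f_def[abs_def])
      qed
      then have "Z p (\<lambda>q. W q f) = Z p (\<lambda>_. 0)"
        by (rule tangent_local[OF vector_field_tangent[OF Z] vector_field_smooth[OF W(1) f] Cinf_const])
      then show ?thesis using tangent_const[OF vector_field_tangent[OF Z]] by simp
    qed
    have "lie_bracket X Y p f = 0" unfolding lie_bracket_def using zero[OF XY(1,2,4)] zero[OF XY(2,1,3)] by simp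
    moreover have "lie_bracket X Y p f = L k"
      unfolding k f_def[abs_def] using eventually_nhds_x_imp_x[OF \<rho>(3)] L(1) by blast
    ultimately show False using L(3) by simp
  qed
  then show ?thesis using k TF[OF c(2)] by auto
qed

end

context smooth_mfd
begin

section \<open>Poisson vector fields\<close>

lemma lie_derivative_eq:
  assumes A: "A \<in> bivector_fields E" and Y: "Y \<in> VF" and f: "f \<in> C" and g: "g \<in> C"
  shows "lie_derivative E Y A f g p =
      Y p (on_diffs E A f g) + ham_field E A g p (\<lambda>q. Y q f) - ham_field E A f p (\<lambda>q. Y q g)"
  using on_diffs_eq_ham_left[OF A vector_field_smooth[OF Y f] g, of p]
    on_diffs_eq_ham_right[OF A f vector_field_smooth[OF Y g], of p]
  by (simp add: lie_derivative_def)

lemma on_diffs_skew_fun: "A \<in> bivector_fields E \<Longrightarrow> f \<in> C \<Longrightarrow> g \<in> C \<Longrightarrow> on_diffs E A f g = (\<lambda>p. - on_diffs E A g f p)"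
  by (rule ext) (rule on_diffs_skew)

lemma lie_derivative_skew:
  assumes A: "A \<in> bivector_fields E" and Y: "Y \<in> VF" and f: "f \<in> C" and g: "g \<in> C"
  shows "lie_derivative E Y A f g p = - lie_derivative E Y A g f p"
  using tangent_uminus[OF vector_field_tangent[OF Y] on_diffs_smooth[OF A g f], of p]
  unfolding lie_derivative_eq[OF A Y f g] lie_derivative_eq[OF A Y g f]
  by (simp add: on_diffs_skew_fun[OF A f g])

text \<open>In one argument the Lie derivative is the derivation \<open>A\<^sup>\<sharp>d(Y g) - [Y, A\<^sup>\<sharp>dg]\<close>.\<close>

lemma lie_derivative_derivation:
  assumes A: "A \<in> bivector_fields E" and Y: "Y \<in> VF" and g: "g \<in> C"
  obtains \<tau> where "\<tau> \<in> T p" "\<And>f. f \<in> C \<Longrightarrow> lie_derivative E Y A f g p = \<tau> f"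
proof
  let ?G = "ham_field E A g"
  have G: "?G \<in> VF" by (rule ham_field_vector_field[OF A g])
  have Yg: "(\<lambda>q. Y q g) \<in> C" by (rule vector_field_smooth[OF Y g])
  show "ham_field E A (\<lambda>q. Y q g) p - lie_bracket Y ?G p \<in> T p"
    by (intro subspace_diff subspace_tangent ham_field_tangent[OF A Yg] lie_bracket_tangent Y G)
  fix f assume f: "f \<in> C"
  have "on_diffs E A f g = (\<lambda>q. - ?G q f)"
    by (rule ext) (rule on_diffs_eq_ham_left[OF A f g])
  then have "Y p (on_diffs E A f g) = - Y p (\<lambda>q. ?G q f)"
    using tangent_uminus[OF vector_field_tangent[OF Y] vector_field_smooth[OF G f]] by simp
  moreover have "ham_field E A f p (\<lambda>q. Y q g) = - ham_field E A (\<lambda>q. Y q g) p f"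
    using on_diffs_eq_ham_left[OF A f Yg, of p] on_diffs_eq_ham_right[OF A f Yg, of p] by simp
  ultimately show "lie_derivative E Y A f g p = (ham_field E A (\<lambda>q. Y q g) p - lie_bracket Y ?G p) f"
    unfolding lie_derivative_eq[OF A Y f g] by (simp add: lie_bracket_def)
qed

lemma lie_derivative_diff_field:
  assumes A: "A \<in> bivector_fields E" and Y: "Y \<in> VF" and Z: "Z \<in> VF"
    and f: "f \<in> C" and g: "g \<in> C"
  shows "lie_derivative E (\<lambda>q. Y q - Z q) A f g p = lie_derivative E Y A f g p - lie_derivative E Z A f g p"
  using tangent_diff[OF ham_field_tangent[OF A g] vector_field_smooth[OF Y f] vector_field_smooth[OF Z f], of p]
    tangent_diff[OF ham_field_tangent[OF A f] vector_field_smooth[OF Y g] vector_field_smooth[OF Z g], of p]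
  unfolding lie_derivative_eq[OF A vector_field_diff[OF Y Z] f g] lie_derivative_eq[OF A Y f g]
    lie_derivative_eq[OF A Z f g]
  by simp

lemma preservesD: "preserves E Z A \<Longrightarrow> f \<in> C \<Longrightarrow> g \<in> C \<Longrightarrow> lie_derivative E Z A f g p = 0"
  by (simp add: preserves_def)

lemma PoissD: "Z \<in> Poiss E A \<Longrightarrow> Z \<in> VF" "Z \<in> Poiss E A \<Longrightarrow> preserves E Z A"
  by (auto simp: Poiss_def)

lemma Poiss_diff: "A \<in> bivector_fields E \<Longrightarrow> Y \<in> Poiss E A \<Longrightarrow> Z \<in> Poiss E A \<Longrightarrow> (\<lambda>q. Y q - Z q) \<in> Poiss E A"
  unfolding Poiss_def preserves_def by (auto simp: lie_derivative_diff_field vector_field_diff fun_eq_iff)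

text \<open>The Jacobi identity of the bracket, read as a derivation property of \<open>on_diffs E A F\<close>.\<close>

lemma Ham_subset_Poiss:
  assumes A: "poisson_tensor E A"
  shows "Ham E A \<subseteq> Poiss E A"
proof -
  have Ab: "A \<in> bivector_fields E" using A by (simp add: poisson_tensor_def)
  have "ham_field E A F \<in> Poiss E A" if F: "F \<in> C" for F
    unfolding Poiss_def preserves_def
  proof (safe intro!: ham_field_vector_field[OF Ab F])
    fix f g assume f: "f \<in> C" and g: "g \<in> C"
    show "lie_derivative E (ham_field E A F) A f g = 0"
    proof
      fix p
      let ?b = "on_diffs E A"
      have sm: "?b f g \<in> C" "?b F f \<in> C" "?b F g \<in> C" "?b g F \<in> C" by (intro on_diffs_smooth Ab f g F)+
      have "schouten E A A f g F p = 0" using A f g F by (simp add: poisson_tensor_def)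
      then have jac: "?b (?b f g) F p + ?b (?b g F) f p + ?b (?b F f) g p = 0"
        by (simp add: schouten_def)
      have 1: "(\<lambda>q. ham_field E A F q f) = ?b F f" "(\<lambda>q. ham_field E A F q g) = ?b F g"
        by (auto simp: ham_field_apply Ab F f g)
      have 2: "ham_field E A F p (?b f g) = - ?b (?b f g) F p"
        using on_diffs_skew[OF Ab sm(1) F, of p] by (simp add: ham_field_apply Ab F sm)
      have "?b f (?b F g) p = ham_field E A f p (\<lambda>q. - ?b g F q)"
        unfolding on_diffs_skew_fun[OF Ab F g] by (rule on_diffs_eq_ham_right[OF Ab f Cinf_uminus[OF sm(4)]])
      also have "\<dots> = - ?b f (?b g F) p"
        by (simp add: tangent_uminus[OF ham_field_tangent[OF Ab f] sm(4)] on_diffs_eq_ham_right[OF Ab f sm(4)])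
      also have "\<dots> = ?b (?b g F) f p" using on_diffs_skew[OF Ab f sm(4), of p] by simp
      finally have 3: "?b f (?b F g) p = ?b (?b g F) f p" .
      show "lie_derivative E (ham_field E A F) A f g p = 0 p"
        unfolding lie_derivative_def 1 2 3 using jac by simp
    qed
  qed
  then show ?thesis by (auto simp: Ham_def)
qed

lemma ham_field_linear:
  assumes A: "A \<in> bivector_fields E" and f: "f \<in> C" and g: "g \<in> C"
  shows "ham_field E A (\<lambda>q. k * f q + l * g q) p = k *\<^sub>R ham_field E A f p + l *\<^sub>R ham_field E A g p"
proof (rule tangent_eqI[of _ p])
  have fg: "(\<lambda>q. k * f q + l * g q) \<in> C" by (intro Cinf_intros f g)
  show "ham_field E A (\<lambda>q. k * f q + l * g q) p \<in> T p" by (rule ham_field_tangent[OF A fg])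
  show "k *\<^sub>R ham_field E A f p + l *\<^sub>R ham_field E A g p \<in> T p"
    by (intro subspace_add subspace_scale subspace_tangent ham_field_tangent A f g)
  fix h assume h: "h \<in> C"
  have "ham_field E A f' p h = - ham_field E A h p f'" if "f' \<in> C" for f'
    using on_diffs_eq_ham_left[OF A that h] on_diffs_eq_ham_right[OF A that h] by simp
  then show "ham_field E A (\<lambda>q. k * f q + l * g q) p h = (k *\<^sub>R ham_field E A f p + l *\<^sub>R ham_field E A g p) h"
    using tangent_add[OF ham_field_tangent[OF A h] Cinf_scale[OF f] Cinf_scale[OF g], of p k l]
    by (simp add: fg f g scaleR_fun_apply tangent_scale[OF ham_field_tangent[OF A h]])
qed

lemma ham_field_sum:
  assumes A: "A \<in> bivector_fields E" and f: "\<And>i. i \<in> I \<Longrightarrow> f i \<in> C"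
  shows "ham_field E A (\<lambda>q. \<Sum>i\<in>I. k i * f i q) p = (\<Sum>i\<in>I. k i *\<^sub>R ham_field E A (f i) p)"
  using f
proof (induction I rule: infinite_finite_induct)
  case (insert i I)
  have "(\<lambda>q. \<Sum>i\<in>I. k i * f i q) \<in> C" using insert.prems by (intro Cinf_sum Cinf_scale) auto
  from ham_field_linear[OF A _ this, of "f i" "k i" 1 p] insert show ?case by simp
next
  case empty
  show ?case using ham_field_linear[OF A Cinf_const Cinf_const, of 0 0 0 0 p] by simp
next
  case (infinite I)
  then show ?case using ham_field_linear[OF A Cinf_const Cinf_const, of 0 0 0 0 p] by simp
qed

lemma bivector_section_annihilates:
  assumes A: "A \<in> bivector_sections E D" and \<alpha>: "\<And>v. v \<in> D p \<Longrightarrow> \<alpha> v = 0"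
  shows "A p \<alpha> \<beta> = 0"
proof -
  have "A p \<in> span {wedge E p v w |v w. v \<in> D p \<and> w \<in> D p}" using A by (simp add: bivector_sections_def)
  then show ?thesis
  proof (induction rule: span_induct)
    case base
    show ?case by (rule subspaceI) (auto simp: scaleR_fun_apply)
  next
    case (step b)
    then show ?case using \<alpha> by (auto simp: wedge_def)
  qed
qed

end

section \<open>Coupling Poisson tensors\<close>

locale coupling = smooth_bundle E B \<pi>
  for E :: "('e::{t2_space,second_countable_topology}, 'm::model_space) chart set"
    and B :: "('b::{t2_space,second_countable_topology}, 'n::model_space) chart set" and \<pi> +
  fixes \<Lambda> P Q :: "'e \<Rightarrow> 'e bivec"
  assumes coupling_poisson: "coupling_poisson E B \<pi> \<Lambda>"
    and P: "P \<in> bivector_sections E (vertical E B \<pi>)"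
    and Q: "Q \<in> bivector_sections E (coupling_horizontal E B \<pi> \<Lambda>)"
    and decomposition: "\<Lambda> = Q + P"
begin

abbreviation "H \<equiv> coupling_horizontal E B \<pi> \<Lambda>"

lemma poisson: "poisson_tensor E \<Lambda>"
  and H_direct_sum: "direct_sum (T p) (H p) (V p)"
  using coupling_poisson by (auto simp: coupling_poisson_def)

lemmas H_D = direct_sumD[OF H_direct_sum]

lemma \<Lambda>_field: "\<Lambda> \<in> bivector_fields E" and P_field: "P \<in> bivector_fields E" and Q_field: "Q \<in> bivector_fields E"
  using poisson P Q by (auto simp: poisson_tensor_def bivector_sections_def)

lemma \<Lambda>_apply: "\<Lambda> p \<alpha> \<beta> = Q p \<alpha> \<beta> + P p \<alpha> \<beta>"
  by (simp add: decomposition)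

lemma ham_decomposition: "F \<in> C \<Longrightarrow> ham_field E \<Lambda> F p = ham_field E Q F p + ham_field E P F p"
  by (rule tangent_eqI[of _ p])
    (auto intro!: ham_field_tangent subspace_add subspace_tangent \<Lambda>_field P_field Q_field
      simp: ham_field_apply \<Lambda>_field P_field Q_field on_diffs_def \<Lambda>_apply)

lemma basic_annihilates: "g \<in> Cinf B \<Longrightarrow> v \<in> V p \<Longrightarrow> diff E (basic g) p v = 0"
  by (simp add: diff_apply vertical_tangent vertical_basic)

lemma basic_annihilator: "g \<in> Cinf B \<Longrightarrow> diff E (basic g) p \<in> annihilator E V p"
  by (simp add: annihilator_def diff_cotangent pullback_smooth basic_annihilates)

lemma ham_basic_horizontal: "g \<in> Cinf B \<Longrightarrow> ham_field E \<Lambda> (basic g) p \<in> H p"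
  unfolding ham_field_def coupling_horizontal_def using basic_annihilator by blast

lemma P_basic: "g \<in> Cinf B \<Longrightarrow> on_diffs E P (basic g) f p = 0"
  unfolding on_diffs_def by (rule bivector_section_annihilates[OF P basic_annihilates])

lemma ham_P_vertical:
  assumes F: "F \<in> C" shows "ham_field E P F p \<in> V p"
  unfolding vertical_iff
proof (intro conjI ballI ham_field_tangent[OF P_field F])
  fix g assume g: "g \<in> Cinf B"
  show "ham_field E P F p (basic g) = 0"
    using on_diffs_eq_ham_left[OF P_field pullback_smooth[OF g] F, of p] P_basic[OF g] by simp
qed

text \<open>A covector that annihilates \<open>V\<close> is determined by its values on lifts \<open>t b\<close> of the frame \<open>u\<close> of the base,
  hence it is a combination of the differentials of the basic coordinates. Applying \<open>\<Lambda>\<^sup>\<sharp>\<close> gives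
  the combination of Hamiltonian vectors.\<close>

lemma horizontal_module_extend:
  fixes y :: "'n \<Rightarrow> 'b \<Rightarrow> real"
  assumes y: "\<And>b. y b \<in> Cinf B" and u: "\<And>b. u b \<in> vector_fields B"
    and yu: "\<forall>w\<in>tangent B (\<pi> p). w = (\<Sum>b\<in>onb. w (y b) *\<^sub>R u b (\<pi> p))"
    and v: "v \<in> H p"
  obtains k where "v = (\<Sum>b\<in>onb. k b *\<^sub>R ham_field E \<Lambda> (basic (y b)) p)"
proof -
  let ?Y = "\<lambda>b q. y b (\<pi> q)"
  have Y: "?Y b \<in> C" for b by (rule pullback_smooth[OF y])
  obtain \<alpha> where \<alpha>: "\<alpha> \<in> cotangent E p" "\<And>v. v \<in> V p \<Longrightarrow> \<alpha> v = 0" "v = sharp E \<Lambda> p \<alpha>"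
    using v unfolding coupling_horizontal_def annihilator_def by auto
  have "\<forall>b. \<exists>t. t \<in> T p \<and> dmap B \<pi> t = u b (\<pi> p)"
    using dmap_surj[OF base.vector_field_tangent[OF u]] by blast
  then obtain t where t: "\<And>b. t b \<in> T p" "\<And>b. dmap B \<pi> (t b) = u b (\<pi> p)" by metis
  have \<alpha>t: "\<alpha> = diff E (\<lambda>q. \<Sum>b\<in>onb. \<alpha> (t b) * ?Y b q) p"
  proof (rule cotangent_eqI[OF \<alpha>(1) diff_cotangent])
    show "(\<lambda>q. \<Sum>b\<in>onb. \<alpha> (t b) * ?Y b q) \<in> C" by (intro Cinf_intros Y)
    fix w assume w: "w \<in> T p"
    let ?w = "\<Sum>b\<in>onb. w (?Y b) *\<^sub>R t b"
    have wT: "?w \<in> T p" by (intro subspace_sum subspace_scale subspace_tangent t)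
    have "w - ?w \<in> V p"
      unfolding vertical_diff_iff[OF w wT]
    proof
      fix g assume g: "g \<in> Cinf B"
      have "w (basic g) = (\<Sum>b\<in>onb. dmap B \<pi> w (y b) *\<^sub>R u b (\<pi> p)) g"
        using yu dmap_tangent[OF w] dmap_apply[OF g, of w] by metis
      also have "\<dots> = (\<Sum>b\<in>onb. w (?Y b) * t b (basic g))"
        by (simp add: sum_fun_apply scaleR_fun_apply dmap_apply y g t(2)[symmetric])
      finally show "w (basic g) = ?w (basic g)" by (simp add: sum_fun_apply scaleR_fun_apply)
    qed
    then have "\<alpha> (w - ?w) = 0" by (rule \<alpha>(2))
    then have "\<alpha> w = \<alpha> ?w"
      using functionals_on_diff[OF _ subspace_tangent w wT, of \<alpha>] \<alpha>(1) by (simp add: cotangent_def)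
    also have "\<dots> = (\<Sum>b\<in>onb. w (?Y b) * \<alpha> (t b))" by (rule cotangent_sum[OF \<alpha>(1) t(1)])
    also have "\<dots> = (\<Sum>b\<in>onb. \<alpha> (t b) *\<^sub>R diff E (?Y b) p) w"
      using w by (simp add: sum_fun_apply scaleR_fun_apply diff_apply mult.commute)
    also have "\<dots> = diff E (\<lambda>q. \<Sum>b\<in>onb. \<alpha> (t b) * ?Y b q) p w" by (simp add: diff_sum Y)
    finally show "\<alpha> w = diff E (\<lambda>q. \<Sum>b\<in>onb. \<alpha> (t b) * ?Y b q) p w" .
  qed
  have "v = ham_field E \<Lambda> (\<lambda>q. \<Sum>b\<in>onb. \<alpha> (t b) * ?Y b q) p"
    unfolding \<alpha>(3) ham_field_def using \<alpha>t by simp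
  also have "\<dots> = (\<Sum>b\<in>onb. \<alpha> (t b) *\<^sub>R ham_field E \<Lambda> (?Y b) p)"
    by (rule ham_field_sum[OF \<Lambda>_field Y])
  finally show ?thesis by (rule that)
qed

text \<open>Elimination within the module spanned by the Hamiltonian fields of basic coordinates yields a frame
  of \<open>H\<close> with smooth coefficients \<open>c\<close> with respect to these Hamiltonian fields.\<close>

lemma horizontal_frame:
  obtains y :: "'n \<Rightarrow> 'b \<Rightarrow> real" and h c where "\<And>b. y b \<in> Cinf B" "\<And>b. b \<in> onb \<Longrightarrow> h b \<in> VF"
    "\<And>b b'. b \<in> onb \<Longrightarrow> c b b' \<in> C"
    "\<And>b q. b \<in> onb \<Longrightarrow> h b q = (\<Sum>b'\<in>onb. c b b' q *\<^sub>R ham_field E \<Lambda> (basic (y b')) q)"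
    "near p (spanned H y h)"
proof -
  obtain y u where y: "\<And>b. y b \<in> Cinf B" and u: "\<And>b. u b \<in> vector_fields B"
    and n: "near p (adapted y u)"
    by (rule base_coordinates[of p]) (rule that)
  let ?X = "\<lambda>b. ham_field E \<Lambda> (basic (y b))"
  define M where "M = {X. \<exists>c. (\<forall>b. c b \<in> C) \<and> X = (\<lambda>q. \<Sum>b\<in>onb. c b q *\<^sub>R ?X b q)}"
  have X: "?X b \<in> VF" for b by (intro ham_field_vector_field \<Lambda>_field pullback_smooth y)
  obtain h where h: "\<And>b. b \<in> onb \<Longrightarrow> h b \<in> M"
    and hn: "near p (spanned H y h)"
  proof (rule distribution_frame[where D=H and M = M and p=p, OF H_direct_sum _ _ _ _ _ y n u])
    show "M \<subseteq> VF"
      unfolding M_def by (auto intro!: vector_field_combination X)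
    show "near p (\<lambda>q. X q \<in> H q)" if "X \<in> M" for X
      using that unfolding M_def
      by (auto intro!: always_eventually subspace_sum subspace_scale H_D(1) ham_basic_horizontal y)
    show "(\<lambda>q. X q + Z q) \<in> M" if "X \<in> M" "Z \<in> M" for X Z
    proof -
      obtain c d where "\<forall>b. c b \<in> C" "X = (\<lambda>q. \<Sum>b\<in>onb. c b q *\<^sub>R ?X b q)"
        "\<forall>b. d b \<in> C" "Z = (\<lambda>q. \<Sum>b\<in>onb. d b q *\<^sub>R ?X b q)" using \<open>X \<in> M\<close> \<open>Z \<in> M\<close> unfolding M_def by blast
      then show ?thesis unfolding M_def
        by (intro CollectI exI[of _ "\<lambda>b q. c b q + d b q"]) (simp add: Cinf_add scaleR_add_left sum.distrib)
    qed
    show "(\<lambda>q. f q *\<^sub>R X q) \<in> M" if "f \<in> C" "X \<in> M" for f X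
    proof -
      obtain c where "\<forall>b. c b \<in> C" "X = (\<lambda>q. \<Sum>b\<in>onb. c b q *\<^sub>R ?X b q)" using \<open>X \<in> M\<close> unfolding M_def by blast
      then show ?thesis unfolding M_def using \<open>f \<in> C\<close>
        by (intro CollectI exI[of _ "\<lambda>b q. f q * c b q"]) (simp add: Cinf_mult scaleR_sum_right)
    qed
    show "\<exists>X\<in>M. X p = v" if v: "v \<in> H p" for v
    proof -
      obtain k where k: "v = (\<Sum>b\<in>onb. k b *\<^sub>R ?X b p)"
        by (rule horizontal_module_extend[OF y u _ v]) (use eventually_nhds_x_imp_x[OF n] that in auto)
      show ?thesis unfolding M_def using k
        by (intro bexI[of _ "\<lambda>q. \<Sum>b\<in>onb. k b *\<^sub>R ?X b q"] CollectI exI[of _ "\<lambda>b q. k b"]) (auto simp: Cinf_const)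
    qed
  qed (rule that)
  have "\<forall>b\<in>onb. \<exists>c. (\<forall>b'. c b' \<in> C) \<and> h b = (\<lambda>q. \<Sum>b'\<in>onb. c b' q *\<^sub>R ?X b' q)"
    using h unfolding M_def by blast
  from bchoice[OF this] obtain c where
    c: "\<forall>b\<in>onb. (\<forall>b'. c b b' \<in> C) \<and> h b = (\<lambda>q. \<Sum>b'\<in>onb. c b b' q *\<^sub>R ?X b' q)" by blast
  show ?thesis
  proof (rule that)
    show "h b \<in> VF" if "b \<in> onb" for b
    proof -
      have "h b = (\<lambda>q. \<Sum>b'\<in>onb. c b b' q *\<^sub>R ?X b' q)" using c that by blast
      also have "\<dots> \<in> VF" by (rule vector_field_combination[OF _ X]) (use c that in blast)
      finally show ?thesis .
    qed
    show "h b q = (\<Sum>b'\<in>onb. c b b' q *\<^sub>R ?X b' q)" if "b \<in> onb" for b q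
      using c that by (metis (no_types))
    show "near p (spanned H y h)" by (rule hn)
  qed (use y c in auto)
qed

lemma H_framed: "framed H"
  unfolding framed_def
proof (intro conjI allI H_direct_sum)
  fix p
  obtain y h c where y: "\<And>b. y b \<in> Cinf B"
    and h: "\<And>b. b \<in> onb \<Longrightarrow> h b \<in> VF"
    and "\<And>b b'. b \<in> onb \<Longrightarrow> c b b' \<in> C"
    "\<And>b q. b \<in> onb \<Longrightarrow> h b q = (\<Sum>b'\<in>onb. c b b' q *\<^sub>R ham_field E \<Lambda> (basic (y b')) q)"
    and n: "near p (spanned H y h)"
    by (rule horizontal_frame[of p]) (rule that)
  show "\<exists>y h. (\<forall>b :: 'n. y b \<in> Cinf B) \<and> (\<forall>b\<in>onb. h b \<in> VF) \<and> near p (spanned H y h)"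
    using y h n by (intro exI[of _ y] exI[of _ h]) auto
qed

text \<open>The functions \<open>a b\<close> are the coefficients of a one-form \<open>\<Sum>\<^sub>b a\<^sub>b dy\<^sub>b\<close> that \<open>\<Lambda>\<^sup>\<sharp>\<close> maps to \<open>X\<close>.\<close>

lemma horizontal_field_expansion:
  assumes X: "X \<in> VF" "\<And>q. X q \<in> H q"
  obtains y :: "'n \<Rightarrow> 'b \<Rightarrow> real" and a where "\<And>b. y b \<in> Cinf B" "\<And>b. a b \<in> C"
    "near p (\<lambda>q. X q = (\<Sum>b\<in>onb. a b q *\<^sub>R ham_field E \<Lambda> (basic (y b)) q))"
proof -
  obtain y h c where y: "\<And>b. y b \<in> Cinf B" and h: "\<And>b. b \<in> onb \<Longrightarrow> h b \<in> VF"
    and c: "\<And>b b'. b \<in> onb \<Longrightarrow> c b b' \<in> C"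
    and hc: "\<And>b q. b \<in> onb \<Longrightarrow> h b q = (\<Sum>b'\<in>onb. c b b' q *\<^sub>R ham_field E \<Lambda> (basic (y b')) q)"
    and n: "near p (spanned H y h)"
    by (rule horizontal_frame[of p]) (rule that)
  define a where "a b' q = (\<Sum>b\<in>onb. X q (basic (y b)) * c b b' q)" for b' q
  have a: "a b' \<in> C" for b'
    unfolding a_def[abs_def]
    by (rule Cinf_sum, rule Cinf_mult[OF vector_field_smooth[OF X(1) pullback_smooth[OF y]] c])
  have "near p (\<lambda>q. X q = (\<Sum>b\<in>onb. a b q *\<^sub>R ham_field E \<Lambda> (basic (y b)) q))"
    using n
  proof eventually_elim
    case (elim q)
    have "X q = (\<Sum>b\<in>onb. X q (basic (y b)) *\<^sub>R h b q)" using elim X(2) by blast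
    also have "\<dots> = (\<Sum>b\<in>onb. \<Sum>b'\<in>onb. (X q (basic (y b)) * c b b' q) *\<^sub>R ham_field E \<Lambda> (basic (y b')) q)"
      by (rule sum.cong[OF refl]) (simp add: hc scaleR_sum_right)
    also have "\<dots> = (\<Sum>b'\<in>onb. \<Sum>b\<in>onb. (X q (basic (y b)) * c b b' q) *\<^sub>R ham_field E \<Lambda> (basic (y b')) q)"
      by (rule sum.swap)
    also have "\<dots> = (\<Sum>b\<in>onb. a b q *\<^sub>R ham_field E \<Lambda> (basic (y b)) q)"
      by (simp add: a_def scaleR_sum_left)
    finally show ?case .
  qed
  with y a show ?thesis by (rule that)
qed

text \<open>The field \<open>S\<close> and the Hamiltonian fields preserve \<open>\<Lambda>\<close>, so only those terms remain in which the
  coefficients are differentiated.\<close>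

lemma horizontal_lie_derivative:
  assumes S: "S \<in> Poiss E \<Lambda>" and W: "W \<in> VF"
    and a: "\<And>b :: 'n. a b \<in> C" and y: "\<And>b. y b \<in> Cinf B"
    and eq: "near p (\<lambda>q. W q - S q = (\<Sum>b\<in>onb. a b q *\<^sub>R ham_field E \<Lambda> (basic (y b)) q))"
    and f: "f \<in> C" and g: "g \<in> C"
  shows "lie_derivative E W \<Lambda> f g p =
    - (\<Sum>b\<in>onb. on_diffs E \<Lambda> (a b) g p * on_diffs E \<Lambda> (basic (y b)) f p
        + on_diffs E \<Lambda> f (a b) p * on_diffs E \<Lambda> (basic (y b)) g p)"
proof -
  let ?X = "\<lambda>b. ham_field E \<Lambda> (basic (y b))"
  have Y: "(basic (y b)) \<in> C" for b by (rule pullback_smooth[OF y])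
  have X: "?X b \<in> Poiss E \<Lambda>" for b using Ham_subset_Poiss[OF poisson] Y by (auto simp: Ham_def)
  have eq': "near p (\<lambda>q. W q = S q + (\<Sum>b\<in>onb. a b q *\<^sub>R ?X b q))"
    using eq by eventually_elim (simp add: algebra_simps)
  have "lie_derivative E W \<Lambda> f g p = lie_derivative E S \<Lambda> f g p +
    (\<Sum>b\<in>onb. a b p * lie_derivative E (?X b) \<Lambda> f g p
       - on_diffs E \<Lambda> (a b) g p * ?X b p f - on_diffs E \<Lambda> f (a b) p * ?X b p g)"
    by (rule lie_derivative_combination[OF \<Lambda>_field PoissD(1)[OF S] W PoissD(1)[OF X] a eq' f g])
  also have "\<dots> = - (\<Sum>b\<in>onb. on_diffs E \<Lambda> (a b) g p * on_diffs E \<Lambda> (basic (y b)) f p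
        + on_diffs E \<Lambda> f (a b) p * on_diffs E \<Lambda> (basic (y b)) g p)"
    by (simp add: preservesD[OF PoissD(2)[OF S] f g] preservesD[OF PoissD(2)[OF X] f g]
        ham_field_apply \<Lambda>_field Y f g sum_negf[symmetric])
  finally show ?thesis .
qed

text \<open>Brackets of \<open>P\<close> and derivatives along vertical vectors do not change when basic functions are
  subtracted from their arguments, so they can be tested on functions whose differential vanishes on
  \<open>H p\<close>.\<close>

lemma horizontal_critical:
  assumes f: "f \<in> C"
  obtains g where "g \<in> Cinf B" "\<And>v. v \<in> H p \<Longrightarrow> v (\<lambda>q. f q - g (\<pi> q)) = 0"
proof -
  obtain y h where y: "\<And>b. y b \<in> Cinf B"
    and h: "\<And>b. b \<in> onb \<Longrightarrow> h b \<in> VF" and n: "near p (spanned H y h)"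
    by (rule framed_frame[OF H_framed, of p]) (rule that)
  note Y = pullback_smooth[OF y]
  define g where "g z = (\<Sum>b\<in>onb. h b p f * y b z)" for z
  have g: "g \<in> Cinf B" unfolding g_def[abs_def] by (intro base.Cinf_intros y)
  have "v (\<lambda>q. f q - g (\<pi> q)) = 0" if v: "v \<in> H p" for v
  proof -
    have vT: "v \<in> T p" by (rule H_D(3)[OF v])
    have "v = (\<Sum>b\<in>onb. v (basic (y b)) *\<^sub>R h b p)" using eventually_nhds_x_imp_x[OF n] v by blast
    then have "v f = (\<Sum>b\<in>onb. v (basic (y b)) *\<^sub>R h b p) f" by simp
    also have "\<dots> = (\<Sum>b\<in>onb. h b p f * v (basic (y b)))"
      by (simp add: sum_fun_apply scaleR_fun_apply mult.commute)
    also have "\<dots> = v (basic g)"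
      unfolding g_def by (simp add: tangent_sum[OF vT] Cinf_scale Y tangent_scale[OF vT Y])
    finally show ?thesis using tangent_diff[OF vT f pullback_smooth[OF g]] by simp
  qed
  with g show ?thesis by (rule that)
qed

text \<open>The bracket of \<open>Q\<close> vanishes at \<open>p\<close> on functions whose differential kills \<open>H p\<close>. Such functions
  suffice to test the vertical component of the vector, which is therefore zero.\<close>

lemma ham_Q_horizontal:
  assumes F: "F \<in> C" shows "ham_field E Q F p \<in> H p"
proof -
  let ?w = "ham_field E Q F p"
  have w: "?w \<in> T p" by (rule ham_field_tangent[OF Q_field F])
  obtain h where h: "h \<in> H p" "?w - h \<in> V p" using H_D(5)[OF w] by blast
  have "?w = h"
  proof (rule tangent_eqI[OF w H_D(3)[OF h(1)]])
    fix f assume f: "f \<in> C"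
    obtain g where g: "g \<in> Cinf B" and fc: "\<And>v. v \<in> H p \<Longrightarrow> v (\<lambda>q. f q - g (\<pi> q)) = 0"
      by (rule horizontal_critical[OF f, of p]) (rule that)
    let ?f = "\<lambda>q. f q - g (\<pi> q)"
    have f': "?f \<in> C" by (rule Cinf_diff[OF f pullback_smooth[OF g]])
    have "Q p (diff E ?f p) (diff E F p) = 0"
      by (rule bivector_section_annihilates[OF Q]) (simp add: diff_apply H_D(3) fc)
    then have "?w ?f = h ?f"
      using on_diffs_eq_ham_left[OF Q_field f' F, of p] fc[OF h(1)] by (simp add: on_diffs_def)
    then show "?w f = h f"
      using tangent_diff[OF w f pullback_smooth[OF g]] vertical_basic[OF h(2) g]
        tangent_diff[OF H_D(3)[OF h(1)] f pullback_smooth[OF g]] by simp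
  qed
  with h(1) show ?thesis by simp
qed

text \<open>Near \<open>p\<close> the bracket of \<open>Q\<close> is \<open>\<Sum>\<^sub>b h\<^sub>b(f) {y\<^sub>b, g}\<close>, and both factors of each term vanish at
  \<open>p\<close>.\<close>

lemma Q_bracket_critical:
  assumes f: "f \<in> C" and g: "g \<in> C" and W: "w \<in> T p"
    and fc: "\<And>v. v \<in> H p \<Longrightarrow> v f = 0" and gc: "\<And>v. v \<in> H p \<Longrightarrow> v g = 0"
  shows "w (on_diffs E Q f g) = 0"
proof -
  obtain y h where y: "\<And>b. y b \<in> Cinf B"
    and h: "\<And>b. b \<in> onb \<Longrightarrow> h b \<in> VF" and n: "near p (spanned H y h)"
    by (rule framed_frame[OF H_framed, of p]) (rule that)
  let ?b = "on_diffs E Q"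
  have Y: "(basic (y b)) \<in> C" for b by (rule pullback_smooth[OF y])
  have hf: "(\<lambda>q. h b q f) \<in> C" if "b \<in> onb" for b by (rule vector_field_smooth[OF h[OF that] f])
  have bY: "?b (basic (y b)) g \<in> C" for b by (rule on_diffs_smooth[OF Q_field Y g])
  have terms: "(\<lambda>q. h b q f * ?b (basic (y b)) g q) \<in> C" if "b \<in> onb" for b
    by (rule Cinf_mult[OF hf[OF that] bY])
  have "near p (\<lambda>q. ?b f g q = (\<Sum>b\<in>onb. h b q f * ?b (basic (y b)) g q))"
    using n
  proof eventually_elim
    case (elim q)
    have G: "ham_field E Q g q \<in> H q" by (rule ham_Q_horizontal[OF g])
    then have "ham_field E Q g q = (\<Sum>b\<in>onb. ham_field E Q g q (basic (y b)) *\<^sub>R h b q)" using elim by blast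
    then have "ham_field E Q g q f = (\<Sum>b\<in>onb. ham_field E Q g q (basic (y b)) *\<^sub>R h b q) f" by simp
    then show ?case
      by (simp add: sum_fun_apply scaleR_fun_apply on_diffs_eq_ham_left[OF Q_field f g]
          on_diffs_eq_ham_left[OF Q_field Y g] sum_negf mult.commute)
  qed
  then have "w (?b f g) = w (\<lambda>q. \<Sum>b\<in>onb. h b q f * ?b (basic (y b)) g q)"
    using terms by (intro tangent_local[OF W on_diffs_smooth[OF Q_field f g]] Cinf_sum)
  also have "\<dots> = (\<Sum>b\<in>onb. w (\<lambda>q. h b q f * ?b (basic (y b)) g q))"
    by (rule tangent_sum[OF W terms])
  also have "\<dots> = 0"
  proof (rule sum.neutral, rule ballI)
    fix b :: 'n assume b: "b \<in> onb"
    have "h b p f = 0" using fc eventually_nhds_x_imp_x[OF n] b by blast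
    moreover have "?b (basic (y b)) g p = 0"
      using gc[OF ham_Q_horizontal[OF Y]] on_diffs_eq_ham_right[OF Q_field Y g] by simp
    ultimately show "w (\<lambda>q. h b q f * ?b (basic (y b)) g q) = 0"
      using tangent_mult[OF W hf[OF b] bY] by simp
  qed
  finally show ?thesis .
qed

text \<open>Since \<open>W\<close> maps basic functions to basic functions, which are Casimir functions of \<open>P\<close>, the tensor
  \<open>L\<^sub>W P\<close> vanishes when one argument is basic. It is therefore enough to evaluate it at \<open>p\<close> on functions
  \<open>f\<close>, \<open>g\<close> whose differentials vanish on \<open>H p\<close>. For these, \<open>L\<^sub>W \<Lambda>\<close> vanishes because each surviving term
  contains a derivative of \<open>f\<close> or \<open>g\<close> along a vector of \<open>H p\<close>, and \<open>L\<^sub>W Q\<close> vanishes because the bracket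
  of \<open>f\<close> and \<open>g\<close> with respect to \<open>Q\<close> vanishes to second order; the difference is \<open>L\<^sub>W P\<close>.\<close>

lemma projectable_congruent_preserves_P:
  assumes S: "S \<in> Poiss E \<Lambda>" and W: "W \<in> VF" and WS: "\<And>q. W q - S q \<in> H q"
    and basic: "\<And>g. g \<in> Cinf B \<Longrightarrow> \<exists>g'\<in>Cinf B. \<forall>q. W q (basic g) = g' (\<pi> q)"
  shows "preserves E W P"
proof -
  let ?L = "\<lambda>f g p. lie_derivative E W P f g p"
  have critical: "?L f g p = 0" if f: "f \<in> C" and g: "g \<in> C"
    and fc: "\<And>v. v \<in> H p \<Longrightarrow> v f = 0" and gc: "\<And>v. v \<in> H p \<Longrightarrow> v g = 0" for f g p
  proof -
    obtain y :: "'n \<Rightarrow> 'b \<Rightarrow> real" and a where y: "\<And>b. y b \<in> Cinf B" and a: "\<And>b. a b \<in> C"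
      and n: "near p (\<lambda>q. W q - S q = (\<Sum>b\<in>onb. a b q *\<^sub>R ham_field E \<Lambda> (basic (y b)) q))"
      by (rule horizontal_field_expansion[OF vector_field_diff[OF W PoissD(1)[OF S]] WS, of p]) (rule that)
    have Y: "(basic (y b)) \<in> C" for b by (rule pullback_smooth[OF y])
    have "on_diffs E \<Lambda> (basic (y b)) f p = 0" "on_diffs E \<Lambda> (basic (y b)) g p = 0" for b
      using fc[OF ham_basic_horizontal[OF y]] gc[OF ham_basic_horizontal[OF y]]
        on_diffs_eq_ham_right[OF \<Lambda>_field Y f] on_diffs_eq_ham_right[OF \<Lambda>_field Y g] by auto
    then have 1: "lie_derivative E W \<Lambda> f g p = 0"
      using horizontal_lie_derivative[OF S W a y n f g] by simp
    have Wf: "(\<lambda>q. W q f) \<in> C" "(\<lambda>q. W q g) \<in> C" by (intro vector_field_smooth[OF W] f g)+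
    have "W p (on_diffs E Q f g) = 0"
      by (rule Q_bracket_critical[OF f g vector_field_tangent[OF W]]) (rule fc gc; assumption)+
    then have 2: "lie_derivative E W Q f g p = 0"
      unfolding lie_derivative_def
      using fc[OF ham_Q_horizontal[OF Wf(2)]] gc[OF ham_Q_horizontal[OF Wf(1)]]
        on_diffs_eq_ham_left[OF Q_field f Wf(2), of p] on_diffs_eq_ham_right[OF Q_field Wf(1) g, of p] by simp
    have sum: "on_diffs E \<Lambda> f' g' = (\<lambda>q. on_diffs E Q f' g' q + on_diffs E P f' g' q)" for f' g'
      by (simp add: on_diffs_def \<Lambda>_apply fun_eq_iff)
    have "lie_derivative E W \<Lambda> f g p = lie_derivative E W Q f g p + ?L f g p"
      unfolding lie_derivative_def sum
      by (simp add: tangent_add[OF vector_field_tangent[OF W] on_diffs_smooth[OF Q_field f g] on_diffs_smooth[OF P_field f g]])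
    with 1 2 show ?thesis by simp
  qed
  have basic0: "?L (basic g) f p = 0" if g: "g \<in> Cinf B" and f: "f \<in> C" for f g p
  proof -
    obtain g' where g': "g' \<in> Cinf B" "\<forall>q. W q (basic g) = g' (\<pi> q)" using basic[OF g] by blast
    have "on_diffs E P (basic g) f = (\<lambda>_. 0)" by (rule ext) (rule P_basic[OF g])
    then show ?thesis unfolding lie_derivative_def
      using g' P_basic[OF g'(1)] P_basic[OF g] tangent_const[OF vector_field_tangent[OF W]] by simp
  qed
  have reduce: "?L (\<lambda>q. f q - k (\<pi> q)) g p = ?L f g p"
    if f: "f \<in> C" and g: "g \<in> C" and k: "k \<in> Cinf B" for f g k p
  proof -
    obtain \<tau> where \<tau>: "\<tau> \<in> T p" "\<And>f. f \<in> C \<Longrightarrow> ?L f g p = \<tau> f"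
      by (rule lie_derivative_derivation[OF P_field W g, of p]) (rule that)
    have K: "basic k \<in> C" by (rule pullback_smooth[OF k])
    show ?thesis
      using tangent_diff[OF \<tau>(1) f K] basic0[OF k g, of p] by (simp add: \<tau>(2) f K Cinf_diff)
  qed
  have "?L f g p = 0" if f: "f \<in> C" and g: "g \<in> C" for f g p
  proof -
    obtain k where k: "k \<in> Cinf B" and fc: "\<And>v. v \<in> H p \<Longrightarrow> v (\<lambda>q. f q - k (\<pi> q)) = 0"
      by (rule horizontal_critical[OF f, of p]) (rule that)
    obtain l where l: "l \<in> Cinf B" and gc: "\<And>v. v \<in> H p \<Longrightarrow> v (\<lambda>q. g q - l (\<pi> q)) = 0"
      by (rule horizontal_critical[OF g, of p]) (rule that)
    let ?f = "\<lambda>q. f q - k (\<pi> q)" and ?g = "\<lambda>q. g q - l (\<pi> q)"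
    have f': "?f \<in> C" and g': "?g \<in> C" by (intro Cinf_intros f g pullback_smooth k l)+
    have "?L f g p = ?L ?f g p" using reduce[OF f g k] by simp
    also have "\<dots> = - ?L g ?f p" by (rule lie_derivative_skew[OF P_field W f' g])
    also have "\<dots> = - ?L ?g ?f p" using reduce[OF g f' l] by simp
    also have "?L ?g ?f p = 0" by (rule critical[OF g' f']) (rule gc fc; assumption)+
    finally show ?thesis by simp
  qed
  then show ?thesis by (auto simp: preserves_def fun_eq_iff)
qed

end

section \<open>Zero quotient spaces\<close>

lemma trivial_quotient_spaceD:
  assumes "quotient_space S R = {R}" "0 \<in> R" "x \<in> S"
  shows "x \<in> R"
proof -
  let ?r = "{(x, y). x \<in> S \<and> y \<in> S \<and> x - y \<in> R}"
  have "?r `` {x} \<in> S // ?r" using assms(3) by (rule quotientI)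
  then have "?r `` {x} = R" using assms(1) by (simp add: quotient_space_def)
  moreover have "x \<in> ?r `` {x}" using assms(2,3) by simp
  ultimately show ?thesis by simp
qed

lemma quotient_space_self:
  assumes "R \<noteq> {}" "\<And>x y. x \<in> R \<Longrightarrow> y \<in> R \<Longrightarrow> x - y \<in> R"
  shows "quotient_space R R = {R}"
proof -
  have "{(x, y). x \<in> R \<and> y \<in> R \<and> x - y \<in> R} `` {x} = R" if "x \<in> R" for x using assms(2) that by auto
  then show ?thesis using assms(1) unfolding quotient_space_def quotient_def by auto
qed

section \<open>Horizontal Poisson vector fields\<close>

context coupling
begin

text \<open>This is the image of \<open>\<Lambda>\<^sup>\<sharp>\<close>, since every covector is the differential of a function.\<close>

definition characteristic :: "'e \<Rightarrow> 'e tvec set" where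
  "characteristic p = {ham_field E \<Lambda> G p |G. G \<in> C}"

lemma subspace_char: "subspace (characteristic p)"
proof (rule subspaceI)
  show "0 \<in> characteristic p"
    unfolding characteristic_def using ham_field_linear[OF \<Lambda>_field Cinf_const Cinf_const, of 0 0 0 0 p] Cinf_const[of 0] by force
  show "v + w \<in> characteristic p" if vw: "v \<in> characteristic p" "w \<in> characteristic p" for v w
  proof -
    obtain f g where fg: "f \<in> C" "g \<in> C" "v = ham_field E \<Lambda> f p" "w = ham_field E \<Lambda> g p"
      using vw unfolding characteristic_def by auto
    then have "v + w = ham_field E \<Lambda> (\<lambda>q. 1 * f q + 1 * g q) p"
      using ham_field_linear[OF \<Lambda>_field fg(1,2), of 1 1 p] by simp
    moreover have "(\<lambda>q. 1 * f q + 1 * g q) \<in> C" by (intro Cinf_intros fg)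
    ultimately show ?thesis unfolding characteristic_def by blast
  qed
  show "c *\<^sub>R v \<in> characteristic p" if v: "v \<in> characteristic p" for c v
  proof -
    obtain f where f: "f \<in> C" "v = ham_field E \<Lambda> f p" using v unfolding characteristic_def by auto
    then have "c *\<^sub>R v = ham_field E \<Lambda> (\<lambda>q. c * f q + 0 * f q) p"
      using ham_field_linear[OF \<Lambda>_field f(1) f(1), of c 0 p] by simp
    moreover have "(\<lambda>q. c * f q + 0 * f q) \<in> C" by (intro Cinf_intros f)
    ultimately show ?thesis unfolding characteristic_def by blast
  qed
qed

lemma H_subset_char: "H p \<subseteq> characteristic p"
proof
  fix v assume "v \<in> H p"
  then obtain \<alpha> where \<alpha>: "\<alpha> \<in> cotangent E p" "v = sharp E \<Lambda> p \<alpha>"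
    unfolding coupling_horizontal_def annihilator_def by auto
  obtain f where "f \<in> C" "\<alpha> = diff E f p" by (rule cotangent_is_diff[OF \<alpha>(1)]) (rule that)
  then show "v \<in> characteristic p" unfolding characteristic_def ham_field_def using \<alpha>(2) by blast
qed

lemma ham_P_char: "F \<in> C \<Longrightarrow> ham_field E P F p \<in> characteristic p"
proof -
  assume F: "F \<in> C"
  have "ham_field E P F p = ham_field E \<Lambda> F p - ham_field E Q F p" using ham_decomposition[OF F] by simp
  also have "\<dots> \<in> characteristic p"
    by (rule subspace_diff[OF subspace_char _ subsetD[OF H_subset_char ham_Q_horizontal[OF F]]])
      (use F in \<open>auto simp: characteristic_def\<close>)
  finally show ?thesis .
qed

text \<open>In coordinates \<open>y\<^sub>b\<close> of the base, \<open>\<beta> = \<Sum>\<^sub>b a\<^sub>b dy\<^sub>b\<close> at \<open>q\<close>, and \<open>two_form a y v w\<close> is the value of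
  \<open>\<Sum>\<^sub>b da\<^sub>b \<and> dy\<^sub>b\<close> on \<open>v\<close> and \<open>w\<close>.\<close>

abbreviation "represents \<beta> a (y :: 'n \<Rightarrow> 'b \<Rightarrow> real) q \<equiv> \<forall>v\<in>T q. \<beta> q v = (\<Sum>b\<in>onb. a b q * v (basic (y b)))"
abbreviation "two_form a y v w \<equiv> \<Sum>b\<in>onb. v (a b) * w (basic (y b)) - w (a b) * v (basic (y b))"

text \<open>On \<open>V\<^sup>0\<close> the map \<open>\<Lambda>\<^sup>\<sharp>\<close> is injective: by skew-symmetry \<open>\<alpha>(\<Lambda>\<^sup>\<sharp>\<gamma>) = - \<gamma>(\<Lambda>\<^sup>\<sharp>\<alpha>)\<close>, so \<open>\<Lambda>\<^sup>\<sharp>\<alpha>\<close>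
  determines the values of \<open>\<alpha>\<close> on \<open>H\<close>, and on \<open>V\<close> these are zero.\<close>

lemma horizontal_covector_unique:
  assumes \<alpha>: "\<alpha> \<in> annihilator E V p" and \<beta>: "\<beta> \<in> annihilator E V p"
    and eq: "sharp E \<Lambda> p \<alpha> = sharp E \<Lambda> p \<beta>"
  shows "\<alpha> = \<beta>"
proof (rule cotangent_eqI)
  show c: "\<alpha> \<in> cotangent E p" "\<beta> \<in> cotangent E p" using \<alpha> \<beta> by (auto simp: annihilator_def)
  note \<Lambda>p = bivector_fieldD[OF \<Lambda>_field, of p]
  fix v assume v: "v \<in> T p"
  obtain h where h: "h \<in> H p" "v - h \<in> V p" using H_D(5)[OF v] by blast
  have hT: "h \<in> T p" by (rule H_D(3)[OF h(1)])
  obtain \<gamma> where \<gamma>: "\<gamma> \<in> cotangent E p" "h = sharp E \<Lambda> p \<gamma>"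
    using h(1) unfolding coupling_horizontal_def annihilator_def by auto
  have on_h: "\<delta> v = - \<gamma> (sharp E \<Lambda> p \<delta>)" if \<delta>: "\<delta> \<in> annihilator E V p" for \<delta>
  proof -
    have \<delta>c: "\<delta> \<in> cotangent E p" and "\<delta> (v - h) = 0" using \<delta> h(2) by (auto simp: annihilator_def)
    then have "\<delta> v = \<delta> h"
      using functionals_on_diff[OF _ subspace_tangent v hT, of \<delta>] by (simp add: cotangent_def)
    also have "\<dots> = \<Lambda> p \<gamma> \<delta>" unfolding \<gamma>(2) by (rule sharp_pairing[of \<Lambda>, OF \<Lambda>p \<gamma>(1) \<delta>c])
    also have "\<dots> = - \<Lambda> p \<delta> \<gamma>" by (rule bivector_skew[of \<Lambda>, OF \<Lambda>p \<gamma>(1) \<delta>c])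
    also have "\<dots> = - \<gamma> (sharp E \<Lambda> p \<delta>)" using sharp_pairing[of \<Lambda>, OF \<Lambda>p \<delta>c \<gamma>(1)] by simp
    finally show ?thesis .
  qed
  show "\<alpha> v = \<beta> v" using on_h[OF \<alpha>] on_h[OF \<beta>] eq by simp
qed

text \<open>Along a horizontal Poisson field \<open>X = \<Lambda>\<^sup>\<sharp>\<beta>\<close> with \<open>\<beta> = \<Sum>\<^sub>b a\<^sub>b dy\<^sub>b\<close>, the two-form
  \<open>d\<beta> = \<Sum>\<^sub>b da\<^sub>b \<and> dy\<^sub>b\<close> vanishes on pairs of characteristic vectors, which is what \<open>L\<^sub>X\<Lambda> = 0\<close> says.\<close>

lemma horizontal_poisson_form:
  assumes X: "X \<in> Poiss E \<Lambda>" and XH: "\<And>q. X q \<in> H q"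
    and \<beta>: "\<And>q. \<beta> q \<in> annihilator E V q" "\<And>q. X q = sharp E \<Lambda> q (\<beta> q)"
  obtains y :: "'n \<Rightarrow> 'b \<Rightarrow> real" and a where "\<And>b. y b \<in> Cinf B" "\<And>b. a b \<in> C"
    "near p (represents \<beta> a y)"
    "\<And>v w. v \<in> characteristic p \<Longrightarrow> w \<in> characteristic p \<Longrightarrow>
       two_form a y v w = 0"
proof -
  have Xv: "X \<in> VF" by (rule PoissD(1)[OF X])
  obtain y :: "'n \<Rightarrow> 'b \<Rightarrow> real" and a where y: "\<And>b. y b \<in> Cinf B" and a: "\<And>b. a b \<in> C"
    and n: "near p (\<lambda>q. X q = (\<Sum>b\<in>onb. a b q *\<^sub>R ham_field E \<Lambda> (basic (y b)) q))"
    by (rule horizontal_field_expansion[OF Xv XH, of p]) (rule that)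
  let ?Y = "\<lambda>b q. y b (\<pi> q)"
  have Y: "?Y b \<in> C" for b by (rule pullback_smooth[OF y])
  have local_form: "near p (\<lambda>q. \<forall>v\<in>T q. \<beta> q v = (\<Sum>b\<in>onb. a b q * v (?Y b)))"
    using n
  proof eventually_elim
    case (elim q)
    let ?f = "\<lambda>q'. \<Sum>b\<in>onb. a b q * ?Y b q'"
    have f: "?f \<in> C" by (intro Cinf_intros Y)
    have val: "diff E ?f q v = (\<Sum>b\<in>onb. a b q * v (?Y b))" if v: "v \<in> T q" for v
      using v by (simp add: diff_apply tangent_sum[OF v] Cinf_scale Y tangent_scale[OF v Y])
    have "diff E ?f q \<in> annihilator E V q"
      unfolding annihilator_def
      by (auto simp: diff_cotangent f val vertical_tangent vertical_basic y)
    moreover have "ham_field E \<Lambda> ?f q = (\<Sum>b\<in>onb. a b q *\<^sub>R ham_field E \<Lambda> (?Y b) q)"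
      by (rule ham_field_sum[OF \<Lambda>_field Y])
    then have "sharp E \<Lambda> q (\<beta> q) = sharp E \<Lambda> q (diff E ?f q)"
      using elim \<beta>(2)[of q] by (simp add: ham_field_def)
    ultimately have "\<beta> q = diff E ?f q" by (rule horizontal_covector_unique[OF \<beta>(1)])
    then show ?case by (simp add: val)
  qed
  have closed: "(\<Sum>b\<in>onb. v (a b) * w (?Y b) - w (a b) * v (?Y b)) = 0"
    if vw: "v \<in> characteristic p" "w \<in> characteristic p" for v w
  proof -
    obtain f g where fg: "f \<in> C" "g \<in> C" "v = ham_field E \<Lambda> f p" "w = ham_field E \<Lambda> g p"
      using vw unfolding characteristic_def by auto
    \<comment> \<open>the zero field, which is a Poisson field as a difference of two\<close>
    let ?S = "\<lambda>q. X q - X q"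
    have S: "?S \<in> Poiss E \<Lambda>" by (rule Poiss_diff[OF \<Lambda>_field X X])
    have "near p (\<lambda>q. X q - ?S q = (\<Sum>b\<in>onb. a b q *\<^sub>R ham_field E \<Lambda> (?Y b) q))" using n by simp
    from horizontal_lie_derivative[OF S Xv a y this fg(1,2)]
    have 0: "(\<Sum>b\<in>onb. on_diffs E \<Lambda> (a b) g p * on_diffs E \<Lambda> (?Y b) f p
        + on_diffs E \<Lambda> f (a b) p * on_diffs E \<Lambda> (?Y b) g p) = 0"
      using preservesD[OF PoissD(2)[OF X] fg(1,2), of p] by simp
    have "v (a b) * w (?Y b) - w (a b) * v (?Y b) = - (on_diffs E \<Lambda> (a b) g p * on_diffs E \<Lambda> (?Y b) f p
        + on_diffs E \<Lambda> f (a b) p * on_diffs E \<Lambda> (?Y b) g p)" for b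
      unfolding on_diffs_eq_ham_left[OF \<Lambda>_field a fg(2)] on_diffs_eq_ham_left[OF \<Lambda>_field Y fg(1)]
        on_diffs_eq_ham_right[OF \<Lambda>_field fg(1) a] on_diffs_eq_ham_left[OF \<Lambda>_field Y fg(2)] fg(3,4)
      by simp
    then show ?thesis using 0 by (simp only: sum_negf)
  qed
  show ?thesis by (rule that[of y a, OF y a local_form closed])
qed

end

section \<open>Coupling tensors with a flat Poisson connection\<close>

locale flat_coupling = coupling E B \<pi> \<Lambda> P Q
  for E :: "('e::{t2_space,second_countable_topology}, 'm::model_space) chart set"
    and B :: "('b::{t2_space,second_countable_topology}, 'n::model_space) chart set" and \<pi> \<Lambda> P Q +
  fixes TF :: "'e \<Rightarrow> 'e tvec set"
  assumes Poiss_V: "Poiss_V E B \<pi> P = Ham E P"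
    and foliation: "foliation E TF"
    and TF_direct_sum: "\<And>p. direct_sum (tangent E p) (TF p) (vertical E B \<pi> p)"
    and flat_poisson: "\<And>Z. Z \<in> projectable_sections E B \<pi> TF \<Longrightarrow> preserves E Z P"
    and fol_H1: "fol_H1 E TF = {fol_B1 E TF}"
    and Ham_fol: "Ham_fol E B \<pi> TF P = {ham_field E P H |H. H \<in> Cinf_fol E TF}"
begin

lemmas TF_D = direct_sumD[OF TF_direct_sum]
lemmas TF_framed = foliation_framed[OF foliation TF_direct_sum]

lemma projectable_sectionD:
  assumes "Z \<in> projectable_sections E B \<pi> TF"
  shows "Z \<in> VF" "Z p \<in> TF p" "g \<in> Cinf B \<Longrightarrow> \<exists>g'\<in>Cinf B. \<forall>q. Z q (basic g) = g' (\<pi> q)"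
proof -
  show "Z \<in> VF" "Z p \<in> TF p" using assms by (auto simp: projectable_sections_def sections_def)
  obtain u where u: "u \<in> vector_fields B" "\<And>p. dmap B \<pi> (Z p) = u (\<pi> p)"
    using assms by (auto simp: projectable_sections_def)
  show "\<exists>g'\<in>Cinf B. \<forall>q. Z q (basic g) = g' (\<pi> q)" if g: "g \<in> Cinf B"
    by (rule bexI[of _ "\<lambda>b. u b g"])
      (use u(2) dmap_apply[OF g] base.vector_field_smooth[OF u(1) g] in \<open>auto simp: fun_eq_iff, metis\<close>)
qed

text \<open>The horizontal part of \<open>Z\<close> is projectable and congruent to the zero field modulo \<open>H\<close>, so it
  preserves \<open>P\<close>. The same holds for \<open>Z\<close>, and their difference is a vertical Poisson field of \<open>P\<close>.\<close>

lemma projectable_section_decomposition: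
  assumes Z: "Z \<in> projectable_sections E B \<pi> TF"
  obtains F where "F \<in> C" "\<And>p. Z p - ham_field E P F p \<in> H p"
proof -
  note ZD = projectable_sectionD[OF Z]
  obtain h where h: "h \<in> VF" "\<And>p. h p \<in> H p" "\<And>p. Z p - h p \<in> V p"
    by (rule projection_field[OF H_framed ZD(1)]) (rule that)
  have hg: "h p (basic g) = Z p (basic g)" if "g \<in> Cinf B" for g p
    using vertical_basic[OF h(3) that, of p] by simp
  \<comment> \<open>the zero field, written as a difference of two Hamiltonian fields\<close>
  have 0: "(\<lambda>q. X q - X q) \<in> Poiss E \<Lambda>" if "X = ham_field E \<Lambda> (\<lambda>_. 0)" for X
    using Ham_subset_Poiss[OF poisson] Cinf_const[of 0] that
    by (intro Poiss_diff[OF \<Lambda>_field]) (auto simp: Ham_def)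
  have "preserves E h P"
    by (rule projectable_congruent_preserves_P[OF 0[OF refl] h(1)]) (use h(2) ZD(3) hg in auto)
  then have "(\<lambda>q. Z q - h q) \<in> Poiss E P"
    using ZD(1) h(1) flat_poisson[OF Z] by (intro Poiss_diff[OF P_field]) (auto simp: Poiss_def)
  then have "(\<lambda>q. Z q - h q) \<in> Poiss_V E B \<pi> P"
    using h(3) by (auto simp: Poiss_V_def Poiss_def sections_def)
  then obtain F where F: "F \<in> C" "(\<lambda>q. Z q - h q) = ham_field E P F"
    unfolding Poiss_V Ham_def by auto
  have "Z p - ham_field E P F p = h p" for p
    unfolding F(2)[symmetric] by simp
  then show ?thesis using that[OF F(1)] h(2) by simp
qed

lemma TF_decomposition:
  assumes "w \<in> TF p"
  obtains F where "F \<in> C" "w - ham_field E P F p \<in> H p"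
proof -
  obtain Z where Z: "Z \<in> projectable_sections E B \<pi> TF" "Z p = w"
    by (rule projectable_section_through[OF TF_framed assms]) (rule that)
  obtain F where "F \<in> C" "\<And>p. Z p - ham_field E P F p \<in> H p"
    by (rule projectable_section_decomposition[OF Z(1)]) (rule that)
  then show ?thesis using that Z(2) by metis
qed

text \<open>Decompose \<open>h\<close> along \<open>TF\<close> and \<open>V\<close>, and then its component in \<open>TF\<close> along \<open>H\<close> and \<open>V\<close>: comparing the
  two shows that the vertical component of \<open>h\<close> is the value of a Hamiltonian field of \<open>P\<close>.\<close>

lemma H_decomposition:
  assumes h: "h \<in> H p"
  obtains w F where "w \<in> TF p" "F \<in> C" "h = w - ham_field E P F p"
proof -
  obtain w where w: "w \<in> TF p" "h - w \<in> V p" using TF_D(5)[OF H_D(3)[OF h]] by blast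
  obtain F where F: "F \<in> C" "w - ham_field E P F p \<in> H p" by (rule TF_decomposition[OF w(1)]) (rule that)
  have "h - (w - ham_field E P F p) \<in> H p" by (rule subspace_diff[OF H_D(1) h F(2)])
  moreover have "h - (w - ham_field E P F p) = (h - w) + ham_field E P F p" by simp
  moreover have "\<dots> \<in> V p" by (rule subspace_add[OF H_D(2) w(2) ham_P_vertical[OF F(1)]])
  ultimately have "h - (w - ham_field E P F p) = 0" using H_D(4) by metis
  then have "h = w - ham_field E P F p" by simp
  then show ?thesis by (rule that[OF w(1) F(1)])
qed

lemma TF_subset_char: "TF p \<subseteq> characteristic p"
proof
  fix w assume "w \<in> TF p"
  then obtain F where F: "F \<in> C" "w - ham_field E P F p \<in> H p" by (rule TF_decomposition)
  have "(w - ham_field E P F p) + ham_field E P F p \<in> characteristic p"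
    by (rule subspace_add[OF subspace_char subsetD[OF H_subset_char F(2)] ham_P_char[OF F(1)]])
  then show "w \<in> characteristic p" by simp
qed

text \<open>The field is \<open>\<Lambda>\<^sup>\<sharp>\<beta>\<close> for a one-form \<open>\<beta>\<close> annihilating \<open>V\<close>. A leafwise primitive \<open>K\<close> of \<open>\<beta>\<close>, corrected
  by a leafwise constant function such that its Hamiltonian field with respect to \<open>P\<close> vanishes, is a
  Hamiltonian of the field with respect to \<open>\<Lambda>\<close>.\<close>

lemma horizontal_poisson_hamiltonian:
  assumes X: "X \<in> Poiss E \<Lambda>" and XH: "\<And>q. X q \<in> H q"
  obtains F where "F \<in> C" "X = ham_field E \<Lambda> F"
proof -
  have Xv: "X \<in> VF" by (rule PoissD(1)[OF X])
  have "\<forall>q. \<exists>\<beta>. \<beta> \<in> annihilator E V q \<and> X q = sharp E \<Lambda> q \<beta>"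
    using XH unfolding coupling_horizontal_def by blast
  then obtain \<beta> where \<beta>: "\<And>q. \<beta> q \<in> annihilator E V q" "\<And>q. X q = sharp E \<Lambda> q (\<beta> q)" by metis
  have \<beta>c: "\<beta> q \<in> cotangent E q" and \<beta>V: "v \<in> V q \<Longrightarrow> \<beta> q v = 0" for q v
    using \<beta>(1)[of q] by (auto simp: annihilator_def)
  note form = horizontal_poisson_form[OF X XH \<beta>]
  \<comment> \<open>the restriction of \<open>\<beta>\<close> to the leaves, a cocycle because \<open>TF\<close> lies in the characteristic distribution\<close>
  define \<mu> where "\<mu> q v = (if v \<in> TF q then \<beta> q v else 0)" for q v
  have \<mu>_forms: "\<mu> \<in> fol_one_forms E TF"
    unfolding fol_one_forms_def
  proof safe
    fix p
    have "TF p \<subseteq> T p" using TF_D(3) by blast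
    then show "\<mu> p \<in> functionals_on (TF p)"
      using \<beta>c[of p] subspace_add[OF TF_D(1)[of p]] subspace_scale[OF TF_D(1)[of p]]
      by (auto simp: functionals_on_def \<mu>_def cotangent_def subset_eq)
  next
    fix Z assume "Z \<in> sections E TF"
    then have Z: "Z \<in> VF" "\<And>q. Z q \<in> TF q" by (auto simp: sections_def)
    show "(\<lambda>p. \<mu> p (Z p)) \<in> C"
    proof (rule Cinf_localI)
      fix p
      obtain y a where y: "\<And>b. y b \<in> Cinf B" and a: "\<And>b. a b \<in> C"
        and n: "near p (represents \<beta> a y)"
        by (rule form[of p]) (rule that)
      show "\<exists>g\<in>C. near p (\<lambda>q. \<mu> q (Z q) = g q)"
      proof (rule bexI)
        show "near p (\<lambda>q. \<mu> q (Z q) = (\<Sum>b\<in>onb. a b q * Z q (basic (y b))))"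
          using n by eventually_elim (use Z vector_field_tangent[OF Z(1)] in \<open>simp add: \<mu>_def\<close>)
        show "(\<lambda>q. \<Sum>b\<in>onb. a b q * Z q (basic (y b))) \<in> C"
          by (rule Cinf_sum, rule Cinf_mult[OF a vector_field_smooth[OF Z(1) pullback_smooth[OF y]]])
      qed
    qed
  qed
  have derivative: "v (\<lambda>q. \<mu> q (Z q)) = (\<Sum>b\<in>onb. a b p * v (\<lambda>q. Z q (basic (y b))) + Z p (basic (y b)) * v (a b))"
    if Z: "Z \<in> VF" "\<And>q. Z q \<in> TF q" and v: "v \<in> T p"
      and y: "\<And>b. y b \<in> Cinf B" and a: "\<And>b. a b \<in> C"
      and n: "near p (represents \<beta> a y)"
    for Z v p a and y :: "'n \<Rightarrow> 'b \<Rightarrow> real"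
  proof -
    have ZY: "(\<lambda>q. Z q (basic (y b))) \<in> C" for b
      by (rule vector_field_smooth[OF Z(1) pullback_smooth[OF y]])
    have m: "(\<lambda>q. \<mu> q (Z q)) \<in> C" using \<mu>_forms Z by (auto simp: fol_one_forms_def sections_def)
    have s: "(\<lambda>q. \<Sum>b\<in>onb. a b q * Z q (basic (y b))) \<in> C" by (intro Cinf_sum Cinf_mult a ZY)
    have "near p (\<lambda>q. \<mu> q (Z q) = (\<Sum>b\<in>onb. a b q * Z q (basic (y b))))"
      using n by eventually_elim (use Z vector_field_tangent[OF Z(1)] in \<open>simp add: \<mu>_def\<close>)
    then have "v (\<lambda>q. \<mu> q (Z q)) = v (\<lambda>q. \<Sum>b\<in>onb. a b q * Z q (basic (y b)))"
      by (rule tangent_local[OF v m s])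
    also have "\<dots> = (\<Sum>b\<in>onb. v (\<lambda>q. a b q * Z q (basic (y b))))"
      by (rule tangent_sum[OF v Cinf_mult[OF a ZY]])
    also have "\<dots> = (\<Sum>b\<in>onb. a b p * v (\<lambda>q. Z q (basic (y b))) + Z p (basic (y b)) * v (a b))"
      by (simp add: tangent_mult[OF v a ZY])
    finally show ?thesis .
  qed
  have "\<mu> \<in> fol_Z1 E TF"
    unfolding fol_Z1_def
  proof (intro CollectI conjI \<mu>_forms ballI)
    fix X1 X2 assume X12: "X1 \<in> sections E TF" "X2 \<in> sections E TF"
    then have X1: "X1 \<in> VF" "\<And>q. X1 q \<in> TF q" and X2: "X2 \<in> VF" "\<And>q. X2 q \<in> TF q"
      by (auto simp: sections_def)
    show "fol_d1 \<mu> X1 X2 = 0"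
    proof
      fix p
      obtain y a where y: "\<And>b. y b \<in> Cinf B" and a: "\<And>b. a b \<in> C"
        and n: "near p (represents \<beta> a y)"
        and closed: "\<And>v w. v \<in> characteristic p \<Longrightarrow> w \<in> characteristic p \<Longrightarrow>
          two_form a y v w = 0"
        by (rule form[of p]) (rule that)
      have "\<mu> p (lie_bracket X1 X2 p) = (\<Sum>b\<in>onb. a b p * lie_bracket X1 X2 p (basic (y b)))"
        using foliation_involutive[OF foliation X12, of p] eventually_nhds_x_imp_x[OF n]
          lie_bracket_tangent[OF X1(1) X2(1), of p] by (simp add: \<mu>_def)
      then have "fol_d1 \<mu> X1 X2 p =
        (\<Sum>b\<in>onb. a b p * X1 p (\<lambda>q. X2 q (basic (y b))) + X2 p (basic (y b)) * X1 p (a b)) -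
        (\<Sum>b\<in>onb. a b p * X2 p (\<lambda>q. X1 q (basic (y b))) + X1 p (basic (y b)) * X2 p (a b)) -
        (\<Sum>b\<in>onb. a b p * lie_bracket X1 X2 p (basic (y b)))"
        unfolding fol_d1_def
        using derivative[OF X2 vector_field_tangent[OF X1(1)] y a n] derivative[OF X1 vector_field_tangent[OF X2(1)] y a n]
        by simp
      also have "\<dots> = (\<Sum>b\<in>onb. X1 p (a b) * X2 p (basic (y b)) - X2 p (a b) * X1 p (basic (y b)))"
        unfolding sum_subtractf[symmetric] lie_bracket_def by (rule sum.cong) (auto simp: algebra_simps)
      also have "\<dots> = 0" using closed X1(2) X2(2) TF_subset_char by blast
      finally show "fol_d1 \<mu> X1 X2 p = 0 p" by simp
    qed
  qed
  moreover have "0 \<in> fol_B1 E TF"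
  proof -
    have "fol_d0 TF (\<lambda>_. 0) = 0"
      using tangent_const[OF TF_D(3)] by (auto simp: fol_d0_def fun_eq_iff)
    then show ?thesis unfolding fol_B1_def using Cinf_const[of 0] by force
  qed
  ultimately have "\<mu> \<in> fol_B1 E TF"
    using trivial_quotient_spaceD[OF fol_H1[unfolded fol_H1_def]] by blast
  then obtain K where K: "K \<in> C" "\<mu> = fol_d0 TF K" by (auto simp: fol_B1_def)
  have vK: "v K = \<beta> q v" if "v \<in> TF q" for v q
    using fun_cong[OF fun_cong[OF K(2), of q], of v] that by (simp add: \<mu>_def fol_d0_def)
  \<comment> \<open>\<open>d\<beta>\<close> vanishes on the pair of \<open>P\<^sup>\<sharp>df\<close> and \<open>Z\<close>; in local coordinates the other terms drop out since \<open>P\<^sup>\<sharp>df\<close> is vertical and \<open>Z\<close> is projectable\<close>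
  have casimir: "on_diffs E P f (\<lambda>q. Z q K) p = 0"
    if Z: "Z \<in> projectable_sections E B \<pi> TF" and f: "f \<in> C" for Z f p
  proof -
    note ZD = projectable_sectionD[OF Z]
    obtain y a where y: "\<And>b. y b \<in> Cinf B" and a: "\<And>b. a b \<in> C"
      and n: "near p (represents \<beta> a y)"
      and closed: "\<And>v w. v \<in> characteristic p \<Longrightarrow> w \<in> characteristic p \<Longrightarrow>
          two_form a y v w = 0"
      by (rule form[of p]) (rule that)
    let ?v = "ham_field E P f p"
    have vV: "?v \<in> V p" by (rule ham_P_vertical[OF f])
    have "?v (\<lambda>q. Z q (basic (y b))) = 0" for b
    proof -
      obtain g where "g \<in> Cinf B" "\<forall>q. Z q (basic (y b)) = g (\<pi> q)" using ZD(3)[OF y] by blast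
      then show ?thesis using vertical_basic[OF vV] by simp
    qed
    moreover have "(\<lambda>q. Z q K) = (\<lambda>q. \<mu> q (Z q))" using vK ZD(2) by (simp add: \<mu>_def)
    ultimately have "?v (\<lambda>q. Z q K) = (\<Sum>b\<in>onb. Z p (basic (y b)) * ?v (a b))"
      using derivative[OF ZD(1,2) vertical_tangent[OF vV] y a n] by simp
    also have "\<dots> = (\<Sum>b\<in>onb. ?v (a b) * Z p (basic (y b)) - Z p (a b) * ?v (basic (y b)))"
      using vertical_basic[OF vV y] by (simp add: mult.commute)
    also have "\<dots> = 0" using closed ham_P_char[OF f] ZD(2) TF_subset_char by blast
    finally show ?thesis using on_diffs_eq_ham_right[OF P_field f vector_field_smooth[OF ZD(1) K(1)]] by simp
  qed
  have "ham_field E P K \<in> Ham_fol E B \<pi> TF P"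
    unfolding Ham_fol_def
  proof (intro CollectI conjI ballI)
    show "ham_field E P K \<in> Ham E P" using K(1) by (auto simp: Ham_def)
    fix Z assume Z: "Z \<in> projectable_sections E B \<pi> TF"
    note Zv = projectable_sectionD(1)[OF Z]
    have Kv: "ham_field E P K \<in> VF" by (rule ham_field_vector_field[OF P_field K(1)])
    have ZK: "(\<lambda>q. Z q K) \<in> C" by (rule vector_field_smooth[OF Zv K(1)])
    have "lie_bracket (ham_field E P K) Z p f = 0" if f: "f \<in> C" for p f
    proof -
      have "(\<lambda>q. ham_field E P K q f) = on_diffs E P K f"
        by (rule ext) (simp add: ham_field_apply P_field K(1) f)
      then have "lie_derivative E Z P K f p = - lie_bracket (ham_field E P K) Z p f + ham_field E P f p (\<lambda>q. Z q K)"
        unfolding lie_derivative_eq[OF P_field Zv K(1) f] lie_bracket_def by simp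
      moreover have "ham_field E P f p (\<lambda>q. Z q K) = 0"
        using casimir[OF Z f, of p] on_diffs_eq_ham_right[OF P_field f ZK] by simp
      ultimately show ?thesis using preservesD[OF flat_poisson[OF Z] K(1) f, of p] by simp
    qed
    then show "lie_bracket (ham_field E P K) Z = 0"
      using tangent_eq_0[OF lie_bracket_tangent[OF Kv Zv]] by (intro ext) (metis zero_fun_apply)
  qed
  then obtain L where L: "L \<in> Cinf_fol E TF" "ham_field E P K = ham_field E P L"
    unfolding Ham_fol by auto
  have LC: "L \<in> C" and L0: "fol_d0 TF L = 0" using L(1) by (auto simp: Cinf_fol_def)
  have vL: "v L = 0" if "v \<in> TF q" for v q
    using fun_cong[OF fun_cong[OF L0, of q], of v] that by (simp add: fol_d0_def)
  define F where "F q = K q - L q" for q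
  have F: "F \<in> C" unfolding F_def by (intro Cinf_intros K(1) LC)
  have vF: "v F = \<beta> q v" if "v \<in> TF q" for v q
    unfolding F_def using tangent_diff[OF TF_D(3)[OF that] K(1) LC] vK[OF that] vL[OF that] by simp
  have PF: "on_diffs E P F f p = 0" if f: "f \<in> C" for f p
    unfolding F_def
    using on_diffs_eq_ham_left[OF P_field _ f, of _ p] F[unfolded F_def]
      tangent_diff[OF ham_field_tangent[OF P_field f] K(1) LC, of p]
      on_diffs_eq_ham_right[OF P_field K(1) f, of p] on_diffs_eq_ham_right[OF P_field LC f, of p]
      K(1) LC L(2) by simp
  \<comment> \<open>\<open>dF\<close> and \<open>\<beta>\<close> agree on \<open>TF\<close> and vanish on Hamiltonian vectors of \<open>P\<close>\<close>
  have agree: "k F = \<beta> p k" if k: "k \<in> H p" for k p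
  proof -
    obtain w G where w: "w \<in> TF p" and G: "G \<in> C" and kw: "k = w - ham_field E P G p"
      by (rule H_decomposition[OF k]) (rule that)
    have "\<beta> p k = \<beta> p w"
      unfolding kw using functionals_on_diff[OF \<beta>c[unfolded cotangent_def] subspace_tangent TF_D(3)[OF w] ham_field_tangent[OF P_field G]]
        \<beta>V[OF ham_P_vertical[OF G]] by simp
    moreover have "ham_field E P G p F = 0"
      using PF[OF G, of p] on_diffs_eq_ham_left[OF P_field F G, of p] by simp
    ultimately show ?thesis using vF[OF w] kw by simp
  qed
  have "X p = ham_field E \<Lambda> F p" for p
  proof (rule tangent_eqI[OF vector_field_tangent[OF Xv] ham_field_tangent[OF \<Lambda>_field F]])
    fix f assume f: "f \<in> C"
    have kH: "ham_field E Q f p \<in> H p" by (rule ham_Q_horizontal[OF f])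
    have "X p f = Q p (\<beta> p) (diff E f p) + P p (\<beta> p) (diff E f p)"
      unfolding \<beta>(2) by (simp add: sharp_apply[of \<Lambda>, OF bivector_fieldD[OF \<Lambda>_field] \<beta>c f] \<Lambda>_apply)
    also have "P p (\<beta> p) (diff E f p) = 0"
      by (rule bivector_section_annihilates[OF P \<beta>V])
    also have "Q p (\<beta> p) (diff E f p) = - Q p (diff E f p) (\<beta> p)"
      by (rule bivector_skew[of Q, OF bivector_fieldD[OF Q_field] \<beta>c diff_cotangent[OF f]])
    also have "Q p (diff E f p) (\<beta> p) = \<beta> p (ham_field E Q f p)"
      unfolding ham_field_def
      by (rule sharp_pairing[of Q, OF bivector_fieldD[OF Q_field] diff_cotangent[OF f] \<beta>c, symmetric])
    also have "\<dots> = ham_field E Q f p F" using agree[OF kH] by simp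
    also have "- ham_field E Q f p F + 0 = on_diffs E Q F f p + on_diffs E P F f p"
      using on_diffs_eq_ham_left[OF Q_field F f, of p] PF[OF f, of p] by simp
    also have "\<dots> = ham_field E \<Lambda> F p f"
      using on_diffs_eq_ham_right[OF \<Lambda>_field F f, of p] by (simp add: on_diffs_def \<Lambda>_apply)
    finally show "X p f = ham_field E \<Lambda> F p f" .
  qed
  then show ?thesis using that[OF F] by blast
qed

text \<open>The vertical part of a Poisson field \<open>Z\<close> is congruent to \<open>Z\<close> modulo \<open>H\<close> and projects to zero, so it is
  a Poisson field of \<open>P\<close>, hence Hamiltonian. Removing the corresponding Hamiltonian field of \<open>\<Lambda>\<close>
  leaves a horizontal Poisson field.\<close>

lemma Poiss_subset_Ham: "Poiss E \<Lambda> \<subseteq> Ham E \<Lambda>"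
proof
  fix Z assume Z: "Z \<in> Poiss E \<Lambda>"
  have Zv: "Z \<in> VF" by (rule PoissD(1)[OF Z])
  obtain h where h: "h \<in> VF" "\<And>p. h p \<in> H p" "\<And>p. Z p - h p \<in> V p"
    by (rule projection_field[OF H_framed Zv]) (rule that)
  have W: "(\<lambda>q. Z q - h q) \<in> VF" by (rule vector_field_diff[OF Zv h(1)])
  have "preserves E (\<lambda>q. Z q - h q) P"
  proof (rule projectable_congruent_preserves_P[OF Z W])
    show "(Z q - h q) - Z q \<in> H q" for q
      using subspace_diff[OF H_D(1) subspace_0[OF H_D(1)] h(2)[of q]] by simp
    show "\<exists>g'\<in>Cinf B. \<forall>q. (Z q - h q) (basic g) = g' (\<pi> q)" if "g \<in> Cinf B" for g
      using vertical_basic[OF h(3) that] base.Cinf_const[of 0] by (intro bexI[of _ "\<lambda>_. 0"]) auto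
  qed
  then have "(\<lambda>q. Z q - h q) \<in> Poiss_V E B \<pi> P"
    using W h(3) by (auto simp: Poiss_V_def sections_def)
  then obtain F where F: "F \<in> C" "(\<lambda>q. Z q - h q) = ham_field E P F"
    unfolding Poiss_V Ham_def by auto
  define X where "X q = Z q - ham_field E \<Lambda> F q" for q
  have FP: "ham_field E \<Lambda> F \<in> Poiss E \<Lambda>" using Ham_subset_Poiss[OF poisson] F(1) by (auto simp: Ham_def)
  have X: "X \<in> Poiss E \<Lambda>" unfolding X_def[abs_def] by (rule Poiss_diff[OF \<Lambda>_field Z FP])
  have "X q = h q - ham_field E Q F q" for q
    using fun_cong[OF F(2), of q] ham_decomposition[OF F(1), of q] by (simp add: X_def algebra_simps)
  then have XH: "X q \<in> H q" for q
    using subspace_diff[OF H_D(1) h(2) ham_Q_horizontal[OF F(1)]] by simp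
  obtain G where G: "G \<in> C" "X = ham_field E \<Lambda> G"
    by (rule horizontal_poisson_hamiltonian[OF X XH]) (rule that)
  have "Z q = ham_field E \<Lambda> (\<lambda>q. 1 * F q + 1 * G q) q" for q
    using ham_field_linear[OF \<Lambda>_field F(1) G(1), of 1 1 q] fun_cong[OF G(2), of q] by (simp add: X_def algebra_simps)
  then have "Z = ham_field E \<Lambda> (\<lambda>q. 1 * F q + 1 * G q)" by blast
  moreover have "(\<lambda>q. 1 * F q + 1 * G q) \<in> C" by (intro Cinf_intros F G)
  ultimately show "Z \<in> Ham E \<Lambda>" unfolding Ham_def by blast
qed

lemma poisson_H1_trivial: "poisson_H1 E \<Lambda> = {Ham E \<Lambda>}"
proof -
  have "Poiss E \<Lambda> = Ham E \<Lambda>" using Poiss_subset_Ham Ham_subset_Poiss[OF poisson] by blast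
  moreover have "quotient_space (Ham E \<Lambda>) (Ham E \<Lambda>) = {Ham E \<Lambda>}"
  proof (rule quotient_space_self)
    show "Ham E \<Lambda> \<noteq> {}" using Cinf_const by (auto simp: Ham_def)
    fix Y Z assume "Y \<in> Ham E \<Lambda>" "Z \<in> Ham E \<Lambda>"
    then have "(\<lambda>q. Y q - Z q) \<in> Ham E \<Lambda>"
      using Poiss_diff[OF \<Lambda>_field, of Y Z] Poiss_subset_Ham Ham_subset_Poiss[OF poisson] by blast
    then show "Y - Z \<in> Ham E \<Lambda>" by (simp add: fun_diff_def)
  qed
  ultimately show ?thesis by (simp add: poisson_H1_def)
qed

end

theorem theorem3:
  fixes E :: "('e::{t2_space,second_countable_topology}, 'm::model_space) chart set"
    and B :: "('b::{t2_space,second_countable_topology}, 'n::model_space) chart set"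
    and \<pi> :: "'e \<Rightarrow> 'b"
    and \<Lambda> P :: "'e \<Rightarrow> 'e bivec"
    and TF :: "'e \<Rightarrow> 'e tvec set"
  assumes "smooth_manifold E" and "smooth_manifold B"
    and "fiber_bundle E B \<pi>"
    and "coupling_poisson E B \<pi> \<Lambda>"
    and "vertical_part E B \<pi> \<Lambda> P"
    and "Poiss_V E B \<pi> P = Ham E P"
    and "foliation E TF"
    and "\<And>p. direct_sum (tangent E p) (TF p) (vertical E B \<pi> p)"
    and "\<And>Z. Z \<in> projectable_sections E B \<pi> TF \<Longrightarrow> preserves E Z P"
    and "fol_H1 E TF = {fol_B1 E TF}"
    and "Ham_fol E B \<pi> TF P = {ham_field E P H |H. H \<in> Cinf_fol E TF}"
  shows "poisson_H1 E \<Lambda> = {Ham E \<Lambda>}"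
proof -
  obtain Q where "P \<in> bivector_sections E (vertical E B \<pi>)"
    "Q \<in> bivector_sections E (coupling_horizontal E B \<pi> \<Lambda>)" "\<Lambda> = Q + P"
    using assms(5) by (auto simp: vertical_part_def)
  with assms interpret flat_coupling E B \<pi> \<Lambda> P Q TF
    by unfold_locales auto
  show ?thesis by (rule poisson_H1_trivial)
qed

end
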